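(* Let $k\ge3$, $m\ge3$ and $0<\alpha<1$. Among all $k$-uniform linear unicyclic hypergraphs with $m$ hyperedges, the first hypergraph in $S_\alpha$-order is the hypercycle $C_m^{(k)}$.
   Context: Hypergraphs are finite; $k$-uniform means every hyperedge has exactly $k$ vertices; linear means any two distinct hyperedges share at most one vertex; unicyclic means connected with exactly one cycle. The hypercycle $C_m^{(k)}$ is obtained from the cycle graph with $m$ edges by inserting $k-2$ new vertices (of degree one) into each edge. For a $k$-uniform hypergraph $\mathcal{H}$ on $[n]$, $\mathcal{A}(\mathcal{H})$ is the $k$-order $n$-dimensional tensor with entry $\frac1{(k-1)!}$ at $(i_1,\dots,i_k)$ if $\{i_1,\dots,i_k\}\in E(\mathcal{H})$ and $0$ otherwise; $\mathcal{D}(\mathcal{H})$ is the diagonal tensor of vertex degrees; $\mathcal{A}_\alpha(\mathcal{H})=\alpha\mathcal{D}(\mathcal{H})+(1-\alpha)\mathcal{A}(\mathcal{H})$. For a tensor $\mathcal{T}$, $\mathrm{Tr}_d(\mathcal{T})$ is the sum of the $d$-th powers of all $n(k-1)^{n-1}$ eigenvalues of $\mathcal{T}$ (roots of its characteristic polynomial, with multiplicity); in particular $\mathrm{Tr}_0(\mathcal{T})=n(k-1)^{n-1}$, and for $d\ge1$ $$\mathrm{Tr}_{d}(\mathcal{T})=(k-1)^{n-1}\sum_{d_1+\cdots+d_n=d}\ \prod_{i=1}^{n}\frac{1}{(d_i(k-1))!}\Big(\sum_{\gamma\in[n]^{k-1}}(\mathcal{T})_{i\gamma}\frac{\partial}{\partial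 a_{i\gamma}}\Big)^{d_i}\mathrm{tr}\big(A^{d(k-1)}\big),$$ with $A=(a_{ij})$ an $n\times n$ matrix of indeterminates, $d_i\ge0$ integers, $\frac{\partial}{\partial a_{i\gamma}}=\frac{\partial}{\partial a_{i i_2}}\cdots\frac{\partial}{\partial a_{i i_k}}$ for $\gamma=i_2\cdots i_k$. $S_\alpha$-order: for $k$-uniform hypergraphs $\mathcal{H}_1,\mathcal{H}_2$ with $n$ vertices, $\mathcal{H}_1\prec_\alpha\mathcal{H}_2$ if there is $d\in\{1,\dots,n(k-1)^{n-1}-1\}$ with $\mathrm{Tr}_t(\mathcal{A}_\alpha(\mathcal{H}_1))=\mathrm{Tr}_t(\mathcal{A}_\alpha(\mathcal{H}_2))$ for $t=0,\dots,d-1$ and $\mathrm{Tr}_d(\mathcal{A}_\alpha(\mathcal{H}_1))<\mathrm{Tr}_d(\mathcal{A}_\alpha(\mathcal{H}_2))$. "$X$ is the first hypergraph in a class" means $X$ is in the class and $X\prec_\alpha\mathcal{H}$ for every $\mathcal{H}$ in the class not isomorphic to $X$. *)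

theory Defs
  imports Complex_Main "HOL-Library.Poly_Mapping" "HOL-Library.FuncSet"
    "Jordan_Normal_Form.Matrix"
begin

section \<open>Hypergraphs\<close>

text \<open>Hypergraphs are labelled: \<open>[n]\<close> is rendered as \<open>{0..<n}\<close>, and all of it is the vertex set.\<close>

record hypergraph =
  nverts :: nat
  edges :: "nat set set"

definition verts :: "hypergraph \<Rightarrow> nat set" where
  "verts H = {0..<nverts H}"

definition is_hypergraph :: "hypergraph \<Rightarrow> bool" where
  "is_hypergraph H \<longleftrightarrow> (\<forall>e\<in>edges H. e \<noteq> {} \<and> e \<subseteq> verts H)"

definition uniform :: "nat \<Rightarrow> hypergraph \<Rightarrow> bool" where
  "uniform k H \<longleftrightarrow> (\<forall>e\<in>edges H. card e = k)"

definition linear_hypergraph :: "hypergraph \<Rightarrow> bool" where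
  "linear_hypergraph H \<longleftrightarrow>
     (\<forall>e\<in>edges H. \<forall>f\<in>edges H. e \<noteq> f \<longrightarrow> card (e \<inter> f) \<le> 1)"

definition vertex_degree :: "hypergraph \<Rightarrow> nat \<Rightarrow> nat" where
  "vertex_degree H v = card {e \<in> edges H. v \<in> e}"

definition adjacent :: "hypergraph \<Rightarrow> (nat \<times> nat) set" where
  "adjacent H = {(u, v). \<exists>e\<in>edges H. u \<in> e \<and> v \<in> e}"

definition connected_hypergraph :: "hypergraph \<Rightarrow> bool" where
  "connected_hypergraph H \<longleftrightarrow>
     verts H \<noteq> {} \<and> (\<forall>u\<in>verts H. \<forall>v\<in>verts H. (u, v) \<in> (adjacent H)\<^sup>*)"

text \<open>
  A closed sequence \<open>v\<^sub>0 e\<^sub>0 v\<^sub>1 e\<^sub>1 \<dots> v\<^sub>l\<^sub>-\<^sub>1 e\<^sub>l\<^sub>-\<^sub>1 v\<^sub>0\<close> with \<open>l \<ge> 2\<close>, distinct vertices and distinct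
  hyperedges, in which \<open>e\<^sub>i\<close> contains \<open>v\<^sub>i\<close> and its cyclic successor.
\<close>
definition cycle_seq :: "hypergraph \<Rightarrow> nat list \<Rightarrow> nat set list \<Rightarrow> bool" where
  "cycle_seq H vs es \<longleftrightarrow>
     length vs \<ge> 2 \<and> length es = length vs \<and> distinct vs \<and> distinct es \<and>
     set es \<subseteq> edges H \<and>
     (\<forall>i<length vs. vs ! i \<in> es ! i \<and> vs ! (Suc i mod length vs) \<in> es ! i)"

text \<open>
  Sequences that differ by a rotation or a reversal are the same cycle. The set of the
  incidences used determines a sequence exactly up to these, so it serves as the cycle itself.
\<close>
definition cycle_incidences :: "nat list \<Rightarrow> nat set list \<Rightarrow> (nat \<times> nat set) set" where
  "cycle_incidences vs es =
     (\<Union>i<length vs. {(vs ! i, es ! i), (vs ! (Suc i mod length vs), es ! i)})"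

definition cycles :: "hypergraph \<Rightarrow> (nat \<times> nat set) set set" where
  "cycles H = {cycle_incidences vs es | vs es. cycle_seq H vs es}"

definition unicyclic :: "hypergraph \<Rightarrow> bool" where
  "unicyclic H \<longleftrightarrow> connected_hypergraph H \<and> (\<exists>!C. C \<in> cycles H)"

definition isomorphic :: "hypergraph \<Rightarrow> hypergraph \<Rightarrow> bool" where
  "isomorphic G H \<longleftrightarrow>
     (\<exists>f. bij_betw f (verts G) (verts H) \<and> (\<lambda>e. f ` e) ` edges G = edges H)"

definition linear_unicyclic_hypergraphs :: "nat \<Rightarrow> nat \<Rightarrow> hypergraph set" where
  "linear_unicyclic_hypergraphs k m =
     {H. is_hypergraph H \<and> uniform k H \<and> linear_hypergraph H \<and> unicyclic H \<and> card (edges H) = m}"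

text \<open>
  \<open>0, \<dots>, m - 1\<close> are the vertices of the cycle graph; its \<open>j\<close>-th edge receives the \<open>k - 2\<close> new
  vertices \<open>m + j (k - 2), \<dots>, m + (j + 1) (k - 2) - 1\<close>.
\<close>
definition hypercycle :: "nat \<Rightarrow> nat \<Rightarrow> hypergraph" where
  "hypercycle k m =
     \<lparr>nverts = m + m * (k - 2),
      edges = (\<lambda>j. {j, Suc j mod m} \<union> {m + j * (k - 2)..<m + Suc j * (k - 2)}) ` {0..<m}\<rparr>"


section \<open>Tensors\<close>

text \<open>A tensor of order \<open>k\<close> and dimension \<open>n\<close>: only the entries at index lists of length \<open>k\<close>
  over \<open>{0..<n}\<close> are relevant.\<close>

type_synonym tensor = "nat list \<Rightarrow> real"

definition adjacency_tensor :: "nat \<Rightarrow> hypergraph \<Rightarrow> tensor" where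
  "adjacency_tensor k H is =
     (if length is = k \<and> set is \<in> edges H then 1 / fact (k - 1) else 0)"

definition degree_tensor :: "nat \<Rightarrow> hypergraph \<Rightarrow> tensor" where
  "degree_tensor k H is =
     (if is = replicate k (hd is) then real (vertex_degree H (hd is)) else 0)"

definition A_alpha :: "nat \<Rightarrow> real \<Rightarrow> hypergraph \<Rightarrow> tensor" where
  "A_alpha k \<alpha> H is = \<alpha> * degree_tensor k H is + (1 - \<alpha>) * adjacency_tensor k H is"


section \<open>Traces of tensors\<close>

text \<open>Real polynomials in the indeterminates \<open>a\<^sub>i\<^sub>j\<close>, indexed by pairs \<open>(i, j)\<close>.\<close>

type_synonym entry_poly = "((nat \<times> nat) \<Rightarrow>\<^sub>0 nat) \<Rightarrow>\<^sub>0 real"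

definition Const :: "real \<Rightarrow> entry_poly" where
  "Const c = Poly_Mapping.single 0 c"

definition Indet :: "nat \<times> nat \<Rightarrow> entry_poly" where
  "Indet v = Poly_Mapping.single (Poly_Mapping.single v 1) 1"

text \<open>The formal partial derivative; the summands in which \<open>v\<close> does not occur vanish.\<close>

definition pdiff :: "nat \<times> nat \<Rightarrow> entry_poly \<Rightarrow> entry_poly" where
  "pdiff v p =
     (\<Sum>t\<in>Poly_Mapping.keys p.
        Poly_Mapping.single (t - Poly_Mapping.single v 1)
          (real (Poly_Mapping.lookup t v) * Poly_Mapping.lookup p t))"

definition pdiff_word :: "nat \<Rightarrow> nat list \<Rightarrow> entry_poly \<Rightarrow> entry_poly" where
  "pdiff_word i \<gamma> = foldr (\<lambda>j. pdiff (i, j)) \<gamma>"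

definition row_operator :: "nat \<Rightarrow> nat \<Rightarrow> tensor \<Rightarrow> nat \<Rightarrow> entry_poly \<Rightarrow> entry_poly" where
  "row_operator k n T i p =
     (\<Sum>\<gamma> | length \<gamma> = k - 1 \<and> set \<gamma> \<subseteq> {0..<n}. Const (T (i # \<gamma>)) * pdiff_word i \<gamma> p)"

definition indet_mat :: "nat \<Rightarrow> entry_poly mat" where
  "indet_mat n = mat n n Indet"

definition mat_trace :: "'a::comm_monoid_add mat \<Rightarrow> 'a" where
  "mat_trace M = (\<Sum>i<dim_row M. M $$ (i, i))"

text \<open>
  The sum of the \<open>d\<close>-th powers of the eigenvalues of \<open>T\<close>, given for \<open>d \<ge> 1\<close> by the trace formula
  of Morozov and Shakirov. The operators there have total order \<open>d (k - 1)\<close> and act on a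
  homogeneous polynomial of that same degree, so the result is a constant polynomial, and
  \<open>lookup _ 0\<close> reads off its value. The rational factors are taken out of the (linear) operators.
  The bound \<open>{..d}\<close> is implied by the sum condition.
\<close>
definition Tr :: "nat \<Rightarrow> nat \<Rightarrow> nat \<Rightarrow> tensor \<Rightarrow> real" where
  "Tr k n d T =
     (if d = 0 then real (n * (k - 1) ^ (n - 1))
      else real ((k - 1) ^ (n - 1)) *
        (\<Sum>ds | ds \<in> {0..<n} \<rightarrow>\<^sub>E {..d} \<and> (\<Sum>i\<in>{0..<n}. ds i) = d.
           (\<Prod>i\<in>{0..<n}. 1 / fact (ds i * (k - 1))) *
           Poly_Mapping.lookup
             (foldr (\<lambda>i. row_operator k n T i ^^ ds i) [0..<n]
                (mat_trace (indet_mat n ^\<^sub>m (d * (k - 1))))) 0))"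


section \<open>The order\<close>

definition S_alpha_less :: "nat \<Rightarrow> real \<Rightarrow> hypergraph \<Rightarrow> hypergraph \<Rightarrow> bool" where
  "S_alpha_less k \<alpha> G H \<longleftrightarrow>
     (\<exists>n. nverts G = n \<and> nverts H = n \<and>
        (\<exists>d\<in>{1..n * (k - 1) ^ (n - 1) - 1}.
           (\<forall>t<d. Tr k n t (A_alpha k \<alpha> G) = Tr k n t (A_alpha k \<alpha> H)) \<and>
           Tr k n d (A_alpha k \<alpha> G) < Tr k n d (A_alpha k \<alpha> H)))"

definition first_in_S_alpha_order :: "nat \<Rightarrow> real \<Rightarrow> hypergraph set \<Rightarrow> hypergraph \<Rightarrow> bool" where
  "first_in_S_alpha_order k \<alpha> \<C> X \<longleftrightarrow>
     X \<in> \<C> \<and> (\<forall>H\<in>\<C>. \<not> isomorphic H X \<longrightarrow> S_alpha_less k \<alpha> X H)"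

end

theory Submission
  imports Defs "HOL-Library.Transitive_Closure_Table"
begin

text \<open>
Expanding the trace formula, \<open>Tr\<^sub>d\<close> is a sum over lists of \<open>d\<close> index lists; such a list contributes only if the
arcs it prescribes form a closed walk. For a linear \<open>k\<close>-uniform hypergraph and \<open>d \<le> k + 2\<close>, a balance
argument at every vertex leaves two kinds of lists: \<open>d\<close> diagonal entries at one vertex, and one
hyperedge used \<open>k\<close> times, once from each of its vertices, plus \<open>d - k\<close> diagonal entries at these vertices.
Their weights are invariant under permutations of the vertices, so \<open>Tr\<^sub>d\<close> depends only on the sums
\<open>\<Sum>\<^sub>v deg(v)\<^sup>d\<close>, and for \<open>d \<ge> k\<close> also on sums over hyperedges of polynomials in the degrees.

All hypergraphs in question have \<open>m (k - 1)\<close> vertices and the same degree sum. \<open>Tr\<^sub>2\<close> compares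
\<open>\<Sum>\<^sub>v deg(v)\<^sup>2\<close>, which is minimal exactly if all degrees are \<open>1\<close> or \<open>2\<close>. In that case the traces agree up to
\<open>d = k + 1\<close>, and \<open>Tr\<^sub>k\<^sub>+\<^sub>2\<close> compares \<open>\<Sum>\<^sub>e (\<Sum>\<^sub>v\<^sub>\<in>\<^sub>e deg(v))\<^sup>2\<close>; the inner sums have mean \<open>k + 2\<close>, so the minimum is
attained only if each hyperedge has exactly two vertices of degree \<open>2\<close>, which forces the hypercycle.
\<close>

section \<open>Expansion of the trace formula\<close>

text \<open>The coefficients of the expansion are sums over closed walks and are never evaluated.
  Permutation invariance makes them common to all hypergraphs with the same number of vertices, and
  their sign matters at two places only: for \<open>d\<close> diagonal entries at one vertex, which
  decides at \<open>d = 2\<close>, and for diagonal entries at two different vertices of a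
  hyperedge, which decides at \<open>d = k + 2\<close>. A vertex repeated in a hyperedge comes with
  the sum of \<open>deg(v)^3\<close>; if all degrees are \<open>1\<close> or \<open>2\<close>, this
  sum is determined by the degree sum, so the sign of its coefficient is immaterial.

  The order \<open>k + 2\<close> arises as follows. Hyperedges enter at \<open>d = k\<close> with a
  constant each, at \<open>d = k + 1\<close> with the sum of \<open>deg(v)^2\<close>, and only at
  \<open>d = k + 2\<close> are the degrees of two vertices of one hyperedge multiplied. As
  \<open>k\<close> is at least \<open>3\<close>, the comparison at \<open>d = 2\<close> takes place
  before hyperedges contribute.

  The degree sum \<open>k m\<close> exceeds the number of vertices by \<open>m\<close>, so degrees
  in \<open>{1, 2}\<close> mean exactly \<open>m\<close> vertices of degree \<open>2\<close>. Then
  the sum of \<open>deg(v)^2\<close> is \<open>m (k - 1) + 3 m\<close>, and division by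
  \<open>m\<close> gives the mean \<open>k + 2\<close>.\<close>

lemma lookup_pdiff:
  "Poly_Mapping.lookup (pdiff v p) t =
     real (Poly_Mapping.lookup t v + 1) * Poly_Mapping.lookup p (t + Poly_Mapping.single v 1)"
proof -
  let ?s = "t + Poly_Mapping.single v (1::nat)"
  have *: "Poly_Mapping.lookup (Poly_Mapping.single (u - Poly_Mapping.single v 1)
          (real (Poly_Mapping.lookup u v) * Poly_Mapping.lookup p u)) t
      = (if u = ?s then real (Poly_Mapping.lookup t v + 1) * Poly_Mapping.lookup p ?s else 0)" for u
  proof (cases "u = ?s")
    case True
    then show ?thesis by (simp add: lookup_add)
  next
    case False
    then show ?thesis
    \<comment> \<open>Subtraction of exponents truncates, so a monomial \<open>u\<close> without
      \<open>v\<close> could also be sent to \<open>t\<close>; its factor is then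
      \<open>0\<close>.\<close>
    proof (cases "Poly_Mapping.lookup u v = 0")
      case False
      then have "u = (u - Poly_Mapping.single v 1) + Poly_Mapping.single v 1"
        by (intro poly_mapping_eqI) (auto simp: lookup_add lookup_minus lookup_single when_def)
      then have "u - Poly_Mapping.single v 1 \<noteq> t" using \<open>u \<noteq> ?s\<close> by metis
      then show ?thesis using \<open>u \<noteq> ?s\<close> by (simp add: lookup_single when_def)
    qed simp
  qed
  show ?thesis unfolding pdiff_def lookup_sum *
    by (auto simp: sum.delta[OF finite_keys] in_keys_iff)
qed

lemma lookup_Const_mult: "Poly_Mapping.lookup (Const c * p) t = c * Poly_Mapping.lookup p t"
  unfolding Const_def mult_map_scale_conv_mult[symmetric]
  by (simp add: Poly_Mapping.map.rep_eq when_def)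

lemma pdiff_commute: "pdiff u (pdiff v p) = pdiff v (pdiff u p)"
  by (intro poly_mapping_eqI) (auto simp: lookup_pdiff lookup_add lookup_single when_def add_ac)

lemma pdiff_add: "pdiff v (p + q) = pdiff v p + pdiff v q"
  by (intro poly_mapping_eqI) (simp add: lookup_pdiff lookup_add distrib_left)

lemma pdiff_zero: "pdiff v 0 = 0"
  by (intro poly_mapping_eqI) (simp add: lookup_pdiff)

lemma pdiff_Const_mult: "pdiff v (Const c * p) = Const c * pdiff v p"
  by (intro poly_mapping_eqI) (simp add: lookup_pdiff lookup_Const_mult)

lemma pdiff_sum: "pdiff v (sum f A) = (\<Sum>a\<in>A. pdiff v (f a))"
  by (induction A rule: infinite_finite_induct) (simp_all add: pdiff_zero pdiff_add)

definition pdiffs :: "(nat \<times> nat) list \<Rightarrow> entry_poly \<Rightarrow> entry_poly" where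
  "pdiffs as = foldr pdiff as"

lemma pdiffs_Nil [simp]: "pdiffs [] p = p"
  and pdiffs_Cons [simp]: "pdiffs (a # as) p = pdiff a (pdiffs as p)"
  and pdiffs_append: "pdiffs (as @ bs) p = pdiffs as (pdiffs bs p)"
  by (simp_all add: pdiffs_def)

lemma pdiffs_Const_mult: "pdiffs as (Const c * p) = Const c * pdiffs as p"
  by (induction as) (simp_all add: pdiff_Const_mult)

lemma pdiffs_sum: "pdiffs as (sum f A) = (\<Sum>a\<in>A. pdiffs as (f a))"
  by (induction as) (simp_all add: pdiff_sum)

lemma pdiffs_pdiff: "pdiffs as (pdiff v p) = pdiff v (pdiffs as p)"
  by (induction as) (simp_all add: pdiff_commute)

lemma pdiffs_commute: "pdiffs as (pdiffs bs p) = pdiffs bs (pdiffs as p)"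
  by (induction bs) (simp_all add: pdiffs_pdiff)

text \<open>The indeterminates by which the operator of the tensor entry at \<open>x\<close>
  differentiates, read as arcs from the row index to each of the other indices.\<close>

definition arcs_of :: "nat list \<Rightarrow> (nat \<times> nat) list" where
  "arcs_of x = map (Pair (hd x)) (tl x)"

lemma pdiff_word_eq: "pdiff_word i \<gamma> p = pdiffs (arcs_of (i # \<gamma>)) p"
  by (induction \<gamma>) (simp_all add: pdiff_word_def pdiffs_def arcs_of_def)

definition index_lists :: "nat \<Rightarrow> nat \<Rightarrow> nat list set" where
  "index_lists n l = {\<gamma>. length \<gamma> = l \<and> set \<gamma> \<subseteq> {0..<n}}"

lemma finite_index_lists: "finite (index_lists n l)"
  unfolding index_lists_def using finite_lists_length_eq[of "{0..<n}" l]
  by (simp add: conj_commute)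

lemma row_operator_eq:
  "row_operator k n T i p =
     (\<Sum>\<gamma>\<in>index_lists n (k - 1). Const (T (i # \<gamma>)) * pdiffs (arcs_of (i # \<gamma>)) p)"
  unfolding row_operator_def index_lists_def pdiff_word_eq ..

lemma row_operator_commute:
  "row_operator k n T i (row_operator k n T j p) = row_operator k n T j (row_operator k n T i p)"
  unfolding row_operator_eq pdiffs_sum pdiffs_Const_mult sum_distrib_left
  by (subst sum.swap) (simp add: mult_ac pdiffs_commute)

definition rows_op :: "nat \<Rightarrow> nat \<Rightarrow> tensor \<Rightarrow> nat list \<Rightarrow> entry_poly \<Rightarrow> entry_poly" where
  "rows_op k n T = foldr (row_operator k n T)"

lemma rows_op_mset_cong:
  assumes "mset rs = mset rs'"
  shows "rows_op k n T rs = rows_op k n T rs'"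
proof -
  have "fold (row_operator k n T) (rev rs) = fold (row_operator k n T) (rev rs')"
    by (rule fold_multiset_equiv) (use assms in \<open>auto simp: fun_eq_iff row_operator_commute\<close>)
  then show ?thesis by (simp add: rows_op_def foldr_conv_fold)
qed

lemma foldr_rows_op:
  "foldr (\<lambda>i. row_operator k n T i ^^ ds i) is p = rows_op k n T (concat (map (\<lambda>i. replicate (ds i) i) is)) p"
proof (induction "is")
  case (Cons i js)
  have *: "foldr f (replicate l i) = f i ^^ l" for f :: "nat \<Rightarrow> entry_poly \<Rightarrow> entry_poly" and l
    by (induction l) (auto simp: fun_eq_iff)
  show ?case using Cons by (simp add: rows_op_def *)
qed (simp add: rows_op_def)

definition arcs :: "nat list list \<Rightarrow> (nat \<times> nat) list" where
  "arcs xs = concat (map arcs_of xs)"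

definition index_words :: "nat \<Rightarrow> nat \<Rightarrow> nat list \<Rightarrow> nat list list set" where
  "index_words n k rs = {xs. map hd xs = rs \<and> (\<forall>x\<in>set xs. x \<noteq> [] \<and> tl x \<in> index_lists n (k - 1))}"

lemma index_words_Nil: "index_words n k [] = {[]}"
  by (auto simp: index_words_def)

lemma index_words_Cons:
  "index_words n k (r # rs) = (\<lambda>(\<gamma>, xs). (r # \<gamma>) # xs) ` (index_lists n (k - 1) \<times> index_words n k rs)"
proof (intro equalityI subsetI)
  fix ys assume "ys \<in> index_words n k (r # rs)"
  then obtain y xs where "ys = y # xs" "hd y = r" "y \<noteq> []" "tl y \<in> index_lists n (k - 1)" "xs \<in> index_words n k rs"
    by (auto simp: index_words_def)
  then show "ys \<in> (\<lambda>(\<gamma>, xs). (r # \<gamma>) # xs) ` (index_lists n (k - 1) \<times> index_words n k rs)"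
    by (intro image_eqI[of _ _ "(tl y, xs)"]) auto
qed (auto simp: index_words_def)

lemma rows_op_expand:
  "rows_op k n T rs p = (\<Sum>xs\<in>index_words n k rs. Const (\<Prod>x\<leftarrow>xs. T x) * pdiffs (arcs xs) p)"
proof (induction rs)
  case Nil
  show ?case by (simp add: rows_op_def index_words_Nil arcs_def Const_def)
next
  case (Cons r rs)
  have Const_mult: "Const (a * b) = Const a * Const b" for a b
    by (simp add: Const_def mult_single)
  have "rows_op k n T (r # rs) p = row_operator k n T r (rows_op k n T rs p)"
    by (simp add: rows_op_def)
  also have "\<dots> = (\<Sum>\<gamma>\<in>index_lists n (k - 1). \<Sum>xs\<in>index_words n k rs.
      Const (\<Prod>x\<leftarrow>(r # \<gamma>) # xs. T x) * pdiffs (arcs ((r # \<gamma>) # xs)) p)"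
    unfolding Cons row_operator_eq
    by (simp add: pdiffs_sum pdiffs_Const_mult sum_distrib_left Const_mult mult_ac arcs_def pdiffs_append)
  also have "\<dots> = (\<Sum>xs\<in>index_words n k (r # rs). Const (\<Prod>x\<leftarrow>xs. T x) * pdiffs (arcs xs) p)"
    unfolding index_words_Cons sum.cartesian_product
    by (subst sum.reindex) (auto simp: inj_on_def case_prod_beta)
  finally show ?case .
qed

section \<open>Monomials as multisets of arcs, and traces of matrix powers as sums over closed
  walks\<close>

definition monom_of :: "(nat \<times> nat) list \<Rightarrow> (nat \<times> nat) \<Rightarrow>\<^sub>0 nat" where
  "monom_of as = (\<Sum>a\<leftarrow>as. Poly_Mapping.single a 1)"

lemma lookup_monom_of: "Poly_Mapping.lookup (monom_of as) a = count (mset as) a"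
  by (induction as) (auto simp: monom_of_def lookup_add lookup_single when_def)

lemma monom_of_eq_iff: "monom_of as = monom_of bs \<longleftrightarrow> mset as = mset bs"
  by (metis lookup_monom_of multiset_eqI poly_mapping_eqI)

lemma monom_of_Cons: "monom_of (a # as) = Poly_Mapping.single a 1 + monom_of as"
  by (simp add: monom_of_def)

text \<open>The closed walk has a marked start: rotations of \<open>ws\<close> have the same arcs up
  to order but are separate summands of the trace.\<close>

definition cyclic_arcs :: "'a list \<Rightarrow> ('a \<times> 'a) list" where
  "cyclic_arcs ws = zip ws (rotate1 ws)"

text \<open>Matrix multiplication concatenates walks; \<open>us\<close> lists the inner vertices of
  a walk from \<open>i\<close> to \<open>j\<close> with \<open>Suc l\<close> arcs.\<close>

lemma indet_mat_power:
  assumes "i < n" "j < n"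
  shows "(indet_mat n ^\<^sub>m Suc l) $$ (i, j) =
    (\<Sum>us\<in>index_lists n l. Poly_Mapping.single (monom_of (zip (i # us) (us @ [j]))) 1)"
  using assms
proof (induction l arbitrary: j)
  case 0
  have "index_lists n 0 = {[]}" by (auto simp: index_lists_def)
  with 0 show ?case by (simp add: indet_mat_def Indet_def monom_of_def)
next
  case (Suc l)
  have dim: "indet_mat n ^\<^sub>m Suc l \<in> carrier_mat n n" "indet_mat n \<in> carrier_mat n n"
    by (auto simp: indet_mat_def intro!: pow_carrier_mat mult_carrier_mat)
  \<comment> \<open>Matrix powers multiply by the new factor on the right, so a walk is extended at
    its end.\<close>
  have snoc: "index_lists n (Suc l) = (\<lambda>(us, v). us @ [v]) ` (index_lists n l \<times> {0..<n})"
  proof (intro equalityI subsetI)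
    fix us assume "us \<in> index_lists n (Suc l)"
    then have "us = butlast us @ [last us]" "butlast us \<in> index_lists n l" "last us \<in> {0..<n}"
      by (auto simp: index_lists_def dest: in_set_butlastD
          intro!: append_butlast_last_id[symmetric]) (metis last_in_set length_0_conv nat.distinct(1) subsetD atLeastLessThan_iff)
    then show "us \<in> (\<lambda>(us, v). us @ [v]) ` (index_lists n l \<times> {0..<n})"
      by (metis (no_types, lifting) SigmaI case_prod_conv image_eqI)
  qed (auto simp: index_lists_def)
  have "(indet_mat n ^\<^sub>m Suc (Suc l)) $$ (i, j) =
      (\<Sum>v\<in>{0..<n}. (indet_mat n ^\<^sub>m Suc l) $$ (i, v) * Indet (v, j))"
    using dim Suc.prems by (simp add: scalar_prod_def) (simp add: indet_mat_def)
  also have "\<dots> = (\<Sum>us\<in>index_lists n l. \<Sum>v\<in>{0..<n}.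
      Poly_Mapping.single (monom_of (zip (i # us) (us @ [v]) @ [(v, j)])) 1)"
    by (subst sum.swap, rule sum.cong[OF refl])
      (simp add: Suc.IH[OF Suc.prems(1)] sum_distrib_right Indet_def mult_single monom_of_def del: pow_mat.simps)
  also have "\<dots> = (\<Sum>us\<in>index_lists n (Suc l). Poly_Mapping.single (monom_of (zip (i # us) (us @ [j]))) 1)"
    unfolding snoc sum.cartesian_product
  proof (subst sum.reindex, force simp: inj_on_def, rule sum.cong[OF refl], clarsimp)
    fix us v assume "us \<in> index_lists n l"
    have "zip (i # us @ [v]) (us @ [v, j]) = zip ((i # us) @ [v]) ((us @ [v]) @ [j])" by simp
    also have "\<dots> = zip (i # us) (us @ [v]) @ [(v, j)]" by (subst zip_append) auto
    finally show "Poly_Mapping.single (monom_of (zip (i # us) (us @ [v]) @ [(v, j)])) 1 =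
      Poly_Mapping.single (monom_of (zip (i # us @ [v]) (us @ [v, j]))) 1" by simp
  qed
  finally show ?case .
qed

lemma trace_indet_mat_power:
  assumes "l > 0"
  shows "mat_trace (indet_mat n ^\<^sub>m l) =
    (\<Sum>ws\<in>index_lists n l. Poly_Mapping.single (monom_of (cyclic_arcs ws)) 1)"
proof -
  obtain l' where l: "l = Suc l'" using assms gr0_implies_Suc by blast
  have cons: "index_lists n l = (\<lambda>(i, us). i # us) ` ({0..<n} \<times> index_lists n l')"
    unfolding l
  proof (intro equalityI subsetI)
    fix us assume "us \<in> index_lists n (Suc l')"
    then show "us \<in> (\<lambda>(i, us). i # us) ` ({0..<n} \<times> index_lists n l')"
      by (cases us) (auto simp: index_lists_def)
  qed (auto simp: index_lists_def)
  have "dim_row (indet_mat n ^\<^sub>m l) = n"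
    using l by (auto simp: indet_mat_def)
  then have "mat_trace (indet_mat n ^\<^sub>m l) = (\<Sum>i\<in>{0..<n}. (indet_mat n ^\<^sub>m l) $$ (i, i))"
    by (simp add: mat_trace_def lessThan_atLeast0)
  also have "\<dots> = (\<Sum>i\<in>{0..<n}. \<Sum>us\<in>index_lists n l'.
      Poly_Mapping.single (monom_of (cyclic_arcs (i # us))) 1)"
    unfolding l by (rule sum.cong[OF refl]) (simp add: indet_mat_power cyclic_arcs_def del: pow_mat.simps)
  also have "\<dots> = (\<Sum>ws\<in>index_lists n l. Poly_Mapping.single (monom_of (cyclic_arcs ws)) 1)"
    unfolding cons sum.cartesian_product by (subst sum.reindex) (auto simp: inj_on_def case_prod_beta)
  finally show ?thesis .
qed

text \<open>The factor that differentiating along the arcs \<open>as\<close> produces in front of the monomial of \<open>bs\<close>: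
  the quotient of the factorials of the exponents of \<open>bs @ as\<close> and of \<open>bs\<close>.\<close>

fun deriv_coeff :: "(nat \<times> nat) list \<Rightarrow> (nat \<times> nat) list \<Rightarrow> real" where
  "deriv_coeff bs [] = 1"
| "deriv_coeff bs (a # as) = real (count (mset bs) a + 1) * deriv_coeff (a # bs) as"

lemma deriv_coeff_pos: "deriv_coeff bs as > 0"
  by (induction bs as rule: deriv_coeff.induct) (simp_all add: add_pos_nonneg)

lemma count_mset_map_inj: "inj f \<Longrightarrow> count (mset (map f xs)) (f a) = count (mset xs) a"
  by (induction xs) (auto dest: injD)

lemma deriv_coeff_map: "inj f \<Longrightarrow> deriv_coeff (map f bs) (map f as) = deriv_coeff bs as"
proof (induction bs as rule: deriv_coeff.induct)
  case (2 bs a as)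
  have "count (mset (map f bs)) (f a) = count (mset bs) a"
    by (rule count_mset_map_inj[OF 2(2)])
  with 2 show ?case by simp
qed simp

lemma lookup_pdiffs:
  "Poly_Mapping.lookup (pdiffs as p) (monom_of bs) =
     deriv_coeff bs as * Poly_Mapping.lookup p (monom_of bs + monom_of as)"
proof (induction as arbitrary: bs)
  case Nil
  show ?case by (simp add: monom_of_def)
next
  case (Cons a as)
  have "monom_of bs + Poly_Mapping.single a 1 = monom_of (a # bs)"
    by (simp add: monom_of_def add_ac)
  then show ?case
    using Cons[of "a # bs"] by (simp add: lookup_pdiff lookup_monom_of monom_of_Cons add_ac)
qed

definition circuits :: "nat \<Rightarrow> nat \<Rightarrow> (nat \<times> nat) list \<Rightarrow> nat list set" where
  "circuits n l as = {ws \<in> index_lists n l. mset (cyclic_arcs ws) = mset as}"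

text \<open>Differentiation along \<open>as\<close> leaves a nonzero constant only of the monomial
  of \<open>as\<close> itself. Each closed walk that uses exactly these arcs contributes this
  monomial once.\<close>

lemma lookup_pdiffs_trace:
  assumes "l > 0"
  shows "Poly_Mapping.lookup (pdiffs as (mat_trace (indet_mat n ^\<^sub>m l))) 0 =
    deriv_coeff [] as * real (card (circuits n l as))"
proof -
  have "Poly_Mapping.lookup (mat_trace (indet_mat n ^\<^sub>m l)) (monom_of as) =
      (\<Sum>ws\<in>index_lists n l. if mset (cyclic_arcs ws) = mset as then 1 else 0)"
    unfolding trace_indet_mat_power[OF assms] lookup_sum
    by (intro sum.cong) (auto simp: lookup_single when_def monom_of_eq_iff)
  also have "\<dots> = real (card (circuits n l as))"
    unfolding circuits_def by (simp add: finite_index_lists sum.If_cases Int_def)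
  finally show ?thesis
    using lookup_pdiffs[of as "mat_trace (indet_mat n ^\<^sub>m l)" "[]"] by (simp add: monom_of_def)
qed

section \<open>The trace as a sum over lists of index lists\<close>

definition words :: "nat \<Rightarrow> nat \<Rightarrow> nat \<Rightarrow> nat list list set" where
  "words n k d = {xs. length xs = d \<and> set xs \<subseteq> index_lists n k}"

lemma finite_words: "finite (words n k d)"
  using finite_lists_length_eq[OF finite_index_lists, of n k d] by (simp add: words_def conj_commute)

text \<open>The row operators commute, so all arrangements of a list of rows contribute equally. Dividing by their
  number lets the trace be a sum over all lists instead of sorted ones only; it is this form that is
  invariant under permutations of the vertices.\<close>

definition row_weight :: "nat \<Rightarrow> nat \<Rightarrow> nat list \<Rightarrow> real" where
  "row_weight n k rs =
     (\<Prod>i\<in>{0..<n}. 1 / fact (count (mset rs) i * (k - 1))) / real (card {rs'. mset rs' = mset rs})"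

text \<open>The part of a summand that does not involve the tensor. It vanishes exactly if no closed
  walk runs through precisely the arcs of \<open>xs\<close>.\<close>

definition weight :: "nat \<Rightarrow> nat \<Rightarrow> nat list list \<Rightarrow> real" where
  "weight n k xs = row_weight n k (map hd xs) *
     (deriv_coeff [] (arcs xs) * real (card (circuits n (length xs * (k - 1)) (arcs xs))))"

lemma finite_mset_fibre: "finite {rs'. mset rs' = mset rs}"
proof -
  have "{rs'. mset rs' = mset rs} \<subseteq> {rs'. set rs' \<subseteq> set rs \<and> length rs' = length rs}"
    by (auto dest: mset_eq_setD mset_eq_length)
  then show ?thesis using finite_lists_length_eq[of "set rs"] finite_subset by blast
qed

definition row_list :: "nat \<Rightarrow> (nat \<Rightarrow> nat) \<Rightarrow> nat list" where
  "row_list n ds = concat (map (\<lambda>i. replicate (ds i) i) [0..<n])"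

lemma count_row_list: "count (mset (row_list n ds)) i = (if i < n then ds i else 0)"
  by (induction n) (auto simp: row_list_def)

lemma length_row_list: "length (row_list n ds) = (\<Sum>i\<in>{0..<n}. ds i)"
  by (induction n) (auto simp: row_list_def)

text \<open>Lists of rows are grouped by their multiplicities \<open>ds\<close>. A group consists of
  all arrangements of \<open>row_list n ds\<close>, and its size cancels the denominator in
  \<open>row_weight\<close>.\<close>

lemma sum_over_row_counts:
  fixes G :: "nat list \<Rightarrow> real"
  assumes G: "\<And>rs rs'. mset rs = mset rs' \<Longrightarrow> G rs = G rs'"
  shows "(\<Sum>ds | ds \<in> {0..<n} \<rightarrow>\<^sub>E {..d} \<and> (\<Sum>i\<in>{0..<n}. ds i) = d.
      (\<Prod>i\<in>{0..<n}. 1 / fact (ds i * (k - 1))) * G (row_list n ds)) =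
    (\<Sum>rs\<in>index_lists n d. row_weight n k rs * G rs)"
proof -
  let ?DS = "{ds. ds \<in> {0..<n} \<rightarrow>\<^sub>E {..d} \<and> (\<Sum>i\<in>{0..<n}. ds i) = d}"
  \<comment> \<open>Restricted to \<open>{0..<n}\<close>, because the vectors \<open>ds\<close> in
    the trace formula are extensional functions.\<close>
  let ?g = "\<lambda>rs. \<lambda>i\<in>{0..<n}. count (mset rs) i"
  have fin: "finite ?DS" by (rule finite_subset[OF _ finite_PiE[of "{0..<n}" "\<lambda>_. {..d}"]]) auto
  have img: "?g ` index_lists n d \<subseteq> ?DS"
  proof clarify
    fix rs assume rs: "rs \<in> index_lists n d"
    then have "(\<Sum>i\<in>{0..<n}. count (mset rs) i) = d"
      by (auto simp: index_lists_def size_multiset_overloaded_eq simp flip: size_mset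
          intro!: sum.mono_neutral_right simp: not_in_iff[symmetric])
    moreover have "count (mset rs) i \<le> d" for i
      using rs count_le_size[of "mset rs" i] by (auto simp: index_lists_def)
    ultimately show "?g rs \<in> {0..<n} \<rightarrow>\<^sub>E {..d} \<and> (\<Sum>i\<in>{0..<n}. ?g rs i) = d" by auto
  qed
  have "(\<Sum>rs\<in>{rs \<in> index_lists n d. ?g rs = ds}. row_weight n k rs * G rs) =
      (\<Prod>i\<in>{0..<n}. 1 / fact (ds i * (k - 1))) * G (row_list n ds)" if "ds \<in> ?DS" for ds
  proof -
    have fibre: "{rs \<in> index_lists n d. ?g rs = ds} = {rs. mset rs = mset (row_list n ds)}" (is "?L = ?R")
    proof (intro equalityI subsetI)
      fix rs assume "rs \<in> ?L"
      then have rs: "rs \<in> index_lists n d" and ds: "?g rs = ds" by auto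
      have "mset rs = mset (row_list n (?g rs))"
        using rs by (auto intro!: multiset_eqI simp: count_row_list index_lists_def count_eq_zero_iff)
      then show "rs \<in> ?R" unfolding ds by simp
    next
      fix rs assume "rs \<in> ?R"
      then have rs: "mset rs = mset (row_list n ds)" by simp
      have "length rs = d" using that mset_eq_length[OF rs] length_row_list[of n ds] by auto
      moreover have "set rs \<subseteq> {0..<n}" unfolding mset_eq_setD[OF rs] by (auto simp: row_list_def)
      moreover have "?g rs i = ds i" for i
        using that unfolding rs by (auto simp: count_row_list PiE_def extensional_def)
      then have "?g rs = ds" by (rule ext)
      ultimately show "rs \<in> ?L" by (simp add: index_lists_def)
    qed
    have "card {rs. mset rs = mset (row_list n ds)} > 0"
      using finite_mset_fibre by (auto simp: card_gt_0_iff)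
    moreover have "(\<Sum>rs\<in>?R. row_weight n k rs * G rs) =
        (\<Sum>rs\<in>?R. row_weight n k (row_list n ds) * G (row_list n ds))"
    proof (rule sum.cong[OF refl])
      fix rs assume "rs \<in> ?R"
      then have "mset rs = mset (row_list n ds)" by simp
      from G[OF this] this
      show "row_weight n k rs * G rs = row_weight n k (row_list n ds) * G (row_list n ds)"
        by (simp add: row_weight_def)
    qed
    ultimately show ?thesis
      unfolding fibre by (simp add: row_weight_def[of n k "row_list n ds"] count_row_list)
  qed
  then have "(\<Sum>ds\<in>?DS. (\<Prod>i\<in>{0..<n}. 1 / fact (ds i * (k - 1))) * G (row_list n ds)) =
     (\<Sum>ds\<in>?DS. \<Sum>rs\<in>{rs \<in> index_lists n d. ?g rs = ds}. row_weight n k rs * G rs)"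
    by (intro sum.cong) auto
  also have "\<dots> = (\<Sum>rs\<in>index_lists n d. row_weight n k rs * G rs)"
    by (rule sum.group[OF finite_index_lists fin img])
  finally show ?thesis .
qed

text \<open>For each list of rows, expanding the operators yields the words with these heads;
  letting the rows vary exhausts all words. The tensor now enters through a product of its entries
  only.\<close>

lemma Tr_eq_sum_words:
  assumes "k \<ge> 2" "d \<ge> 1"
  shows "Tr k n d T = real ((k - 1) ^ (n - 1)) * (\<Sum>xs\<in>words n k d. weight n k xs * (\<Prod>x\<leftarrow>xs. T x))"
proof -
  let ?p = "mat_trace (indet_mat n ^\<^sub>m (d * (k - 1)))"
  let ?G = "\<lambda>rs. Poly_Mapping.lookup (rows_op k n T rs ?p) 0"
  have "Tr k n d T = real ((k - 1) ^ (n - 1)) * (\<Sum>rs\<in>index_lists n d. row_weight n k rs * ?G rs)"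
    using assms sum_over_row_counts[where G = ?G and n = n and d = d and k = k, OF arg_cong[where f = "\<lambda>g. Poly_Mapping.lookup (g ?p) 0", OF rows_op_mset_cong]]
    by (simp add: Tr_def foldr_rows_op row_list_def)
  also have "(\<Sum>rs\<in>index_lists n d. row_weight n k rs * ?G rs) =
      (\<Sum>rs\<in>index_lists n d. \<Sum>xs\<in>{xs \<in> words n k d. map hd xs = rs}. weight n k xs * (\<Prod>x\<leftarrow>xs. T x))"
  proof (rule sum.cong[OF refl])
    fix rs assume rs: "rs \<in> index_lists n d"
    have fibre: "index_words n k rs = {xs \<in> words n k d. map hd xs = rs}"
    proof (intro equalityI subsetI)
      fix xs assume xs: "xs \<in> index_words n k rs"
      have "x \<in> index_lists n k" if "x \<in> set xs" for x
      proof -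
        have "hd x \<in> set rs" "x \<noteq> []" "tl x \<in> index_lists n (k - 1)"
          using xs that by (auto simp: index_words_def)
        then obtain i \<gamma> where "x = i # \<gamma>" "i \<in> set rs" "\<gamma> \<in> index_lists n (k - 1)" by (cases x) auto
        then show ?thesis using rs assms(1) by (auto simp: index_lists_def)
      qed
      moreover have "length xs = length rs" "map hd xs = rs" using xs by (auto simp: index_words_def)
      ultimately show "xs \<in> {xs \<in> words n k d. map hd xs = rs}"
        using rs by (auto simp: words_def index_lists_def)
    next
      fix xs assume xs: "xs \<in> {xs \<in> words n k d. map hd xs = rs}"
      have "x \<noteq> [] \<and> tl x \<in> index_lists n (k - 1)" if "x \<in> set xs" for x
      proof -
        have "x \<in> index_lists n k" using xs that by (auto simp: words_def)
        then show ?thesis using assms(1) by (cases x) (auto simp: index_lists_def)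
      qed
      with xs show "xs \<in> index_words n k rs" by (simp add: index_words_def)
    qed
    have "?G rs = (\<Sum>xs\<in>index_words n k rs. (\<Prod>x\<leftarrow>xs. T x) *
        (deriv_coeff [] (arcs xs) * real (card (circuits n (d * (k - 1)) (arcs xs)))))"
      using assms by (simp add: rows_op_expand lookup_sum lookup_Const_mult lookup_pdiffs_trace)
    also have "row_weight n k rs * \<dots> = (\<Sum>xs\<in>index_words n k rs. weight n k xs * (\<Prod>x\<leftarrow>xs. T x))"
      unfolding sum_distrib_left
      by (rule sum.cong) (auto simp: fibre weight_def words_def)
    finally show "row_weight n k rs * ?G rs =
      (\<Sum>xs\<in>{xs \<in> words n k d. map hd xs = rs}. weight n k xs * (\<Prod>x\<leftarrow>xs. T x))"
      unfolding fibre .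
  qed
  also have "\<dots> = (\<Sum>xs\<in>words n k d. weight n k xs * (\<Prod>x\<leftarrow>xs. T x))"
  proof (rule sum.group[OF finite_words finite_index_lists], clarsimp)
    fix xs assume xs: "xs \<in> words n k d"
    have "hd x \<in> {0..<n}" if "x \<in> set xs" for x
    proof -
      have "x \<in> index_lists n k" using xs that by (auto simp: words_def)
      moreover from this have "x \<noteq> []" using assms(1) by (auto simp: index_lists_def)
      ultimately show ?thesis by (cases x) (auto simp: index_lists_def)
    qed
    with xs show "map hd xs \<in> index_lists n d" by (auto simp: words_def index_lists_def)
  qed
  finally show ?thesis .
qed


section \<open>Invariance of the weights under permutations of the vertices\<close>

lemma arcs_map:
  assumes "\<forall>x\<in>set xs. x \<noteq> []"
  shows "arcs (map (map f) xs) = map (map_prod f f) (arcs xs)"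
  using assms
proof (induction xs)
  case (Cons a xs)
  then obtain i \<gamma> where "a = i # \<gamma>" by (cases a) auto
  with Cons show ?case by (simp add: arcs_def arcs_of_def)
qed (simp add: arcs_def)

lemma cyclic_arcs_map: "cyclic_arcs (map f ws) = map (map_prod f f) (cyclic_arcs ws)"
  by (simp add: cyclic_arcs_def rotate1_map zip_map_map map_prod_def case_prod_beta)

lemma inj_mset_map_eq_iff:
  assumes "inj f" shows "mset (map f xs) = mset (map f ys) \<longleftrightarrow> mset xs = mset ys"
  using count_mset_map_inj[OF assms] by (metis multiset_eqI mset_map)

lemma map_inv_permutes:
  assumes "f permutes A" shows "map f (map (Hilbert_Choice.inv f) xs) = xs" "map (Hilbert_Choice.inv f) (map f xs) = xs"
  using permutes_inverses[OF assms] by (simp_all add: map_idI)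

text \<open>Each factor is built from multiplicities or from the size of a set of lists, and
  \<open>f\<close> carries these sets over bijectively, with its inverse going back.\<close>

lemma weight_map:
  assumes f: "f permutes {0..<n}" and xs: "\<forall>x\<in>set xs. x \<noteq> []"
  shows "weight n k (map (map f) xs) = weight n k xs"
proof -
  have inj: "inj f" using f by (rule permutes_inj)
  have injp: "inj (map_prod f f)" using inj by (simp add: map_prod_inj_on prod.inj_map)
  let ?rs = "map hd xs"
  have hd: "map hd (map (map f) xs) = map f ?rs"
    using xs by (auto simp: hd_map)
  have "bij_betw (map f) {rs. mset rs = mset ?rs} {rs. mset rs = mset (map f ?rs)}"
  proof (rule bij_betw_byWitness[where f' = "map (Hilbert_Choice.inv f)"])
    show "map (Hilbert_Choice.inv f) ` {rs. mset rs = mset (map f ?rs)} \<subseteq> {rs. mset rs = mset ?rs}"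
    proof clarify
      fix rs assume "mset rs = mset (map f ?rs)"
      then have "mset (map f (map (Hilbert_Choice.inv f) rs)) = mset (map f ?rs)"
        unfolding map_inv_permutes[OF f] .
      then show "mset (map (Hilbert_Choice.inv f) rs) = mset ?rs"
        by (simp only: inj_mset_map_eq_iff[OF inj])
    qed
    show "map f ` {rs. mset rs = mset ?rs} \<subseteq> {rs. mset rs = mset (map f ?rs)}"
      unfolding mset_map by auto
    show "\<forall>rs\<in>{rs. mset rs = mset ?rs}. map (Hilbert_Choice.inv f) (map f rs) = rs"
      "\<forall>rs\<in>{rs. mset rs = mset (map f ?rs)}. map f (map (Hilbert_Choice.inv f) rs) = rs"
      using map_inv_permutes[OF f] by blast+
  qed
  then have card_rs: "card {rs. mset rs = mset (map f ?rs)} = card {rs. mset rs = mset ?rs}"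
    by (simp add: bij_betw_same_card)
  have "(\<Prod>i\<in>{0..<n}. 1 / fact (count (mset (map f ?rs)) i * (k - 1))) =
        (\<Prod>i\<in>{0..<n}. 1 / fact (count (mset (map f ?rs)) (f i) * (k - 1)) :: real)"
    using f by (rule prod.permute[unfolded comp_def])
  also have "\<dots> = (\<Prod>i\<in>{0..<n}. 1 / fact (count (mset ?rs) i * (k - 1)))"
    by (simp only: count_mset_map_inj[OF inj])
  finally have row: "row_weight n k (map hd (map (map f) xs)) = row_weight n k ?rs"
    unfolding hd row_weight_def card_rs by simp
  let ?l = "length xs * (k - 1)"
  have "bij_betw (map f) (circuits n ?l (arcs xs)) (circuits n ?l (map (map_prod f f) (arcs xs)))"
  proof (rule bij_betw_byWitness[where f' = "map (Hilbert_Choice.inv f)"])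
    have f': "Hilbert_Choice.inv f permutes {0..<n}" using f by (rule permutes_inv)
    have il: "map g ws \<in> index_lists n l" if "g permutes {0..<n}" "ws \<in> index_lists n l" for g ws l
      using that by (auto simp: index_lists_def permutes_in_image)
    show "map f ` circuits n ?l (arcs xs) \<subseteq> circuits n ?l (map (map_prod f f) (arcs xs))"
      using il[OF f] by (auto simp: circuits_def cyclic_arcs_map)
    show "map (Hilbert_Choice.inv f) ` circuits n ?l (map (map_prod f f) (arcs xs)) \<subseteq> circuits n ?l (arcs xs)"
    proof clarify
      fix ws assume ws: "ws \<in> circuits n ?l (map (map_prod f f) (arcs xs))"
      have "mset (map (map_prod f f) (cyclic_arcs (map (Hilbert_Choice.inv f) ws))) = mset (map (map_prod f f) (arcs xs))"
        using ws unfolding cyclic_arcs_map[symmetric] map_inv_permutes[OF f] by (simp add: circuits_def)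
      then have "mset (cyclic_arcs (map (Hilbert_Choice.inv f) ws)) = mset (arcs xs)"
        by (simp only: inj_mset_map_eq_iff[OF injp])
      then show "map (Hilbert_Choice.inv f) ws \<in> circuits n ?l (arcs xs)"
        using ws il[OF f'] by (simp add: circuits_def)
    qed
    show "\<forall>ws\<in>circuits n ?l (arcs xs). map (Hilbert_Choice.inv f) (map f ws) = ws"
      "\<forall>ws\<in>circuits n ?l (map (map_prod f f) (arcs xs)). map f (map (Hilbert_Choice.inv f) ws) = ws"
      using map_inv_permutes[OF f] by blast+
  qed
  then have circ: "card (circuits n ?l (map (map_prod f f) (arcs xs))) = card (circuits n ?l (arcs xs))"
    by (simp add: bij_betw_same_card)
  show ?thesis
    using row circ deriv_coeff_map[OF injp, of "[]" "arcs xs"] unfolding weight_def arcs_map[OF xs]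
    by (simp only: list.map(1) length_map)
qed

lemma row_weight_pos: "row_weight n k rs > 0"
proof -
  have "card {rs'. mset rs' = mset rs} > 0" using finite_mset_fibre by (auto simp: card_gt_0_iff)
  then show ?thesis unfolding row_weight_def by (intro divide_pos_pos prod_pos) auto
qed

lemma weight_nonneg: "weight n k xs \<ge> 0"
  unfolding weight_def using row_weight_pos deriv_coeff_pos
  by (intro mult_nonneg_nonneg) (auto intro: less_imp_le)

lemma weight_eq_0_iff: "weight n k xs = 0 \<longleftrightarrow> circuits n (length xs * (k - 1)) (arcs xs) = {}"
proof -
  have "finite (circuits n l as)" for l as
    by (simp add: circuits_def finite_index_lists)
  then show ?thesis
    unfolding weight_def using row_weight_pos[of n k "map hd xs"] deriv_coeff_pos[of "[]" "arcs xs"] by auto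
qed

section \<open>Surviving terms of the low-order traces\<close>

lemma map_fst_cyclic_arcs: "map fst (cyclic_arcs ws) = ws"
  and map_snd_cyclic_arcs: "map snd (cyclic_arcs ws) = rotate1 ws"
  by (simp_all add: cyclic_arcs_def)

lemma length_cyclic_arcs: "length (cyclic_arcs ws) = length ws"
  by (simp add: cyclic_arcs_def)

lemma length_arcs: "\<forall>x\<in>set xs. length x = k \<Longrightarrow> length (arcs xs) = length xs * (k - 1)"
  by (induction xs) (simp_all add: arcs_def arcs_of_def)

lemma count_heads:
  assumes "\<forall>x\<in>set xs. length x = k"
  shows "count (mset (map fst (arcs xs))) i = (k - 1) * length (filter (\<lambda>x. hd x = i) xs)"
proof -
  have *: "map (\<lambda>x. c) zs = replicate (length zs) c" for c :: nat and zs :: "nat list"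
    by (simp add: map_replicate_const)
  show ?thesis using assms
    by (induction xs) (auto simp: arcs_def arcs_of_def comp_def *)
qed

text \<open>No arc enters \<open>i\<close> on account of a head, so the heads are added on the left
  to obtain plain occurrence counts on the right.\<close>

lemma count_tails:
  assumes "\<forall>x\<in>set xs. x \<noteq> []"
  shows "count (mset (map snd (arcs xs))) i + length (filter (\<lambda>x. hd x = i) xs) =
    (\<Sum>x\<leftarrow>xs. count (mset x) i)"
  using assms
proof (induction xs)
  case (Cons x xs)
  then obtain j \<gamma> where "x = j # \<gamma>" by (cases x) auto
  with Cons show ?case by (simp add: arcs_def arcs_of_def comp_def)
qed (simp add: arcs_def)

lemma weight_nonzero_circuit:
  assumes "weight n k xs \<noteq> 0"
  obtains ws where "length ws = length xs * (k - 1)" "set ws \<subseteq> {0..<n}" "mset (cyclic_arcs ws) = mset (arcs xs)"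
  using assms unfolding weight_eq_0_iff by (auto simp: circuits_def index_lists_def)

text \<open>A closed walk enters \<open>i\<close> as often as it leaves it. An index list with head
  \<open>i\<close> has \<open>k - 1\<close> arcs out of \<open>i\<close>; adding the head itself on
  both sides turns \<open>k - 1\<close> into \<open>k\<close>.\<close>

lemma weight_nonzero_balanced:
  assumes w: "weight n k xs \<noteq> 0" and len: "\<forall>x\<in>set xs. length x = k" and k: "k \<ge> 1"
  shows "k * length (filter (\<lambda>x. hd x = i) xs) = (\<Sum>x\<leftarrow>xs. count (mset x) i)"
proof -
  obtain ws where ws: "mset (cyclic_arcs ws) = mset (arcs xs)"
    using weight_nonzero_circuit[OF w] by metis
  have "mset (map fst (arcs xs)) = mset (map fst (cyclic_arcs ws))"
    "mset (map snd (arcs xs)) = mset (map snd (cyclic_arcs ws))"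
    unfolding mset_map ws by (rule refl)+
  moreover have "mset (rotate1 ws) = mset ws" by (cases ws) simp_all
  ultimately have "mset (map fst (arcs xs)) = mset (map snd (arcs xs))"
    unfolding map_fst_cyclic_arcs map_snd_cyclic_arcs by simp
  then have "(k - 1) * length (filter (\<lambda>x. hd x = i) xs) + length (filter (\<lambda>x. hd x = i) xs) =
      (\<Sum>x\<leftarrow>xs. count (mset x) i)"
    using count_heads[OF len, of i] count_tails[of xs i] len k by fastforce
  with k show ?thesis by (cases k) auto
qed

text \<open>One closed walk runs through all arcs. Once inside a set \<open>U\<close> closed under
  the arcs it cannot leave, and it visits every head, since \<open>k\<close> at least
  \<open>2\<close> gives each index list an arc.\<close>

lemma weight_nonzero_connected:
  assumes w: "weight n k xs \<noteq> 0" and len: "\<forall>x\<in>set xs. length x = k" and k: "k \<ge> 2"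
    and closed: "\<And>x. x \<in> set xs \<Longrightarrow> hd x \<in> U \<Longrightarrow> set (tl x) \<subseteq> U"
    and x0: "x0 \<in> set xs" "hd x0 \<in> U" and x: "x \<in> set xs"
  shows "hd x \<in> U"
proof -
  obtain ws where ws: "mset (cyclic_arcs ws) = mset (arcs xs)"
    using weight_nonzero_circuit[OF w] by metis
  have set_eq: "set (cyclic_arcs ws) = set (arcs xs)" using mset_eq_setD[OF ws] .
  let ?l = "length ws"
  have arc: "(ws ! j, ws ! (Suc j mod ?l)) \<in> set (arcs xs)" if "j < ?l" for j
  proof -
    have "cyclic_arcs ws ! j = (ws ! j, ws ! (Suc j mod ?l))"
      using that by (simp add: cyclic_arcs_def nth_rotate1)
    then show ?thesis
      using that nth_mem[of j "cyclic_arcs ws"] by (simp add: set_eq length_cyclic_arcs)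
  qed
  have closed': "v \<in> U" if uv: "(u, v) \<in> set (arcs xs)" "u \<in> U" for u v
  proof -
    obtain x where "x \<in> set xs" "u = hd x" "v \<in> set (tl x)"
      using uv(1) by (auto simp: arcs_def arcs_of_def)
    with closed uv(2) show ?thesis by blast
  qed
  have head: "\<exists>j<?l. ws ! j = hd y" if y_xs: "y \<in> set xs" for y
  proof -
    have "length y \<ge> 2" using len k y_xs by simp
    then obtain i i' \<gamma> where y: "y = i # i' # \<gamma>"
      by (cases y; cases "tl y") auto
    then have "(i, i') \<in> set (arcs xs)" using y_xs by (force simp: arcs_def arcs_of_def)
    then have "i \<in> fst ` set (cyclic_arcs ws)" by (force simp: set_eq)
    then have "i \<in> set ws" by (metis list.set_map map_fst_cyclic_arcs)
    then show ?thesis using y by (simp add: in_set_conv_nth)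
  qed
  obtain j0 where j0: "j0 < ?l" "ws ! j0 = hd x0" using head[OF x0(1)] by blast
  have step: "ws ! ((j0 + t) mod ?l) \<in> U" for t
  proof (induction t)
    case 0
    then show ?case using j0 x0 by simp
  next
    case (Suc t)
    have "(j0 + t) mod ?l < ?l" using j0 by (intro mod_less_divisor) linarith
    from closed'[OF arc[OF this] Suc] show ?case by (simp add: mod_Suc_eq)
  qed
  obtain j where j: "j < ?l" "ws ! j = hd x" using head[OF x] by blast
  \<comment> \<open>The extra round \<open>?l\<close> keeps the subtraction of natural numbers exact
    when \<open>j\<close> precedes \<open>j0\<close>.\<close>
  have "(j0 + (?l + j - j0)) mod ?l = j" using j j0 by simp
  with step[of "?l + j - j0"] j show ?thesis by simp
qed

definition diag :: "nat \<Rightarrow> nat list \<Rightarrow> bool" where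
  "diag k x \<longleftrightarrow> x = replicate k (hd x)"

lemma sum_length_filter:
  "finite A \<Longrightarrow> (\<Sum>i\<in>A. length (filter (\<lambda>x. g x = i) xs)) = length (filter (\<lambda>x. g x \<in> A) xs)"
proof (induction xs)
  case (Cons a xs)
  have "length (filter (\<lambda>x. g x = i) (a # xs)) =
      length (filter (\<lambda>x. g x = i) xs) + (if g a = i then 1 else 0)" for i
    by simp
  with Cons show ?case by (simp add: sum.distrib)
qed simp

locale linear_uniform =
  fixes H :: hypergraph and k :: nat
  assumes hyp: "is_hypergraph H" and unif: "uniform k H" and lin: "linear_hypergraph H" and k3: "k \<ge> 3"
begin

lemma card_edge: "e \<in> edges H \<Longrightarrow> card e = k"
  using unif by (simp add: uniform_def)

lemma edge_subset: "e \<in> edges H \<Longrightarrow> e \<subseteq> {0..<nverts H}"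
  using hyp by (simp add: is_hypergraph_def verts_def)

lemma finite_edge: "e \<in> edges H \<Longrightarrow> finite e"
  using edge_subset finite_subset by blast

lemma finite_edges: "finite (edges H)"
  by (rule finite_subset[of _ "Pow {0..<nverts H}"]) (use edge_subset in auto)

lemma card_Int_edges: "e \<in> edges H \<Longrightarrow> f \<in> edges H \<Longrightarrow> e \<noteq> f \<Longrightarrow> card (e \<inter> f) \<le> 1"
  using lin by (simp add: linear_hypergraph_def)

text \<open>A hyperedge has at least three vertices, so no index list lies in the support of both
  the degree tensor and the adjacency tensor.\<close>

lemma diag_not_edge: "diag k x \<Longrightarrow> set x \<notin> edges H"
proof
  assume "diag k x" "set x \<in> edges H"
  then have "set x = {hd x}" using k3 by (metis diag_def not_numeral_le_zero set_replicate)
  then show False using card_edge[OF \<open>set x \<in> edges H\<close>] k3 by simp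
qed

lemma A_alpha_diag: "diag k x \<Longrightarrow> A_alpha k \<alpha> H x = \<alpha> * real (vertex_degree H (hd x))"
  using diag_not_edge[of x] unfolding A_alpha_def degree_tensor_def adjacency_tensor_def
  by (auto simp: diag_def)

lemma A_alpha_not_diag:
  "\<not> diag k x \<Longrightarrow> length x = k \<Longrightarrow>
     A_alpha k \<alpha> H x = (if set x \<in> edges H then (1 - \<alpha>) / fact (k - 1) else 0)"
  unfolding A_alpha_def degree_tensor_def adjacency_tensor_def by (auto simp: diag_def)

text \<open>If \<open>h i\<close> non-diagonal entries have row \<open>i\<close>, balance at \<open>i\<close> says that \<open>k * h i\<close> of them have \<open>i\<close> in their
  hyperedge. So \<open>h \<ge> 1\<close> on every hyperedge that occurs, and two of them would need \<open>2 * k - 1 \<le> k + 2\<close>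
  entries. This leaves \<open>k = 3\<close> with \<open>h = 1\<close> on five vertices, where counting gives \<open>3 + 3\<close> entries.\<close>

lemma surviving_word:
  assumes xs: "length xs = d" "\<forall>x\<in>set xs. length x = k" "\<forall>x\<in>set xs. diag k x \<or> set x \<in> edges H"
    and w: "weight n k xs \<noteq> 0" and d: "1 \<le> d" "d \<le> k + 2"
  shows "(\<exists>i. xs = replicate d (replicate k i)) \<or>
    (\<exists>e\<in>edges H. length (filter (\<lambda>x. \<not> diag k x) xs) = k \<and>
       (\<forall>x\<in>set xs. (diag k x \<and> hd x \<in> e) \<or> set x = e))"
proof -
  let ?N = "filter (\<lambda>x. \<not> diag k x) xs"
  define h where "h i = length (filter (\<lambda>x. hd x = i) ?N)" for i
  define c where "c i = length (filter (\<lambda>x. i \<in> set x) ?N)" for i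
  have conn: "hd x \<in> U" if "\<And>x. x \<in> set xs \<Longrightarrow> hd x \<in> U \<Longrightarrow> set (tl x) \<subseteq> U"
    "x0 \<in> set xs" "hd x0 \<in> U" "x \<in> set xs" for U x0 x
    using weight_nonzero_connected[OF w xs(2) _ that] k3 by auto
  have N: "set x \<in> edges H" "length x = k" "x \<in> set xs" "hd x \<in> set x" if "x \<in> set ?N" for x
  proof -
    show *: "set x \<in> edges H" "length x = k" "x \<in> set xs" using that xs by auto
    then show "hd x \<in> set x" using k3 by (cases x) auto
  qed
  \<comment> \<open>A diagonal entry at \<open>i\<close> adds \<open>k\<close> to both sides of the
    balance and cancels. A non-diagonal entry lists the \<open>k\<close> vertices of its hyperedge
    without repetition, so it counts \<open>i\<close> at most once.\<close>
  have bal: "k * h i = c i" for i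
  proof -
    have cnt: "count (mset x) i = (if diag k x then (if hd x = i then k else 0) else if i \<in> set x then 1 else 0)"
      if "x \<in> set xs" for x
    proof (cases "diag k x")
      case True
      have "count (mset (replicate k (hd x))) i = (if hd x = i then k else 0)" by simp
      with True show ?thesis by (simp add: diag_def)
    next
      case False
      then have "set x \<in> edges H" using xs that by auto
      from card_edge[OF this] have "distinct x" using xs that by (simp add: card_distinct)
      with False show ?thesis by (simp add: distinct_count_atmost_1)
    qed
    have "(\<Sum>x\<leftarrow>xs. count (mset x) i) =
        (\<Sum>x\<leftarrow>xs. if diag k x then (if hd x = i then k else 0) else if i \<in> set x then 1 else 0)"
      by (rule arg_cong[of _ _ sum_list], rule map_cong[OF refl]) (rule cnt)
    also have "\<dots> = k * length (filter (\<lambda>x. diag k x \<and> hd x = i) xs) + c i"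
      unfolding c_def by (induction xs) auto
    finally have "k * length (filter (\<lambda>x. hd x = i) xs) =
        k * length (filter (\<lambda>x. diag k x \<and> hd x = i) xs) + c i"
      using weight_nonzero_balanced[OF w xs(2), of i] k3 by simp
    moreover have "length (filter (\<lambda>x. hd x = i) xs) =
        length (filter (\<lambda>x. diag k x \<and> hd x = i) xs) + h i"
      unfolding h_def by (induction xs) auto
    ultimately show ?thesis by (simp add: distrib_left)
  qed
  have sum_h: "(\<Sum>i\<in>A. h i) = length (filter (\<lambda>x. hd x \<in> A) ?N)" if "finite A" for A
    unfolding h_def by (rule sum_length_filter[OF that])
  have h_pos: "h i \<ge> 1" if "x \<in> set ?N" "i \<in> set x" for x i
  proof -
    have "x \<in> set (filter (\<lambda>x. i \<in> set x) ?N)" using that by simp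
    then have "c i > 0" unfolding c_def by (metis length_pos_if_in_set)
    with bal[of i] show ?thesis by (cases "h i") auto
  qed
  show ?thesis
  proof (cases "?N = []")
    case True
    then have all_diag: "\<forall>x\<in>set xs. diag k x" by (simp add: filter_empty_conv)
    obtain x0 where x0: "x0 \<in> set xs" using d xs by (cases xs) auto
    have "set (tl x) \<subseteq> {hd x}" if "x \<in> set xs" for x
    proof -
      have "set (tl x) \<subseteq> set (replicate k (hd x))"
        using all_diag that by (metis diag_def list.set_sel(2) subsetI tl_Nil)
      then show ?thesis by auto
    qed
    then have "hd x \<in> {hd x0}" if "x \<in> set xs" for x
      using that x0 by (intro conn[of "{hd x0}" x0 x]) auto
    then have "\<forall>x\<in>set xs. x = replicate k (hd x0)" using all_diag by (auto simp: diag_def)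
    then have "xs = replicate d (replicate k (hd x0))" using xs(1) replicate_eqI by metis
    then show ?thesis by blast
  next
    case False
    then obtain x0 where x0: "x0 \<in> set ?N" by (metis list.set_intros(1) neq_Nil_conv)
    let ?e = "set x0"
    note e = N(1)[OF x0]
    have len_N: "length ?N \<le> d" using xs(1) by (metis length_filter_le)
    have all_e: "set x1 = ?e" if x1: "x1 \<in> set ?N" for x1
    proof (rule ccontr)
      let ?f = "set x1"
      assume ne: "?f \<noteq> ?e"
      note f = N(1)[OF x1]
      let ?A = "?e \<union> ?f"
      have "card ?A + card (?e \<inter> ?f) = 2 * k"
        using card_Un_Int[of ?e ?f] card_edge[OF e] card_edge[OF f] by simp
      then have card_A: "card ?A \<ge> 2 * k - 1" using card_Int_edges[OF e f] ne by auto
      have hA: "h i \<ge> 1" if "i \<in> ?A" for i using that h_pos[OF x0] h_pos[OF x1] by auto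
      have le1: "card ?A \<le> (\<Sum>i\<in>?A. h i)"
        using sum_mono[of ?A "\<lambda>_. 1" h] hA by simp
      have le2: "(\<Sum>i\<in>?A. h i) \<le> length ?N" unfolding sum_h[OF finite_UnI[OF finite_set finite_set]] by (rule length_filter_le)
      \<comment> \<open>The chain from \<open>2 * k - 1\<close> over \<open>card ?A\<close>, the sum
        of \<open>h\<close>, \<open>length ?N\<close> and \<open>d\<close> up to
        \<open>k + 2\<close> is increasing, so with \<open>k\<close> at least \<open>3\<close> every
        step is an equality.\<close>
      have k: "k = 3" and N5: "length ?N = 5" and cA: "card ?A = 5" and hs: "(\<Sum>i\<in>?A. h i) = 5"
        using card_A le1 le2 len_N d k3 by linarith+
      have h1: "h i = 1" if "i \<in> ?A" for i
      proof (rule ccontr)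
        assume "h i \<noteq> 1"
        then have "h i > 1" using hA[OF that] by simp
        then have "(\<Sum>i\<in>?A. 1) < (\<Sum>i\<in>?A. h i)" using that hA by (intro sum_strict_mono_ex1) auto
        then show False using hs cA by simp
      qed
      have "length (filter (\<lambda>x. hd x \<in> ?A) ?N) = length ?N"
        using sum_h[of ?A] hs N5 by simp
      then have hd_A: "hd x \<in> ?A" if "x \<in> set ?N" for x
        using that by (metis (mono_tags, lifting) length_filter_less less_irrefl_nat)
      have sub_A: "set x \<subseteq> ?A" if "x \<in> set ?N" for x
      proof
        fix i assume "i \<in> set x"
        then have "h i \<ge> 1" using h_pos that by blast
        then have "filter (\<lambda>x. hd x = i) ?N \<noteq> []" unfolding h_def by (metis list.size(3) not_one_le_zero)
        then obtain y where "y \<in> set ?N" "hd y = i" unfolding filter_empty_conv by blast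
        then show "i \<in> ?A" using hd_A by blast
      qed
      \<comment> \<open>By linearity a third hyperedge inside \<open>?A\<close> would have at most
        one vertex in each of \<open>?e\<close> and \<open>?f\<close>, but it has three.\<close>
      have ef: "set x = ?e \<or> set x = ?f" if "x \<in> set ?N" for x
      proof (rule ccontr)
        assume "\<not> (set x = ?e \<or> set x = ?f)"
        then have "card (set x \<inter> ?e) \<le> 1" "card (set x \<inter> ?f) \<le> 1"
          using card_Int_edges[OF N(1)[OF that]] e f by auto
        moreover have "set x = (set x \<inter> ?e) \<union> (set x \<inter> ?f)" using sub_A[OF that] by blast
        then have "card (set x) \<le> card (set x \<inter> ?e) + card (set x \<inter> ?f)" by (metis card_Un_le)
        ultimately show False using card_edge[OF N(1)[OF that]] k by simp
      qed
      obtain i where i: "i \<in> ?e" "i \<notin> ?f"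
        using ne card_edge[OF e] card_edge[OF f] card_subset_eq[OF finite_set, of ?e x1] by fastforce
      obtain j where j: "j \<in> ?f" "j \<notin> ?e"
        using ne card_edge[OF e] card_edge[OF f] card_subset_eq[OF finite_set, of ?f x0] by fastforce
      have "c i = length (filter (\<lambda>x. set x = ?e) ?N)"
        unfolding c_def by (rule arg_cong[of _ _ length], rule filter_cong[OF refl]) (use ef i in blast)
      moreover have "c j = length (filter (\<lambda>x. \<not> set x = ?e) ?N)"
        unfolding c_def by (rule arg_cong[of _ _ length], rule filter_cong[OF refl]) (use ef j in blast)
      moreover have "c i = 3" "c j = 3" using bal[of i] bal[of j] h1 i j k by auto
      ultimately show False using N5 sum_length_filter_compl[of "\<lambda>x. set x = ?e" ?N] by linarith
    qed
    have h_e: "k * h i = length ?N" if "i \<in> ?e" for i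
    proof -
      have "filter (\<lambda>x. i \<in> set x) ?N = ?N" by (rule filter_True) (use that all_e in blast)
      then show ?thesis using bal[of i] unfolding c_def by simp
    qed
    \<comment> \<open>The number of non-diagonal entries is a multiple of \<open>k\<close> strictly
      between \<open>0\<close> and \<open>2 * k\<close>, as \<open>k + 2 < 2 * k\<close>.\<close>
    have "length ?N > 0" by (rule length_pos_if_in_set[OF x0])
    moreover have "k * h (hd x0) = length ?N" using h_e N(4)[OF x0] by blast
    moreover have "length ?N < 2 * k" using len_N d k3 by linarith
    ultimately have "h (hd x0) > 0" "k * h (hd x0) < k * 2" "k * h (hd x0) = length ?N"
      by (auto intro: Nat.gr0I)
    note h_x0 = this
    have "h (hd x0) < 2" using h_x0(2) by simp
    then have "h (hd x0) = 1" using h_x0(1) by simp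
    then have N_k: "length ?N = k" using \<open>k * h (hd x0) = length ?N\<close> by simp
    have x_e: "set x = ?e" if "x \<in> set xs" "\<not> diag k x" for x using all_e that by simp
    have "hd x \<in> ?e" if "x \<in> set xs" for x
    proof (rule conn[OF _ N(3)[OF x0] N(4)[OF x0] that])
      fix y assume y: "y \<in> set xs" "hd y \<in> ?e"
      show "set (tl y) \<subseteq> ?e"
      proof (cases "diag k y")
        case True
        then have "set y \<subseteq> {hd y}" unfolding diag_def by (metis set_replicate_conv_if empty_subsetI order_refl)
        then show ?thesis using y(2) by (cases y) auto
      next
        case False
        then show ?thesis using x_e[OF y(1)] by (cases y) auto
      qed
    qed
    then show ?thesis using e N_k x_e by blast
  qed
qed

end

section \<open>The contribution of a single hyperedge\<close>

text \<open>\<open>ys\<close> lists the vertices of the diagonal entries, in the order of their occurrence.\<close>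

definition edge_words :: "nat \<Rightarrow> nat set \<Rightarrow> nat \<Rightarrow> nat list \<Rightarrow> nat list list set" where
  "edge_words k e d ys = {xs. length xs = d \<and>
     (\<forall>x\<in>set xs. length x = k \<and> (diag k x \<and> hd x \<in> e \<or> set x = e)) \<and> map hd (filter (diag k) xs) = ys}"

text \<open>Gathers words on which the product of tensor entries is constant, so that this product
  can be factored out.\<close>

definition edge_coeff :: "nat \<Rightarrow> nat \<Rightarrow> nat \<Rightarrow> nat set \<Rightarrow> nat list \<Rightarrow> real" where
  "edge_coeff n k d e ys = (\<Sum>xs\<in>edge_words k e d ys. weight n k xs)"

lemma diag_map: "k \<ge> 1 \<Longrightarrow> length x = k \<Longrightarrow> inj f \<Longrightarrow> diag k (map f x) = diag k x"
proof -
  assume "k \<ge> 1" "length x = k" "inj f"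
  then have "x \<noteq> []" by auto
  then have "diag k (map f x) \<longleftrightarrow> map f x = map f (replicate k (hd x))"
    by (simp add: diag_def hd_map)
  also have "\<dots> \<longleftrightarrow> x = replicate k (hd x)" by (rule inj_map_eq_map[OF \<open>inj f\<close>])
  finally show ?thesis by (simp only: diag_def)
qed

lemma edge_words_map:
  assumes f: "f permutes S" and k: "k \<ge> 1" and xs: "xs \<in> edge_words k e d ys"
  shows "map (map f) xs \<in> edge_words k (f ` e) d (map f ys)"
proof -
  have inj: "inj f" using f by (rule permutes_inj)
  have len: "length x = k" "x \<noteq> []" if "x \<in> set xs" for x
    using xs that k by (auto simp: edge_words_def)
  have "filter (diag k) (map (map f) xs) = map (map f) (filter (diag k) xs)"
    unfolding filter_map by (rule arg_cong[of _ _ "map (map f)"], rule filter_cong[OF refl])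
      (use diag_map[OF k len(1) inj] in simp)
  moreover have "map hd (map (map f) (filter (diag k) xs)) = map f (map hd (filter (diag k) xs))"
    using len(2) by (auto simp: hd_map)
  moreover have "map hd (filter (diag k) xs) = ys" "length xs = d" using xs by (auto simp: edge_words_def)
  ultimately have "map hd (filter (diag k) (map (map f) xs)) = map f ys" "length (map (map f) xs) = d"
    by (simp_all only: length_map)
  moreover have "length y = k \<and> (diag k y \<and> hd y \<in> f ` e \<or> set y = f ` e)" if y: "y \<in> set (map (map f) xs)" for y
  proof -
    obtain x where x: "x \<in> set xs" "y = map f x" using y by auto
    then have "diag k x \<and> hd x \<in> e \<or> set x = e" using xs by (auto simp: edge_words_def)
    then show ?thesis
      using x len[OF x(1)] diag_map[OF k len(1)[OF x(1)] inj] by (auto simp: hd_map)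
  qed
  ultimately show ?thesis unfolding edge_words_def by blast
qed

lemma edge_coeff_map:
  assumes f: "f permutes {0..<n}" and k: "k \<ge> 1"
  shows "edge_coeff n k d (f ` e) (map f ys) = edge_coeff n k d e ys"
  unfolding edge_coeff_def
proof (rule sum.reindex_bij_witness[where i = "map (map f)" and j = "map (map (Hilbert_Choice.inv f))"])
  let ?g = "Hilbert_Choice.inv f"
  have g: "?g permutes {0..<n}" using f by (rule permutes_inv)
  have gf: "?g ` f ` e = e" using permutes_inverses[OF f] by (simp add: image_image)
  fix xs
  show "map (map f) (map (map ?g) xs) = xs"
    using permutes_inverses[OF f] by (simp add: map_idI)
  show "map (map ?g) (map (map f) xs) = xs"
    using permutes_inverses[OF f] by (simp add: map_idI)
  { assume "xs \<in> edge_words k e d ys"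
    then show "map (map f) xs \<in> edge_words k (f ` e) d (map f ys)" by (rule edge_words_map[OF f k]) }
  { assume xs: "xs \<in> edge_words k (f ` e) d (map f ys)"
    from edge_words_map[OF g k xs] show "map (map ?g) xs \<in> edge_words k e d ys"
      unfolding gf map_inv_permutes[OF f] .
    have "\<forall>x\<in>set xs. x \<noteq> []" using xs k by (auto simp: edge_words_def)
    then show "weight n k (map (map ?g) xs) = weight n k xs"
      by (rule weight_map[OF g]) }
qed

text \<open>Two enumerations of \<open>{0..<n}\<close> are matched position by position: each starts
  with the given list, continues with the rest of the given set and ends with its
  complement.\<close>

lemma exists_permutation_extending:
  fixes n :: nat
  assumes e: "e \<subseteq> {0..<n}" "e' \<subseteq> {0..<n}" "card e = card e'"
    and ys: "distinct ys" "set ys \<subseteq> e" and ys': "distinct ys'" "set ys' \<subseteq> e'" and len: "length ys = length ys'"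
  shows "\<exists>f. f permutes {0..<n} \<and> f ` e = e' \<and> map f ys = ys'"
proof -
  have fin: "finite e" "finite e'" by (rule finite_subset[OF e(1) finite_atLeastLessThan], rule finite_subset[OF e(2) finite_atLeastLessThan])
  obtain us where us: "distinct us" "set us = e - set ys"
    using finite_distinct_list[OF finite_Diff[OF fin(1)]] by metis
  obtain us' where us': "distinct us'" "set us' = e' - set ys'"
    using finite_distinct_list[OF finite_Diff[OF fin(2)]] by metis
  obtain vs where vs: "distinct vs" "set vs = {0..<n} - e"
    using finite_distinct_list[OF finite_Diff[OF finite_atLeastLessThan]] by metis
  obtain vs' where vs': "distinct vs'" "set vs' = {0..<n} - e'"
    using finite_distinct_list[OF finite_Diff[OF finite_atLeastLessThan]] by metis
  have len_us: "length us = length us'"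
    using us us' ys ys' len e(3) fin by (metis card_Diff_subset distinct_card finite_set)
  have len_vs: "length vs = length vs'"
    using vs vs' e fin by (metis card_Diff_subset distinct_card)
  let ?L = "ys @ us @ vs" and ?L' = "ys' @ us' @ vs'"
  have L: "distinct ?L" "set ?L = {0..<n}" and L': "distinct ?L'" "set ?L' = {0..<n}"
    using us us' vs vs' ys ys' e by auto
  define f where "f x = (if x \<in> {0..<n} then the (map_of (zip ?L ?L') x) else x)" for x
  have nth: "f (?L ! j) = ?L' ! j" if "j < length ?L" for j
  proof -
    have "?L ! j \<in> {0..<n}" using that L(2) nth_mem by blast
    moreover have "map_of (zip ?L ?L') (?L ! j) = Some (?L' ! j)"
      using L(1) len len_us len_vs that by (intro map_of_zip_nth) auto
    ultimately show ?thesis by (simp add: f_def)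
  qed
  have "map f ?L = ?L'"
    using len len_us len_vs by (intro nth_equalityI) (simp_all add: nth del: map_append)
  then have m: "map f ys = ys'" "map f us = us'" "map f vs = vs'"
    using len len_us by auto
  have "f ` {0..<n} = {0..<n}" by (metis L(2) L'(2) \<open>map f ?L = ?L'\<close> list.set_map)
  then have "bij_betw f {0..<n} {0..<n}" by (simp add: bij_betw_def eq_card_imp_inj_on)
  then have "f permutes {0..<n}" by (rule bij_imp_permutes) (auto simp: f_def)
  moreover have "f ` e = e'"
  proof -
    have "e = set ys \<union> set us" "e' = set ys' \<union> set us'" using us us' ys ys' by auto
    then show ?thesis using m by (metis image_Un list.set_map)
  qed
  ultimately show ?thesis using m by blast
qed

text \<open>Only lists without repetitions are covered; \<open>[i, i]\<close> is moved by a
  permutation that sends \<open>i\<close> to the reference vertex.\<close>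

lemma edge_coeff_cong:
  assumes "e \<subseteq> {0..<n}" "e' \<subseteq> {0..<n}" "card e = card e'"
    "distinct ys" "set ys \<subseteq> e" "distinct ys'" "set ys' \<subseteq> e'" "length ys = length ys'" "k \<ge> 1"
  shows "edge_coeff n k d e ys = edge_coeff n k d e' ys'"
  using exists_permutation_extending[OF assms(1-8)] edge_coeff_map[OF _ assms(9)] by metis

lemma weight_replicate_cong:
  assumes "i < n" "j < n" "k \<ge> 1"
  shows "weight n k (replicate d (replicate k i)) = weight n k (replicate d (replicate k j))"
proof -
  obtain f where f: "f permutes {0..<n}" "map f [i] = [j]"
    using exists_permutation_extending[of "{0..<n}" n "{0..<n}" "[i]" "[j]"] assms by auto
  then show ?thesis
    using weight_map[OF f(1), of "replicate d (replicate k i)" k] assms(3) by auto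
qed

context linear_uniform
begin

lemma prod_edge_word:
  assumes "e \<in> edges H" "xs \<in> edge_words k e d ys"
  shows "(\<Prod>x\<leftarrow>xs. A_alpha k \<alpha> H x) =
    (\<Prod>y\<leftarrow>ys. \<alpha> * real (vertex_degree H y)) * ((1 - \<alpha>) / fact (k - 1)) ^ (d - length ys)"
  using assms(2)
proof (induction xs arbitrary: d ys)
  case Nil
  then show ?case by (simp add: edge_words_def)
next
  case (Cons x xs)
  show ?case
  proof (cases "diag k x")
    case True
    then obtain ys' where ys: "ys = hd x # ys'" "xs \<in> edge_words k e (d - 1) ys'"
      using Cons.prems by (auto simp: edge_words_def)
    show ?thesis using Cons.IH[OF ys(2)] A_alpha_diag[OF True] ys(1) by simp
  next
    case False
    then have xs: "xs \<in> edge_words k e (d - 1) ys" and x: "length x = k" "set x = e"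
      using Cons.prems by (auto simp: edge_words_def)
    have "length (filter (diag k) xs) = length ys" "length xs = d - 1"
      using xs by (auto simp: edge_words_def)
    then have "length ys \<le> d - 1" by (metis length_filter_le)
    moreover have "d \<ge> 1" using Cons.prems by (auto simp: edge_words_def)
    ultimately have "d - length ys = Suc (d - 1 - length ys)" by simp
    then show ?thesis using Cons.IH[OF xs] A_alpha_not_diag[OF False x(1)] x(2) assms(1) by simp
  qed
qed

lemma edge_words_subset:
  assumes "e \<in> edges H"
  shows "edge_words k e d ys \<subseteq> words (nverts H) k d"
proof
  fix xs assume xs: "xs \<in> edge_words k e d ys"
  have "x \<in> index_lists (nverts H) k" if "x \<in> set xs" for x
  proof -
    have "length x = k" "diag k x \<and> hd x \<in> e \<or> set x = e" using xs that by (auto simp: edge_words_def)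
    moreover have "set x = {hd x}" if "diag k x"
      using that k3 by (metis diag_def not_numeral_le_zero set_replicate)
    ultimately show ?thesis using edge_subset[OF assms] by (auto simp: index_lists_def)
  qed
  then show "xs \<in> words (nverts H) k d" using xs by (auto simp: words_def edge_words_def)
qed

text \<open>Such a word determines its hyperedge, which makes the families for different pairs
  \<open>(e, ys)\<close> disjoint from each other and from the purely diagonal words.\<close>

lemma edge_words_edge:
  assumes "xs \<in> edge_words k e d ys" "length ys < d"
  shows "\<exists>x\<in>set xs. \<not> diag k x" and "x \<in> set xs \<Longrightarrow> \<not> diag k x \<Longrightarrow> set x = e"
proof -
  show "\<exists>x\<in>set xs. \<not> diag k x"
  proof (rule ccontr)
    assume "\<not> ?thesis"
    then have "filter (diag k) xs = xs" by (intro filter_True) auto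
    then show False using assms by (auto simp: edge_words_def)
  qed
qed (use assms in \<open>auto simp: edge_words_def\<close>)

lemma Tr_A_alpha_low:
  assumes d: "1 \<le> d" "d \<le> k + 2"
  shows "Tr k (nverts H) d (A_alpha k \<alpha> H) = real ((k - 1) ^ (nverts H - 1)) *
    ((\<Sum>i<nverts H. weight (nverts H) k (replicate d (replicate k i)) * (\<alpha> * real (vertex_degree H i)) ^ d) +
     (if k \<le> d then \<Sum>e\<in>edges H. \<Sum>ys | length ys = d - k \<and> set ys \<subseteq> e.
        edge_coeff (nverts H) k d e ys * ((1 - \<alpha>) / fact (k - 1)) ^ k * (\<Prod>y\<leftarrow>ys. \<alpha> * real (vertex_degree H y))
      else 0))"
proof -
  let ?n = "nverts H"
  define g where "g xs = weight ?n k xs * (\<Prod>x\<leftarrow>xs. A_alpha k \<alpha> H x)" for xs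
  define D where "D = (\<lambda>i. replicate d (replicate k i)) ` {..<?n}"
  \<comment> \<open>For \<open>d < k\<close> a hyperedge cannot be used \<open>k\<close> times;
    without the case distinction, truncated subtraction would admit the empty list.\<close>
  define I where "I = (if k \<le> d then SIGMA e:edges H. {ys. length ys = d - k \<and> set ys \<subseteq> e} else {})"
  \<comment> \<open>A word in \<open>B\<close> may have a vertex of the hyperedge as head of two
    non-diagonal entries; by balance its weight is \<open>0\<close>, so it does no harm.\<close>
  define B where "B = (\<Union>(e, ys)\<in>I. edge_words k e d ys)"
  have I: "e \<in> edges H" "length ys = d - k" "k \<le> d" if "(e, ys) \<in> I" for e ys
    using that unfolding I_def by (auto split: if_splits)
  have fin_ys: "finite {ys. length ys = d - k \<and> set ys \<subseteq> e}" if "e \<in> edges H" for e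
    using finite_lists_length_eq[OF finite_edge[OF that], of "d - k"] by (simp add: conj_commute)
  have fin_I: "finite I" unfolding I_def using finite_edges fin_ys by auto
  have fin_D: "finite D" unfolding D_def by simp
  have fin_W: "finite (edge_words k e d ys)" if "e \<in> edges H" for e ys
    using edge_words_subset[OF that] finite_words finite_subset by blast
  have fin_B: "finite B" unfolding B_def using fin_I fin_W I(1) by auto
  have sub: "D \<union> B \<subseteq> words ?n k d"
  proof -
    have "D \<subseteq> words ?n k d" unfolding D_def words_def index_lists_def by auto
    moreover have "B \<subseteq> words ?n k d" unfolding B_def using edge_words_subset I(1) by fast
    ultimately show ?thesis by blast
  qed
  have zero: "g xs = 0" if xs: "xs \<in> words ?n k d - (D \<union> B)" for xs
  proof (rule ccontr)
    assume "g xs \<noteq> 0"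
    then have w: "weight ?n k xs \<noteq> 0" and p: "(\<Prod>x\<leftarrow>xs. A_alpha k \<alpha> H x) \<noteq> 0"
      unfolding g_def by auto
    have len: "length xs = d" "\<forall>x\<in>set xs. length x = k" and sub: "\<forall>x\<in>set xs. set x \<subseteq> {0..<?n}"
      using xs by (auto simp: words_def index_lists_def)
    have "\<forall>x\<in>set xs. diag k x \<or> set x \<in> edges H"
    proof
      fix x assume "x \<in> set xs"
      then have "A_alpha k \<alpha> H x \<noteq> 0" "length x = k" using p len by (auto simp: prod_list_zero_iff)
      then show "diag k x \<or> set x \<in> edges H" using A_alpha_not_diag[of x] by metis
    qed
    from surviving_word[OF len this w d] show False
    proof (elim disjE exE bexE conjE)
      fix i assume i: "xs = replicate d (replicate k i)"
      then have "i < ?n" using sub d k3 by auto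
      then show False using xs i by (auto simp: D_def)
    next
      fix e assume e: "e \<in> edges H" "length (filter (\<lambda>x. \<not> diag k x) xs) = k"
        "\<forall>x\<in>set xs. diag k x \<and> hd x \<in> e \<or> set x = e"
      let ?ys = "map hd (filter (diag k) xs)"
      have "length ?ys + k = d"
        using sum_length_filter_compl[of "diag k" xs] e(2) len(1) by simp
      moreover have "hd x \<in> e" if "x \<in> set xs" "diag k x" for x
        using e(3) that diag_not_edge e(1) by metis
      then have "set ?ys \<subseteq> e" by auto
      ultimately have "(e, ?ys) \<in> I" using e(1) unfolding I_def by auto
      moreover have "xs \<in> edge_words k e d ?ys"
        using e(3) len by (auto simp: edge_words_def)
      ultimately show False using xs unfolding B_def by blast
    qed
  qed
  have nondiag: "(\<exists>x\<in>set xs. \<not> diag k x) \<and> (\<forall>x\<in>set xs. \<not> diag k x \<longrightarrow> set x = e) \<and>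
      map hd (filter (diag k) xs) = ys" if "(e, ys) \<in> I" "xs \<in> edge_words k e d ys" for e ys xs
  proof -
    have "length ys < d" using I[OF that(1)] k3 by simp
    with edge_words_edge[OF that(2)] that(2) show ?thesis by (auto simp: edge_words_def)
  qed
  have disj: "D \<inter> B = {}"
  proof -
    have "diag k (replicate k i)" for i unfolding diag_def using k3 by (cases k) auto
    then have "\<forall>x\<in>set xs. diag k x" if "xs \<in> D" for xs using that unfolding D_def by auto
    then show ?thesis using nondiag unfolding B_def by fast
  qed
  have Tr: "Tr k ?n d (A_alpha k \<alpha> H) = real ((k - 1) ^ (?n - 1)) * (\<Sum>xs\<in>words ?n k d. g xs)"
    unfolding g_def using k3 d by (intro Tr_eq_sum_words) auto
  have "(\<Sum>xs\<in>words ?n k d. g xs) = (\<Sum>xs\<in>D \<union> B. g xs)"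
    by (rule sum.mono_neutral_right[OF finite_words sub]) (use zero in blast)
  also have "\<dots> = (\<Sum>xs\<in>D. g xs) + (\<Sum>xs\<in>B. g xs)"
    by (rule sum.union_disjoint[OF fin_D fin_B disj])
  also have "(\<Sum>xs\<in>D. g xs) =
      (\<Sum>i<?n. weight ?n k (replicate d (replicate k i)) * (\<alpha> * real (vertex_degree H i)) ^ d)"
  proof -
    have "inj_on (\<lambda>i. replicate d (replicate k i)) {..<?n}"
      using d k3 by (auto simp: inj_on_def)
    moreover have "A_alpha k \<alpha> H (replicate k i) = \<alpha> * real (vertex_degree H i)" for i
      using A_alpha_diag[of "replicate k i"] k3 by (cases k) (simp_all add: diag_def)
    ultimately show ?thesis unfolding D_def g_def by (simp add: sum.reindex prod_list_replicate)
  qed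
  also have "(\<Sum>xs\<in>B. g xs) = (\<Sum>(e, ys)\<in>I. \<Sum>xs\<in>edge_words k e d ys. g xs)"
    unfolding B_def
  proof (subst sum.UNION_disjoint[OF fin_I])
    show "\<forall>i\<in>I. finite (case i of (e, ys) \<Rightarrow> edge_words k e d ys)" using fin_W I(1) by auto
    show "\<forall>i\<in>I. \<forall>j\<in>I. i \<noteq> j \<longrightarrow>
       (case i of (e, ys) \<Rightarrow> edge_words k e d ys) \<inter> (case j of (e, ys) \<Rightarrow> edge_words k e d ys) = {}"
    proof (intro ballI impI equals0I)
      fix i j xs
      assume "i \<in> I" "j \<in> I" "i \<noteq> j"
        "xs \<in> (case i of (e, ys) \<Rightarrow> edge_words k e d ys) \<inter> (case j of (e, ys) \<Rightarrow> edge_words k e d ys)"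
      then show False
        using nondiag[of "fst i" "snd i" xs] nondiag[of "fst j" "snd j" xs]
        by (cases i; cases j) auto
    qed
  qed (simp add: case_prod_beta)
  also have "\<dots> = (\<Sum>(e, ys)\<in>I. edge_coeff ?n k d e ys * ((1 - \<alpha>) / fact (k - 1)) ^ k *
      (\<Prod>y\<leftarrow>ys. \<alpha> * real (vertex_degree H y)))"
  proof (rule sum.cong[OF refl], clarify)
    fix e ys assume eys: "(e, ys) \<in> I"
    have "d - length ys = k" using I[OF eys] by simp
    then have "g xs = weight ?n k xs * (((1 - \<alpha>) / fact (k - 1)) ^ k * (\<Prod>y\<leftarrow>ys. \<alpha> * real (vertex_degree H y)))"
      if "xs \<in> edge_words k e d ys" for xs
      unfolding g_def using prod_edge_word[OF I(1)[OF eys] that] by simp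
    then show "(\<Sum>xs\<in>edge_words k e d ys. g xs) = edge_coeff ?n k d e ys * ((1 - \<alpha>) / fact (k - 1)) ^ k *
      (\<Prod>y\<leftarrow>ys. \<alpha> * real (vertex_degree H y))"
      by (simp add: edge_coeff_def sum_distrib_right mult.assoc)
  qed
  also have "\<dots> = (if k \<le> d then \<Sum>e\<in>edges H. \<Sum>ys | length ys = d - k \<and> set ys \<subseteq> e.
        edge_coeff (nverts H) k d e ys * ((1 - \<alpha>) / fact (k - 1)) ^ k * (\<Prod>y\<leftarrow>ys. \<alpha> * real (vertex_degree H y))
      else 0)"
    unfolding I_def using finite_edges fin_ys by (auto simp: sum.Sigma)
  finally show ?thesis unfolding Tr by (rule arg_cong)
qed

end

section \<open>Closed walks through prescribed arcs, and positivity of the deciding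
  coefficients\<close>

lemma cyclic_arcs_append:
  assumes "xs \<noteq> []" "ys \<noteq> []" "hd xs = hd ys"
  shows "cyclic_arcs (xs @ ys) = cyclic_arcs xs @ cyclic_arcs ys"
proof -
  obtain a xs' ys' where xs: "xs = a # xs'" and ys: "ys = a # ys'"
    using assms by (cases xs; cases ys) auto
  have "cyclic_arcs (xs @ ys) = zip ((a # xs') @ (a # ys')) ((xs' @ [a]) @ (ys' @ [a]))"
    by (simp add: cyclic_arcs_def xs ys)
  also have "\<dots> = zip (a # xs') (xs' @ [a]) @ zip (a # ys') (ys' @ [a])"
    by (rule zip_append) simp
  finally show ?thesis by (simp add: cyclic_arcs_def xs ys)
qed

lemma mset_cyclic_arcs_rotate: "mset (cyclic_arcs (xs @ ys)) = mset (cyclic_arcs (ys @ xs))"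
proof -
  have rotate1: "cyclic_arcs (rotate1 ws) = rotate1 (cyclic_arcs ws)" for ws :: "'a list"
  proof (cases ws)
    case (Cons a w)
    show ?thesis
    proof (cases w)
      case (Cons b w')
      have "cyclic_arcs (rotate1 ws) = zip ((b # w') @ [a]) ((w' @ [a]) @ [b])"
        by (simp add: cyclic_arcs_def \<open>ws = a # w\<close> Cons)
      also have "\<dots> = zip (b # w') (w' @ [a]) @ [(a, b)]" by (subst zip_append) simp_all
      finally show ?thesis by (simp add: cyclic_arcs_def \<open>ws = a # w\<close> Cons)
    qed (simp add: cyclic_arcs_def \<open>ws = a # w\<close>)
  qed (simp add: cyclic_arcs_def)
  have "cyclic_arcs (rotate m ws) = rotate m (cyclic_arcs ws)" for m and ws :: "'a list"
    by (induction m) (simp_all add: rotate1)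
  moreover have "rotate (length xs) (xs @ ys) = ys @ xs" by (rule rotate_append)
  moreover have "mset (rotate m as) = mset as" for m and as :: "('a \<times> 'a) list"
  proof (induction m)
    case (Suc m)
    have "mset (rotate1 bs) = mset bs" for bs :: "('a \<times> 'a) list" by (cases bs) simp_all
    with Suc show ?case by simp
  qed simp
  ultimately show ?thesis by metis
qed

lemma cyclic_arcs_replicate: "cyclic_arcs (replicate m i) = replicate m (i, i)"
  by (simp add: cyclic_arcs_def rotate1_replicate)

text \<open>Positivity of the coefficient at two distinct vertices needs one closed walk along all arcs of the
  complete digraph on a hyperedge and along loops at both vertices. It is spliced together from
  loops and walks of length two.\<close>

lemma circuit_splice:
  assumes "v \<in> set ws" "v \<in> set ws'"
  shows "\<exists>us. set us = set ws \<union> set ws' \<and>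
    mset (cyclic_arcs us) = mset (cyclic_arcs ws) + mset (cyclic_arcs ws')"
proof -
  obtain xs ys where ws: "ws = xs @ v # ys" using split_list[OF assms(1)] by blast
  obtain xs' ys' where ws': "ws' = xs' @ v # ys'" using split_list[OF assms(2)] by blast
  let ?us = "(v # ys @ xs) @ (v # ys' @ xs')"
  have "mset (cyclic_arcs ?us) = mset (cyclic_arcs ((v # ys) @ xs)) + mset (cyclic_arcs ((v # ys') @ xs'))"
    by (subst cyclic_arcs_append) auto
  also have "\<dots> = mset (cyclic_arcs ws) + mset (cyclic_arcs ws')"
    unfolding ws ws' mset_cyclic_arcs_rotate[of "v # ys" xs] mset_cyclic_arcs_rotate[of "v # ys'" xs'] ..
  finally show ?thesis by (intro exI[of _ ?us]) (auto simp: ws ws')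
qed

text \<open>For each \<open>u\<close> in \<open>G\<close> the detour from \<open>u\<close> to
  \<open>v\<close> and back is spliced into the walk at \<open>u\<close>.\<close>

lemma circuit_star:
  assumes "finite G" "G \<subseteq> set ws" "v \<notin> set ws"
  shows "\<exists>us. set us = set ws \<union> (if G = {} then {} else {v}) \<and>
    mset (cyclic_arcs us) = mset (cyclic_arcs ws) + mset_set (G \<times> {v} \<union> {v} \<times> G)"
  using assms
proof (induction G rule: finite_induct)
  case empty
  then show ?case by (intro exI[of _ ws]) simp
next
  case (insert u G)
  then obtain us where us: "set us = set ws \<union> (if G = {} then {} else {v})"
    "mset (cyclic_arcs us) = mset (cyclic_arcs ws) + mset_set (G \<times> {v} \<union> {v} \<times> G)" by auto
  have "u \<in> set us" "u \<in> set [u, v]" using us insert by auto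
  from circuit_splice[OF this] obtain us' where us': "set us' = set us \<union> {u, v}"
    "mset (cyclic_arcs us') = mset (cyclic_arcs us) + {#(u, v), (v, u)#}"
    by (auto simp: cyclic_arcs_def)
  have "u \<noteq> v" using insert by auto
  have "insert u G \<times> {v} \<union> {v} \<times> insert u G = insert (u, v) (insert (v, u) (G \<times> {v} \<union> {v} \<times> G))" by auto
  then have "mset_set (insert u G \<times> {v} \<union> {v} \<times> insert u G) =
      {#(u, v), (v, u)#} + mset_set (G \<times> {v} \<union> {v} \<times> G)"
    using insert \<open>u \<noteq> v\<close> by simp
  then show ?case using us us' insert by (intro exI[of _ us']) auto
qed

definition distinct_pairs :: "'a set \<Rightarrow> ('a \<times> 'a) set" where
  "distinct_pairs F = {(u, v). u \<in> F \<and> v \<in> F \<and> u \<noteq> v}"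

text \<open>The \<open>m\<close> loops at \<open>i\<close> are the initial walk. Each further vertex
  is joined to all earlier ones by a star of detours.\<close>

lemma circuit_complete:
  assumes "finite F" "m \<ge> 1" "i \<notin> F"
  shows "\<exists>ws. set ws = insert i F \<and>
    mset (cyclic_arcs ws) = replicate_mset m (i, i) + mset_set (distinct_pairs (insert i F))"
  using assms
proof (induction F rule: finite_induct)
  case empty
  have "distinct_pairs {i} = {}" by (auto simp: distinct_pairs_def)
  then show ?case using empty by (intro exI[of _ "replicate m i"]) (simp add: cyclic_arcs_replicate)
next
  case (insert w F)
  let ?G = "insert i F"
  have "i \<notin> F" using insert.prems by simp
  from insert.IH[OF insert.prems(1) this] obtain ws where ws: "set ws = ?G"
    "mset (cyclic_arcs ws) = replicate_mset m (i, i) + mset_set (distinct_pairs ?G)"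
    by (elim exE conjE)
  have w: "w \<notin> ?G" using insert by auto
  have G: "finite ?G" using insert.hyps(1) by simp
  obtain us where us: "set us = insert w ?G"
    "mset (cyclic_arcs us) = mset (cyclic_arcs ws) + mset_set (?G \<times> {w} \<union> {w} \<times> ?G)"
    using circuit_star[of ?G ws w] ws(1) G w by auto
  have "finite (distinct_pairs ?G)"
    by (rule finite_subset[of _ "?G \<times> ?G"]) (use G in \<open>auto simp: distinct_pairs_def\<close>)
  moreover have "distinct_pairs ?G \<inter> (?G \<times> {w} \<union> {w} \<times> ?G) = {}" using w by (auto simp: distinct_pairs_def)
  moreover have "finite (?G \<times> {w} \<union> {w} \<times> ?G)" using G by simp
  ultimately have "mset_set (distinct_pairs ?G \<union> (?G \<times> {w} \<union> {w} \<times> ?G)) =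
      mset_set (distinct_pairs ?G) + mset_set (?G \<times> {w} \<union> {w} \<times> ?G)"
    by (intro mset_set_Union)
  moreover have "distinct_pairs ?G \<union> (?G \<times> {w} \<union> {w} \<times> ?G) = distinct_pairs (insert w ?G)"
    using w by (auto simp: distinct_pairs_def)
  ultimately have "mset (cyclic_arcs us) = replicate_mset m (i, i) + mset_set (distinct_pairs (insert w ?G))"
    using us(2) ws(2) by (simp only: add.assoc)
  then show ?case using us(1) unfolding insert_commute[of i w F] by (intro exI[of _ us] conjI)
qed

lemma arcs_of_replicate: "arcs_of (replicate k i) = replicate (k - 1) (i, i)"
  by (cases k) (simp_all add: arcs_of_def)

text \<open>One closed walk suffices. Its length need not be prescribed, as it equals the number of
  arcs of \<open>xs\<close>.\<close>

lemma weight_pos: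
  assumes "\<forall>x\<in>set xs. length x = k" "set ws \<subseteq> {0..<n}" "mset (cyclic_arcs ws) = mset (arcs xs)"
  shows "weight n k xs > 0"
proof -
  have "length ws = length xs * (k - 1)"
    using length_arcs[OF assms(1)] mset_eq_length[OF assms(3)] by (simp add: length_cyclic_arcs)
  then have "ws \<in> circuits n (length xs * (k - 1)) (arcs xs)"
    using assms by (simp add: circuits_def index_lists_def)
  then have "weight n k xs \<noteq> 0" unfolding weight_eq_0_iff by blast
  with weight_nonneg[of n k xs] show ?thesis by simp
qed

lemma weight_replicate_pos:
  assumes "i < n"
  shows "weight n k (replicate d (replicate k i)) > 0"
proof (rule weight_pos[where ws = "replicate (d * (k - 1)) i"])
  have "arcs (replicate d (replicate k i)) = replicate (d * (k - 1)) (i, i)"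
    by (induction d) (simp_all add: arcs_def arcs_of_replicate replicate_add)
  then show "mset (cyclic_arcs (replicate (d * (k - 1)) i)) = mset (arcs (replicate d (replicate k i)))"
    by (simp add: cyclic_arcs_replicate)
qed (use assms in auto)

text \<open>As weights are nonnegative, one word of positive weight is enough: diagonal entries at
  \<open>i\<close> and \<open>j\<close>, then for each vertex of \<open>e\<close> an entry with this
  vertex as head. Its arcs are those of the complete digraph on \<open>e\<close> and
  \<open>k - 1\<close> loops at each of \<open>i\<close> and \<open>j\<close>.\<close>

lemma edge_coeff_pair_pos:
  assumes e: "e \<subseteq> {0..<n}" "card e = k" and k: "k \<ge> 2" and ij: "i \<in> e" "j \<in> e" "i \<noteq> j"
  shows "edge_coeff n k (k + 2) e [i, j] > 0"
proof -
  have fin: "finite e" using e(1) by (rule finite_subset) simp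
  define row where "row v = v # sorted_list_of_set (e - {v})" for v
  define xs where "xs = replicate k i # replicate k j # map row (sorted_list_of_set e)"
  have row: "length (row v) = k" "set (row v) = e" "hd (row v) = v" if "v \<in> e" for v
    using that e(2) fin k by (auto simp: row_def card_Diff_singleton)
  have not_diag: "\<not> diag k (row v)" if "v \<in> e" for v
  proof
    assume "diag k (row v)"
    then have "set (row v) \<subseteq> {v}" using row[OF that]
      by (metis diag_def empty_subsetI set_replicate_conv_if order_refl)
    then show False using row[OF that] ij by auto
  qed
  have diag_rep: "diag k (replicate k v)" "hd (replicate k v) = v" for v
    using k by (cases k; simp add: diag_def)+
  have "filter (diag k) (map row (sorted_list_of_set e)) = []"
    using not_diag fin by (auto simp: filter_empty_conv)
  moreover have "length (sorted_list_of_set e) = k" using e(2) by simp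
  ultimately have xs_in: "xs \<in> edge_words k e (k + 2) [i, j]"
    using diag_rep row ij fin by (auto simp: edge_words_def xs_def)
  have len: "\<forall>x\<in>set xs. length x = k" using xs_in by (auto simp: edge_words_def)
  let ?P = "distinct_pairs e"
  let ?as = "concat (map (\<lambda>v. arcs_of (row v)) (sorted_list_of_set e))"
  have fst: "fst p = v" if "p \<in> set (arcs_of (row v))" for p v
    using that by (auto simp: arcs_of_def row_def)
  have ne: "arcs_of (row v) \<noteq> []" if "v \<in> e" for v
    using row(1)[OF that] k by (simp add: arcs_of_def flip: length_0_conv)
  have "distinct ?as"
  proof (rule distinct_concat)
    show "distinct (map (\<lambda>v. arcs_of (row v)) (sorted_list_of_set e))"
    proof (simp add: distinct_map, rule inj_onI)
      fix u v assume "u \<in> set (sorted_list_of_set e)" "v \<in> set (sorted_list_of_set e)"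
        "arcs_of (row u) = arcs_of (row v)"
      then show "u = v" using ne[of u] fst fin by (metis list.set_sel(1) set_sorted_list_of_set)
    qed
    show "distinct zs" if "zs \<in> set (map (\<lambda>v. arcs_of (row v)) (sorted_list_of_set e))" for zs
      using that by (auto simp: arcs_of_def row_def distinct_map inj_on_def)
    show "set zs \<inter> set zs' = {}"
      if zs: "zs \<in> set (map (\<lambda>v. arcs_of (row v)) (sorted_list_of_set e))"
        "zs' \<in> set (map (\<lambda>v. arcs_of (row v)) (sorted_list_of_set e))" "zs \<noteq> zs'" for zs zs'
    proof -
      obtain u v where "zs = arcs_of (row u)" "zs' = arcs_of (row v)" "u \<noteq> v" using zs by auto
      then show ?thesis using fst by blast
    qed
  qed
  moreover have "set ?as = ?P" using fin by (auto simp: arcs_of_def row_def distinct_pairs_def)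
  ultimately have "mset ?as = mset_set ?P" by (metis mset_set_set)
  then have mset_arcs: "mset (arcs xs) = replicate_mset (k - 1) (i, i) + replicate_mset (k - 1) (j, j) + mset_set ?P"
    by (simp add: arcs_def xs_def arcs_of_replicate comp_def)
  have k1: "k - 1 \<ge> 1" using k by linarith
  have ins: "insert i (e - {i}) = e" using ij(1) by (rule insert_Diff)
  obtain ws where ws: "set ws = e" "mset (cyclic_arcs ws) = replicate_mset (k - 1) (i, i) + mset_set ?P"
    using circuit_complete[OF finite_Diff[OF fin] k1, of i "{i}"] unfolding ins by auto
  have "j \<in> set ws" "j \<in> set (replicate (k - 1) j)" using ws(1) ij k1 by auto
  from circuit_splice[OF this] obtain us where us: "set us = set ws \<union> set (replicate (k - 1) j)"
    "mset (cyclic_arcs us) = mset (cyclic_arcs ws) + mset (cyclic_arcs (replicate (k - 1) j))"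
    by (elim exE conjE)
  have "set us \<subseteq> {0..<n}" using us(1) ws(1) ij(2) e(1) by auto
  moreover have "mset (cyclic_arcs us) = mset (arcs xs)"
    unfolding us(2) ws(2) mset_arcs cyclic_arcs_replicate by simp
  ultimately have "weight n k xs > 0"
    by (rule weight_pos[OF len])
  moreover have "finite (edge_words k e (k + 2) [i, j])"
  proof (rule finite_subset)
    show "edge_words k e (k + 2) [i, j] \<subseteq> words n k (k + 2)"
    proof
      fix ys assume ys: "ys \<in> edge_words k e (k + 2) [i, j]"
      have "y \<in> index_lists n k" if y: "y \<in> set ys" for y
      proof -
        have y': "length y = k" "diag k y \<and> hd y \<in> e \<or> set y = e" using ys y by (auto simp: edge_words_def)
        moreover have "set y = {hd y}" if "diag k y"
          using that k by (metis diag_def not_numeral_le_zero set_replicate)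
        ultimately show ?thesis using e(1) by (auto simp: index_lists_def)
      qed
      then show "ys \<in> words n k (k + 2)" using ys by (auto simp: words_def edge_words_def)
    qed
  qed (rule finite_words)
  ultimately show ?thesis
    unfolding edge_coeff_def using xs_in weight_nonneg by (intro sum_pos2) auto
qed

section \<open>The traces up to order \<open>k + 2\<close> in terms of degrees\<close>

context linear_uniform
begin

lemma sum_over_edges:
  fixes g :: "nat \<Rightarrow> real"
  shows "(\<Sum>e\<in>edges H. \<Sum>i\<in>e. g i) = (\<Sum>i<nverts H. real (vertex_degree H i) * g i)"
proof -
  have "(\<Sum>e\<in>edges H. \<Sum>i\<in>e. g i) = (\<Sum>e\<in>edges H. \<Sum>i\<in>{i \<in> {..<nverts H}. i \<in> e}. g i)"
  proof (rule sum.cong[OF refl])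
    fix e assume "e \<in> edges H"
    then have "{i \<in> {..<nverts H}. i \<in> e} = e" using edge_subset by fastforce
    then show "(\<Sum>i\<in>e. g i) = (\<Sum>i\<in>{i \<in> {..<nverts H}. i \<in> e}. g i)" by simp
  qed
  also have "\<dots> = (\<Sum>i<nverts H. \<Sum>e\<in>{e \<in> edges H. i \<in> e}. g i)"
    by (rule sum.swap_restrict) (simp_all add: finite_edges)
  finally show ?thesis by (simp add: vertex_degree_def)
qed

lemma sum_degrees: "(\<Sum>i<nverts H. vertex_degree H i) = k * card (edges H)"
proof -
  have "(\<Sum>i<nverts H. real (vertex_degree H i)) = (\<Sum>e\<in>edges H. \<Sum>i\<in>e. 1)"
    using sum_over_edges[of "\<lambda>_. 1"] by simp
  also have "\<dots> = real (k * card (edges H))" using card_edge by simp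
  finally show ?thesis by (metis of_nat_eq_iff of_nat_sum)
qed

lemma vertex_part:
  "(\<Sum>i<nverts H. weight (nverts H) k (replicate d (replicate k i)) * (\<alpha> * real (vertex_degree H i)) ^ d) =
   weight (nverts H) k (replicate d (replicate k 0)) * \<alpha> ^ d * (\<Sum>i<nverts H. real (vertex_degree H i) ^ d)"
  unfolding sum_distrib_left
proof (rule sum.cong[OF refl])
  fix i assume "i \<in> {..<nverts H}"
  then have "weight (nverts H) k (replicate d (replicate k i)) = weight (nverts H) k (replicate d (replicate k 0))"
    using k3 by (intro weight_replicate_cong) auto
  then show "weight (nverts H) k (replicate d (replicate k i)) * (\<alpha> * real (vertex_degree H i)) ^ d =
      weight (nverts H) k (replicate d (replicate k 0)) * \<alpha> ^ d * real (vertex_degree H i) ^ d"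
    by (simp only: power_mult_distrib mult.assoc)
qed

lemma Tr_below_k:
  assumes "1 \<le> d" "d < k"
  shows "Tr k (nverts H) d (A_alpha k \<alpha> H) = real ((k - 1) ^ (nverts H - 1)) *
    (weight (nverts H) k (replicate d (replicate k 0)) * \<alpha> ^ d * (\<Sum>i<nverts H. real (vertex_degree H i) ^ d))"
  using Tr_A_alpha_low[of d \<alpha>] assms unfolding vertex_part by simp

text \<open>\<open>{0..<k}\<close> serves as a reference hyperedge, so that the coefficients depend
  on \<open>H\<close> only through its number of vertices. It lies among the vertices because
  \<open>e\<close> already has \<open>k\<close> of them.\<close>

lemma edge_coeff_standard:
  assumes e: "e \<in> edges H"
  shows "edge_coeff (nverts H) k d e [] = edge_coeff (nverts H) k d {0..<k} []"
    and "i \<in> e \<Longrightarrow> edge_coeff (nverts H) k d e [i] = edge_coeff (nverts H) k d {0..<k} [0]"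
    and "i \<in> e \<Longrightarrow> edge_coeff (nverts H) k d e [i, i] = edge_coeff (nverts H) k d {0..<k} [0, 0]"
    and "i \<in> e \<Longrightarrow> j \<in> e \<Longrightarrow> i \<noteq> j \<Longrightarrow>
      edge_coeff (nverts H) k d e [i, j] = edge_coeff (nverts H) k d {0..<k} [0, 1]"
proof -
  have "card e \<le> nverts H" using card_mono[OF _ edge_subset[OF e]] by simp
  then have E: "e \<subseteq> {0..<nverts H}" "{0..<k} \<subseteq> {0..<nverts H}" "card e = card {0..<k}"
    using edge_subset[OF e] card_edge[OF e] by auto
  have k: "k \<ge> 1" using k3 by simp
  show "edge_coeff (nverts H) k d e [] = edge_coeff (nverts H) k d {0..<k} []"
    by (rule edge_coeff_cong[OF E]) (use k in auto)
  show "edge_coeff (nverts H) k d e [i] = edge_coeff (nverts H) k d {0..<k} [0]" if "i \<in> e"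
    by (rule edge_coeff_cong[OF E]) (use k that in auto)
  show "edge_coeff (nverts H) k d e [i, j] = edge_coeff (nverts H) k d {0..<k} [0, 1]" if "i \<in> e" "j \<in> e" "i \<noteq> j"
    by (rule edge_coeff_cong[OF E]) (use k3 that in auto)
  show "edge_coeff (nverts H) k d e [i, i] = edge_coeff (nverts H) k d {0..<k} [0, 0]" if i: "i \<in> e"
  proof -
    obtain f where f: "f permutes {0..<nverts H}" "f ` e = {0..<k}" "map f [i] = [0]"
      using exists_permutation_extending[OF E, of "[i]" "[0]"] k i by auto
    with edge_coeff_map[OF f(1) k, of d e "[i, i]"] show ?thesis by simp
  qed
qed

lemma Tr_k:
  "Tr k (nverts H) k (A_alpha k \<alpha> H) = real ((k - 1) ^ (nverts H - 1)) *
    (weight (nverts H) k (replicate k (replicate k 0)) * \<alpha> ^ k * (\<Sum>i<nverts H. real (vertex_degree H i) ^ k) +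
     real (card (edges H)) * (edge_coeff (nverts H) k k {0..<k} [] * ((1 - \<alpha>) / fact (k - 1)) ^ k))"
proof -
  have "{ys. ys = [] \<and> set ys \<subseteq> e} = {[]}" for e :: "nat set" by auto
  then show ?thesis
    using Tr_A_alpha_low[of k \<alpha>] k3 unfolding vertex_part by (simp add: edge_coeff_standard(1))
qed

text \<open>The one diagonal entry contributes the degree of its vertex, and each vertex is met once
  per hyperedge through it; this squares the degree.\<close>

lemma Tr_Suc_k:
  "Tr k (nverts H) (k + 1) (A_alpha k \<alpha> H) = real ((k - 1) ^ (nverts H - 1)) *
    (weight (nverts H) k (replicate (k + 1) (replicate k 0)) * \<alpha> ^ (k + 1) * (\<Sum>i<nverts H. real (vertex_degree H i) ^ (k + 1)) +
     edge_coeff (nverts H) k (k + 1) {0..<k} [0] * ((1 - \<alpha>) / fact (k - 1)) ^ k * \<alpha> *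
       (\<Sum>i<nverts H. real (vertex_degree H i) ^ 2))"
proof -
  let ?c = "((1 - \<alpha>) / fact (k - 1)) ^ k"
  let ?b = "edge_coeff (nverts H) k (k + 1) {0..<k} [0]"
  have ys: "{ys. length ys = k + 1 - k \<and> set ys \<subseteq> e} = (\<lambda>i. [i]) ` e" for e :: "nat set"
    by (auto simp: length_Suc_conv)
  have "(\<Sum>ys | length ys = k + 1 - k \<and> set ys \<subseteq> e. edge_coeff (nverts H) k (k + 1) e ys * ?c *
      (\<Prod>y\<leftarrow>ys. \<alpha> * real (vertex_degree H y))) = ?b * ?c * \<alpha> * (\<Sum>i\<in>e. real (vertex_degree H i))"
    if "e \<in> edges H" for e
  proof -
    have "(\<Sum>ys | length ys = k + 1 - k \<and> set ys \<subseteq> e. edge_coeff (nverts H) k (k + 1) e ys * ?c *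
      (\<Prod>y\<leftarrow>ys. \<alpha> * real (vertex_degree H y))) = (\<Sum>i\<in>e. ?b * ?c * \<alpha> * real (vertex_degree H i))"
      unfolding ys using edge_coeff_standard(2)[OF that]
      by (simp add: sum.reindex inj_on_def mult_ac)
    then show ?thesis by (simp only: sum_distrib_left)
  qed
  then have "(\<Sum>e\<in>edges H. \<Sum>ys | length ys = k + 1 - k \<and> set ys \<subseteq> e. edge_coeff (nverts H) k (k + 1) e ys * ?c *
      (\<Prod>y\<leftarrow>ys. \<alpha> * real (vertex_degree H y))) =
      ?b * ?c * \<alpha> * (\<Sum>e\<in>edges H. \<Sum>i\<in>e. real (vertex_degree H i))"
    unfolding sum_distrib_left[of _ _ "edges H"] by (intro sum.cong) auto
  then show ?thesis
    using Tr_A_alpha_low[of "k + 1" \<alpha>] k3 unfolding vertex_part sum_over_edges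
    by (simp add: power2_eq_square)
qed

text \<open>The two diagonal entries give a double sum over a hyperedge. Charging the coefficient of
  distinct vertices to all pairs produces the squared degree sum; the correction for equal vertices,
  summed over all hyperedges, becomes a sum of cubes.\<close>

lemma Tr_Suc_Suc_k:
  "Tr k (nverts H) (k + 2) (A_alpha k \<alpha> H) = real ((k - 1) ^ (nverts H - 1)) *
    (weight (nverts H) k (replicate (k + 2) (replicate k 0)) * \<alpha> ^ (k + 2) * (\<Sum>i<nverts H. real (vertex_degree H i) ^ (k + 2)) +
     ((1 - \<alpha>) / fact (k - 1)) ^ k * \<alpha>\<^sup>2 *
       ((edge_coeff (nverts H) k (k + 2) {0..<k} [0, 0] - edge_coeff (nverts H) k (k + 2) {0..<k} [0, 1]) *
          (\<Sum>i<nverts H. real (vertex_degree H i) ^ 3) +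
        edge_coeff (nverts H) k (k + 2) {0..<k} [0, 1] *
          (\<Sum>e\<in>edges H. (\<Sum>i\<in>e. real (vertex_degree H i))\<^sup>2)))"
proof -
  let ?c = "((1 - \<alpha>) / fact (k - 1)) ^ k"
  let ?b = "edge_coeff (nverts H) k (k + 2) {0..<k} [0, 1]"
  let ?b' = "edge_coeff (nverts H) k (k + 2) {0..<k} [0, 0]"
  let ?\<delta> = "\<lambda>i. real (vertex_degree H i)"
  have ys: "{ys. length ys = k + 2 - k \<and> set ys \<subseteq> e} = (\<lambda>(i, j). [i, j]) ` (e \<times> e)" for e :: "nat set"
    by (auto simp: length_Suc_conv numeral_2_eq_2)
  have inner: "(\<Sum>ys | length ys = k + 2 - k \<and> set ys \<subseteq> e. edge_coeff (nverts H) k (k + 2) e ys * ?c *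
      (\<Prod>y\<leftarrow>ys. \<alpha> * real (vertex_degree H y))) =
      ?c * \<alpha>\<^sup>2 * ((?b' - ?b) * (\<Sum>i\<in>e. ?\<delta> i ^ 2) + ?b * (\<Sum>i\<in>e. ?\<delta> i)\<^sup>2)"
    if e: "e \<in> edges H" for e
  proof -
    have "(\<Sum>ys | length ys = k + 2 - k \<and> set ys \<subseteq> e. edge_coeff (nverts H) k (k + 2) e ys * ?c *
      (\<Prod>y\<leftarrow>ys. \<alpha> * real (vertex_degree H y))) =
      (\<Sum>i\<in>e. \<Sum>j\<in>e. edge_coeff (nverts H) k (k + 2) e [i, j] * ?c * (\<alpha> * ?\<delta> i * (\<alpha> * ?\<delta> j)))"
      unfolding ys sum.cartesian_product
      by (subst sum.reindex) (auto simp: inj_on_def intro!: sum.cong)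
    also have "\<dots> = (\<Sum>i\<in>e. \<Sum>j\<in>e. (if i = j then ?c * \<alpha>\<^sup>2 * (?b' - ?b) * ?\<delta> i ^ 2 else 0) +
        ?c * \<alpha>\<^sup>2 * ?b * (?\<delta> i * ?\<delta> j))"
    proof (intro sum.cong refl)
      fix i j assume ij: "i \<in> e" "j \<in> e"
      show "edge_coeff (nverts H) k (k + 2) e [i, j] * ?c * (\<alpha> * ?\<delta> i * (\<alpha> * ?\<delta> j)) =
        (if i = j then ?c * \<alpha>\<^sup>2 * (?b' - ?b) * ?\<delta> i ^ 2 else 0) + ?c * \<alpha>\<^sup>2 * ?b * (?\<delta> i * ?\<delta> j)"
      proof (cases "i = j")
        case True
        then show ?thesis unfolding True edge_coeff_standard(3)[OF e ij(2)]
          by (simp add: power2_eq_square algebra_simps)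
      next
        case False
        then show ?thesis unfolding edge_coeff_standard(4)[OF e ij False]
          by (simp add: power2_eq_square)
      qed
    qed
    also have "\<dots> = (\<Sum>i\<in>e. ?c * \<alpha>\<^sup>2 * (?b' - ?b) * ?\<delta> i ^ 2) + ?c * \<alpha>\<^sup>2 * ?b * (\<Sum>i\<in>e. \<Sum>j\<in>e. ?\<delta> i * ?\<delta> j)"
      using finite_edge[OF e] by (simp add: sum.distrib sum_distrib_left)
    also have "(\<Sum>i\<in>e. \<Sum>j\<in>e. ?\<delta> i * ?\<delta> j) = (\<Sum>i\<in>e. ?\<delta> i)\<^sup>2"
      by (simp add: power2_eq_square sum_product)
    also have "(\<Sum>i\<in>e. ?c * \<alpha>\<^sup>2 * (?b' - ?b) * ?\<delta> i ^ 2) = ?c * \<alpha>\<^sup>2 * (?b' - ?b) * (\<Sum>i\<in>e. ?\<delta> i ^ 2)"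
      by (simp only: sum_distrib_left)
    finally show ?thesis by (simp only: distrib_left mult.assoc)
  qed
  have "(\<Sum>e\<in>edges H. \<Sum>ys | length ys = k + 2 - k \<and> set ys \<subseteq> e. edge_coeff (nverts H) k (k + 2) e ys * ?c *
      (\<Prod>y\<leftarrow>ys. \<alpha> * real (vertex_degree H y))) =
      (\<Sum>e\<in>edges H. ?c * \<alpha>\<^sup>2 * ((?b' - ?b) * (\<Sum>i\<in>e. ?\<delta> i ^ 2) + ?b * (\<Sum>i\<in>e. ?\<delta> i)\<^sup>2))"
    using inner by (rule sum.cong[OF refl])
  also have "\<dots> = ?c * \<alpha>\<^sup>2 * ((?b' - ?b) * (\<Sum>e\<in>edges H. \<Sum>i\<in>e. ?\<delta> i ^ 2) +
      ?b * (\<Sum>e\<in>edges H. (\<Sum>i\<in>e. ?\<delta> i)\<^sup>2))"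
    by (simp only: sum_distrib_left[symmetric] sum.distrib)
  also have "(\<Sum>e\<in>edges H. \<Sum>i\<in>e. ?\<delta> i ^ 2) = (\<Sum>i<nverts H. ?\<delta> i ^ 3)"
    unfolding sum_over_edges by (simp add: power3_eq_cube power2_eq_square mult.assoc)
  finally have edge_part: "(\<Sum>e\<in>edges H. \<Sum>ys | length ys = k + 2 - k \<and> set ys \<subseteq> e.
      edge_coeff (nverts H) k (k + 2) e ys * ?c * (\<Prod>y\<leftarrow>ys. \<alpha> * real (vertex_degree H y))) =
      ?c * \<alpha>\<^sup>2 * ((?b' - ?b) * (\<Sum>i<nverts H. ?\<delta> i ^ 3) + ?b * (\<Sum>e\<in>edges H. (\<Sum>i\<in>e. ?\<delta> i)\<^sup>2))" .
  have le: "1 \<le> k + 2" "k + 2 \<le> k + 2" "k \<le> k + 2" by auto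
  show ?thesis
    unfolding Tr_A_alpha_low[OF le(1,2)] vertex_part edge_part by simp
qed

end

section \<open>Number of vertices of a unicyclic hypergraph\<close>

text \<open>Adjacency in the bipartite incidence graph, with \<open>Inl\<close> for vertices and
  \<open>Inr\<close> for hyperedges; \<open>J\<close> is its set of edges.\<close>

definition inc_rel :: "(nat \<times> nat set) set \<Rightarrow> (nat + nat set) rel" where
  "inc_rel J = {(x, y). \<exists>v e. (v, e) \<in> J \<and> (x = Inl v \<and> y = Inr e \<or> x = Inr e \<and> y = Inl v)}"

lemma inc_rel_I: "(v, e) \<in> J \<Longrightarrow> (Inl v, Inr e) \<in> inc_rel J" "(v, e) \<in> J \<Longrightarrow> (Inr e, Inl v) \<in> inc_rel J"
  by (auto simp: inc_rel_def)

lemma sym_inc_rel: "sym (inc_rel J)"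
  unfolding sym_def inc_rel_def by blast

lemma inc_rel_rtrancl_sym: "(x, y) \<in> (inc_rel J)\<^sup>* \<Longrightarrow> (y, x) \<in> (inc_rel J)\<^sup>*"
  using sym_rtrancl[OF sym_inc_rel] by (rule symD)

text \<open>The first edge of a shortest path to the root gives a bijection between the other vertices and the
  edges: an edge that is missed would not be needed to reach the root, hence would not be a bridge.\<close>

lemma tree_card:
  assumes fin: "finite V" and r: "r \<in> V"
    and ends: "\<And>v e. (v, e) \<in> J \<Longrightarrow> Inl v \<in> V \<and> Inr e \<in> V"
    and conn: "\<And>x. x \<in> V \<Longrightarrow> (x, r) \<in> (inc_rel J)\<^sup>*"
    and bridge: "\<And>v e. (v, e) \<in> J \<Longrightarrow> (Inl v, Inr e) \<notin> (inc_rel (J - {(v, e)}))\<^sup>*"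
  shows "card V = card J + 1"
proof -
  let ?R = "inc_rel J"
  define dist where "dist x = (LEAST l. (x, r) \<in> ?R ^^ l)" for x
  have dist: "(x, r) \<in> ?R ^^ dist x" if "x \<in> V" for x
    unfolding dist_def using conn[OF that] rtrancl_imp_relpow by (metis LeastI)
  have dist_le: "dist x \<le> l" if "(x, r) \<in> ?R ^^ l" for x l
    unfolding dist_def using that by (rule Least_le)
  \<comment> \<open>\<open>q\<close> joins \<open>x\<close> to a neighbour that is one step nearer
    to the root.\<close>
  define closer where "closer x q \<longleftrightarrow> q \<in> J \<and>
    (x = Inl (fst q) \<and> dist x = Suc (dist (Inr (snd q))) \<or> x = Inr (snd q) \<and> dist x = Suc (dist (Inl (fst q))))" for x q
  have "\<exists>q. closer x q" if x: "x \<in> V - {r}" for x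
  proof -
    have "dist x \<noteq> 0"
    proof
      assume "dist x = 0"
      with dist[of x] x have "(x, r) \<in> ?R ^^ 0" by (metis DiffD1)
      with x show False by simp
    qed
    then obtain l where l: "dist x = Suc l" using not0_implies_Suc by blast
    then obtain y where y: "(x, y) \<in> ?R" "(y, r) \<in> ?R ^^ l" using dist[of x] x relpow_Suc_D2 by (metis DiffD1)
    have "y \<in> V" using y(1) ends by (auto simp: inc_rel_def)
    then have "(x, r) \<in> ?R ^^ Suc (dist y)" using y(1) dist[of y] by (metis relpow_Suc_I2)
    then have "dist x = Suc (dist y)" using dist_le[of x] dist_le[OF y(2)] l by fastforce
    then show ?thesis using y(1) by (auto simp: closer_def inc_rel_def)
  qed
  then obtain p where p: "\<And>x. x \<in> V - {r} \<Longrightarrow> closer x (p x)" by metis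
  \<comment> \<open>An edge chosen from both of its ends would have each end nearer to the root than
    the other.\<close>
  have "inj_on p (V - {r})"
  proof (rule inj_onI)
    fix x y assume "x \<in> V - {r}" "y \<in> V - {r}" "p x = p y"
    with p[of x] p[of y] show "x = y" by (auto simp: closer_def)
  qed
  moreover have "p ` (V - {r}) = J"
  proof (intro equalityI subsetI)
    fix q assume "q \<in> p ` (V - {r})"
    then show "q \<in> J" using p by (auto simp: closer_def)
  next
    fix q assume q: "q \<in> J"
    show "q \<in> p ` (V - {r})"
    proof (rule ccontr)
      assume q_notin: "q \<notin> p ` (V - {r})"
      have reach: "x \<in> V \<Longrightarrow> dist x = l \<Longrightarrow> (x, r) \<in> (inc_rel (J - {q}))\<^sup>*" for x l
      proof (induction l arbitrary: x)
        case 0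
        then have "(x, r) \<in> ?R ^^ 0" using dist[of x] by metis
        then show ?case by simp
      next
        case (Suc l)
        show ?case
        proof (cases "x = r")
          case False
          with Suc.prems have x: "x \<in> V - {r}" by simp
          then have "p x \<noteq> q" using q_notin by blast
          with p[OF x] obtain y where y: "(x, y) \<in> inc_rel (J - {q})" "dist x = Suc (dist y)"
            unfolding closer_def inc_rel_def by (cases "p x") auto
          then have "y \<in> V" using ends by (auto simp: inc_rel_def)
          with Suc y show ?thesis by (metis converse_rtrancl_into_rtrancl nat.inject)
        qed simp
      qed
      obtain v e where ve: "q = (v, e)" by (cases q)
      have "(Inl v, r) \<in> (inc_rel (J - {q}))\<^sup>*" "(r, Inr e) \<in> (inc_rel (J - {q}))\<^sup>*"
        using reach inc_rel_rtrancl_sym ends q ve by blast+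
      then show False using bridge[of v e] q ve by (metis rtrancl_trans)
    qed
  qed
  ultimately have "card J = card (V - {r})" by (metis card_image)
  then show ?thesis using fin r by (metis Suc_eq_plus1 card_Suc_Diff1)
qed

definition incidences :: "hypergraph \<Rightarrow> (nat \<times> nat set) set" where
  "incidences H = {(v, e). e \<in> edges H \<and> v \<in> e}"

lemma cycle_incidences_subset: "cycle_seq H vs es \<Longrightarrow> cycle_incidences vs es \<subseteq> incidences H"
  unfolding cycle_seq_def cycle_incidences_def incidences_def by (auto simp: subset_iff)

text \<open>The detour goes backwards around the cycle: from \<open>vs ! 0\<close> to the last
  hyperedge, then to the last vertex, and so on down to \<open>vs ! 1\<close> and
  \<open>es ! 0\<close>.\<close>

lemma cycle_edge_not_bridge:
  assumes "cycle_seq H vs es"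
  shows "(Inl (vs ! 0), Inr (es ! 0)) \<in> (inc_rel (incidences H - {(vs ! 0, es ! 0)}))\<^sup>*"
proof -
  let ?l = "length vs" and ?q = "(vs ! 0, es ! 0)"
  let ?R = "inc_rel (incidences H - {?q})"
  have l: "?l \<ge> 2" "length es = ?l" "distinct vs" "distinct es" using assms by (auto simp: cycle_seq_def)
  have inc: "(vs ! i, es ! i) \<in> incidences H" "(vs ! (Suc i mod ?l), es ! i) \<in> incidences H" if "i < ?l" for i
    using assms that by (auto simp: cycle_seq_def incidences_def)
  have prev: "(Inr (es ! i), Inl (vs ! i)) \<in> ?R" if "0 < i" "i < ?l" for i
  proof -
    have "es ! i \<noteq> es ! 0" using l that by (subst nth_eq_iff_index_eq) auto
    then show ?thesis using inc(1)[OF that(2)] by (intro inc_rel_I) auto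
  qed
  have reach: "(Inl (vs ! Suc i), Inr (es ! 0)) \<in> ?R\<^sup>*" if "Suc i < ?l" for i
    using that
  proof (induction i)
    case 0
    then have "(vs ! Suc 0, es ! 0) \<in> incidences H" using inc(2)[of 0] by fastforce
    moreover have "vs ! Suc 0 \<noteq> vs ! 0" using l 0 by (subst nth_eq_iff_index_eq) auto
    ultimately show ?case by (intro r_into_rtrancl inc_rel_I) auto
  next
    case (Suc i)
    have "(vs ! Suc (Suc i), es ! Suc i) \<in> incidences H" using inc(2)[of "Suc i"] Suc.prems by simp
    moreover have "es ! Suc i \<noteq> es ! 0" using l Suc.prems by (subst nth_eq_iff_index_eq) auto
    ultimately have "(Inl (vs ! Suc (Suc i)), Inr (es ! Suc i)) \<in> ?R" by (intro inc_rel_I) auto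
    with prev[of "Suc i"] Suc show ?case
      by (meson Suc_lessD converse_rtrancl_into_rtrancl zero_less_Suc)
  qed
  obtain l' where l': "?l = Suc (Suc l')" using l(1) by (metis Suc_le_D numeral_2_eq_2 Suc_le_mono)
  have "(vs ! 0, es ! Suc l') \<in> incidences H" using inc(2)[of "Suc l'"] l' by simp
  moreover have "es ! Suc l' \<noteq> es ! 0" using l l' by (subst nth_eq_iff_index_eq) auto
  ultimately have "(Inl (vs ! 0), Inr (es ! Suc l')) \<in> ?R" by (intro inc_rel_I) auto
  moreover have "(Inr (es ! Suc l'), Inl (vs ! Suc l')) \<in> ?R" using prev l' by simp
  moreover have "(Inl (vs ! Suc l'), Inr (es ! 0)) \<in> ?R\<^sup>*" using reach l' by simp
  ultimately show ?thesis by (meson converse_rtrancl_into_rtrancl)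
qed

text \<open>A path without repetitions from \<open>v\<close> to \<open>e\<close> alternates between
  vertices and hyperedges; the deleted incidence closes it to a cycle.\<close>

lemma cycle_through_non_bridge:
  assumes J: "J \<subseteq> incidences H" and q: "(v, e) \<in> J"
    and conn: "(Inl v, Inr e) \<in> (inc_rel (J - {(v, e)}))\<^sup>*"
  shows "\<exists>vs es. cycle_seq H vs es \<and> cycle_incidences vs es \<subseteq> J"
proof -
  let ?J = "J - {(v, e)}"
  let ?r = "\<lambda>x y. (x, y) \<in> inc_rel ?J"
  have "?r\<^sup>*\<^sup>* (Inl v) (Inr e)" using conn by (simp add: rtrancl_def)
  then obtain xs0 where "rtrancl_path ?r (Inl v) xs0 (Inr e)" unfolding rtranclp_eq_rtrancl_path by blast
  then obtain xs where xs: "rtrancl_path ?r (Inl v) xs (Inr e)" "distinct (Inl v # xs)"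
    by (rule rtrancl_path_distinct)
  define P where "P = Inl v # xs"
  have step: "(P ! i, P ! Suc i) \<in> inc_rel ?J" if "Suc i < length P" for i
    using rtrancl_path_nth[OF xs(1), of i] that by (simp add: P_def)
  have last_P: "P ! (length P - 1) = Inr e" 
  proof -
    have "xs \<noteq> []" using xs(1) by (auto elim: rtrancl_path.cases)
    then have "last P = Inr e" using rtrancl_path_last[OF xs(1)] by (simp add: P_def)
    moreover have "P \<noteq> []" by (simp add: P_def)
    ultimately show ?thesis using last_conv_nth by metis
  qed
  have parity: "i < length P \<Longrightarrow> isl (P ! i) \<longleftrightarrow> even i" for i
  proof (induction i)
    case (Suc i)
    from step[OF Suc.prems] Suc show ?case by (auto simp: inc_rel_def)
  qed (simp add: P_def)
  have "length P > 0" by (simp add: P_def)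
  then have "odd (length P - 1)" using parity[of "length P - 1"] last_P by simp
  then obtain l where l: "length P = 2 * l" "l > 0"
    using \<open>length P > 0\<close> by (metis even_Suc Suc_pred' evenE mult_0_right not_gr_zero)
  define vs where "vs = map (\<lambda>i. projl (P ! (2 * i))) [0..<l]"
  define es where "es = map (\<lambda>i. projr (P ! Suc (2 * i))) [0..<l]"
  have vs: "P ! (2 * i) = Inl (vs ! i)" if "i < l" for i
    using parity[of "2 * i"] that l by (simp add: vs_def)
  have es: "P ! Suc (2 * i) = Inr (es ! i)" if "i < l" for i
    using parity[of "Suc (2 * i)"] that l by (simp add: es_def isl_def sum.expand)
  have len: "length vs = l" "length es = l" by (simp_all add: vs_def es_def)
  have dist_P: "distinct P" using xs(2) by (simp add: P_def)
  have "distinct vs"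
  proof (unfold distinct_conv_nth len, intro allI impI)
    fix i j assume "i < l" "j < l" "i \<noteq> j"
    then have "P ! (2 * i) \<noteq> P ! (2 * j)" using dist_P l by (simp add: nth_eq_iff_index_eq)
    then show "vs ! i \<noteq> vs ! j" using vs \<open>i < l\<close> \<open>j < l\<close> by auto
  qed
  have "distinct es"
  proof (unfold distinct_conv_nth len, intro allI impI)
    fix i j assume "i < l" "j < l" "i \<noteq> j"
    then have "P ! Suc (2 * i) \<noteq> P ! Suc (2 * j)" using dist_P l by (simp add: nth_eq_iff_index_eq)
    then show "es ! i \<noteq> es ! j" using es \<open>i < l\<close> \<open>j < l\<close> by auto
  qed
  have inc: "(vs ! i, es ! i) \<in> ?J" if "i < l" for i
    using step[of "2 * i"] vs[OF that] es[OF that] that l by (auto simp: inc_rel_def)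
  have inc': "(vs ! Suc i, es ! i) \<in> ?J" if "Suc i < l" for i
    using step[of "Suc (2 * i)"] vs[OF that] es[of i] that l by (auto simp: inc_rel_def)
  have "vs ! 0 = v" using vs[of 0] l by (simp add: P_def)
  moreover have "es ! (l - 1) = e"
    using es[of "l - 1"] l last_P by (cases l) auto
  ultimately have wrap: "(vs ! 0, es ! (l - 1)) = (v, e)" by simp
  \<comment> \<open>A path of a single step would be the deleted incidence itself; a cycle needs at
    least two vertices.\<close>
  have "l \<noteq> 1" using inc[of 0] wrap by auto
  then have l2: "l \<ge> 2" using l by simp
  have inc_mod: "(vs ! (Suc i mod l), es ! i) \<in> J" if "i < l" for i
  proof (cases "Suc i = l")
    case True
    then show ?thesis using wrap q by auto
  next
    case False
    then show ?thesis using inc'[of i] that by simp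
  qed
  have "set es \<subseteq> edges H"
  proof
    fix f assume "f \<in> set es"
    then obtain i where "i < l" "f = es ! i" using len by (auto simp: in_set_conv_nth)
    then show "f \<in> edges H" using inc J by (auto simp: incidences_def)
  qed
  then have "cycle_seq H vs es"
    unfolding cycle_seq_def len using l2 \<open>distinct vs\<close> \<open>distinct es\<close> inc inc_mod J by (auto simp: incidences_def)
  moreover have "cycle_incidences vs es \<subseteq> J"
    unfolding cycle_incidences_def len using inc inc_mod by auto
  ultimately show ?thesis by blast
qed

lemma connected_incidences:
  assumes "connected_hypergraph H" "is_hypergraph H"
    and "x \<in> Inl ` verts H \<union> Inr ` edges H" "y \<in> Inl ` verts H \<union> Inr ` edges H"
  shows "(x, y) \<in> (inc_rel (incidences H))\<^sup>*"
proof -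
  let ?R = "inc_rel (incidences H)"
  have "(Inl u, Inl w) \<in> ?R\<^sup>*" if "(u, w) \<in> (adjacent H)\<^sup>*" for u w
    using that
  proof (induction rule: rtrancl_induct)
    case (step w w')
    then obtain e where "e \<in> edges H" "w \<in> e" "w' \<in> e" by (auto simp: adjacent_def)
    then have "(Inl w, Inr e) \<in> ?R" "(Inr e, Inl w') \<in> ?R" by (auto intro!: inc_rel_I simp: incidences_def)
    with step.IH show ?case by (meson rtrancl.rtrancl_into_rtrancl)
  qed simp
  then have verts: "(Inl u, Inl w) \<in> ?R\<^sup>*" if "u \<in> verts H" "w \<in> verts H" for u w
    using assms(1) that by (auto simp: connected_hypergraph_def)
  have "\<exists>u\<in>verts H. (z, Inl u) \<in> ?R\<^sup>*" if "z \<in> Inl ` verts H \<union> Inr ` edges H" for z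
    using that
  proof (elim UnE imageE)
    fix e assume e: "e \<in> edges H" "z = Inr e"
    then obtain u where u: "u \<in> e" "u \<in> verts H" using assms(2) by (fastforce simp: is_hypergraph_def)
    then have "(Inr e, Inl u) \<in> ?R" using e by (intro inc_rel_I) (simp add: incidences_def)
    with e u show ?thesis by blast
  qed auto
  then obtain u w where "u \<in> verts H" "w \<in> verts H" "(x, Inl u) \<in> ?R\<^sup>*" "(y, Inl w) \<in> ?R\<^sup>*"
    using assms(3,4) by meson
  then show ?thesis using verts inc_rel_rtrancl_sym by (meson rtrancl_trans)
qed

text \<open>Deleting one incidence of the cycle turns the incidence graph into a tree.\<close>

lemma unicyclic_nverts:
  assumes hyp: "is_hypergraph H" and unif: "uniform k H" and uni: "unicyclic H"
  shows "nverts H + card (edges H) = k * card (edges H)"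
proof -
  obtain C where C: "C \<in> cycles H" "\<And>C'. C' \<in> cycles H \<Longrightarrow> C' = C"
    using uni unfolding unicyclic_def by blast
  then obtain vs es where cyc: "cycle_seq H vs es" and C_eq: "C = cycle_incidences vs es"
    unfolding cycles_def by blast
  let ?q = "(vs ! 0, es ! 0)"
  let ?V = "Inl ` verts H \<union> Inr ` edges H"
  let ?J = "incidences H - {?q}"
  have len: "length vs \<ge> 2" using cyc by (simp add: cycle_seq_def)
  then have qC: "?q \<in> cycle_incidences vs es" by (force simp: cycle_incidences_def)
  then have q: "?q \<in> incidences H" using cycle_incidences_subset[OF cyc] by blast
  have fin_E: "finite (edges H)"
    by (rule finite_subset[of _ "Pow (verts H)"]) (use hyp in \<open>auto simp: is_hypergraph_def verts_def\<close>)
  have fin_e: "finite e" if "e \<in> edges H" for e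
    using hyp that by (intro finite_subset[of e "verts H"]) (auto simp: is_hypergraph_def verts_def)
  have "(x, y) \<in> (inc_rel ?J)\<^sup>*" if xy: "(x, y) \<in> inc_rel (incidences H)" for x y
  proof -
    obtain v e where ve: "(v, e) \<in> incidences H" "x = Inl v \<and> y = Inr e \<or> x = Inr e \<and> y = Inl v"
      using xy unfolding inc_rel_def by blast
    have "(Inl v, Inr e) \<in> (inc_rel ?J)\<^sup>*"
    proof (cases "(v, e) = ?q")
      case True
      then show ?thesis using cycle_edge_not_bridge[OF cyc] by simp
    next
      case False
      then show ?thesis using ve by (intro r_into_rtrancl inc_rel_I) auto
    qed
    then show ?thesis using ve inc_rel_rtrancl_sym by blast
  qed
  then have "inc_rel (incidences H) \<subseteq> (inc_rel ?J)\<^sup>*" by auto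
  then have sub: "(inc_rel (incidences H))\<^sup>* \<subseteq> (inc_rel ?J)\<^sup>*" by (metis rtrancl_subset_rtrancl)
  obtain r where r: "r \<in> verts H" using uni by (auto simp: unicyclic_def connected_hypergraph_def)
  have "card ?V = card ?J + 1"
  proof (rule tree_card)
    show "finite ?V" using fin_E by (simp add: verts_def)
    show "Inl r \<in> ?V" using r by simp
    show "Inl v \<in> ?V \<and> Inr e \<in> ?V" if "(v, e) \<in> ?J" for v e
      using that hyp by (auto simp: incidences_def is_hypergraph_def)
    show "(x, Inl r) \<in> (inc_rel ?J)\<^sup>*" if "x \<in> ?V" for x
      using connected_incidences[OF _ hyp that, of "Inl r"] r uni sub by (auto simp: unicyclic_def)
    \<comment> \<open>An incidence that is not a bridge yields a cycle avoiding \<open>?q\<close>,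
      whereas the only cycle contains \<open>?q\<close>.\<close>
    show "(Inl v, Inr e) \<notin> (inc_rel (?J - {(v, e)}))\<^sup>*" if ve: "(v, e) \<in> ?J" for v e
    proof
      assume "(Inl v, Inr e) \<in> (inc_rel (?J - {(v, e)}))\<^sup>*"
      from cycle_through_non_bridge[OF Diff_subset ve this]
      obtain vs' es' where "cycle_seq H vs' es'" "cycle_incidences vs' es' \<subseteq> ?J" by blast
      moreover have "cycle_incidences vs' es' = cycle_incidences vs es"
        using C(2) \<open>cycle_seq H vs' es'\<close> C_eq unfolding cycles_def by blast
      ultimately show False using qC by blast
    qed
  qed
  moreover have "card ?V = nverts H + card (edges H)"
    using fin_E by (subst card_Un_disjoint) (auto simp: verts_def card_image)
  moreover have "card (incidences H) = k * card (edges H)"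
  proof -
    have "incidences H = prod.swap ` (SIGMA e:edges H. e)"
      by (auto simp: incidences_def image_iff)
    then have "card (incidences H) = (\<Sum>e\<in>edges H. card e)"
      using fin_E fin_e by (simp add: card_image)
    then show ?thesis using unif by (simp add: uniform_def)
  qed
  moreover have "finite (incidences H)"
    by (rule finite_subset[of _ "verts H \<times> edges H"]) (use hyp fin_E in \<open>auto simp: incidences_def is_hypergraph_def verts_def\<close>)
  then have "card (incidences H) = card ?J + 1" using q by (metis Suc_eq_plus1 card_Suc_Diff1)
  ultimately show ?thesis by linarith
qed

section \<open>The hypercycle\<close>

lemma Suc_mod_inj: "i < m \<Longrightarrow> j < m \<Longrightarrow> Suc i mod m = Suc j mod m \<Longrightarrow> i = j"
  by (auto simp: mod_Suc split: if_splits)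

lemma Suc_mod_neq: "i < m \<Longrightarrow> m \<ge> 2 \<Longrightarrow> Suc i mod m \<noteq> i"
  by (auto simp: mod_Suc)

lemma Suc_mod_surj: "i < m \<Longrightarrow> \<exists>j<m. Suc j mod m = i"
proof (cases i)
  case 0
  then show "i < m \<Longrightarrow> ?thesis" by (intro exI[of _ "m - 1"]) auto
next
  case (Suc j)
  then show "i < m \<Longrightarrow> ?thesis" by (intro exI[of _ j]) auto
qed

definition cycle_edge :: "nat \<Rightarrow> nat \<Rightarrow> nat \<Rightarrow> nat set" where
  "cycle_edge k m j = {j, Suc j mod m} \<union> {m + j * (k - 2)..<m + Suc j * (k - 2)}"

lemma edges_hypercycle: "edges (hypercycle k m) = cycle_edge k m ` {0..<m}"
  and nverts_hypercycle: "nverts (hypercycle k m) = m + m * (k - 2)"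
  by (simp_all add: hypercycle_def cycle_edge_def)

text \<open>Seen as a subgraph of the incidence graph, a cycle has no endpoint: one can always
  continue from a vertex and from a hyperedge.\<close>

lemma cycle_seq_neighbours:
  assumes "cycle_seq H vs es" "(v, e) \<in> cycle_incidences vs es"
  shows "\<exists>w. w \<noteq> v \<and> (w, e) \<in> cycle_incidences vs es"
    and "\<exists>f. f \<noteq> e \<and> (v, f) \<in> cycle_incidences vs es"
    and "e \<in> edges H" "v \<in> e"
proof -
  let ?l = "length vs" and ?C = "cycle_incidences vs es"
  have l: "?l \<ge> 2" "length es = ?l" "distinct vs" "distinct es" using assms(1) by (auto simp: cycle_seq_def)
  obtain i where i: "i < ?l" "e = es ! i" "v = vs ! i \<or> v = vs ! (Suc i mod ?l)"
    using assms(2) by (auto simp: cycle_incidences_def)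
  have C: "(vs ! j, es ! j) \<in> ?C" "(vs ! (Suc j mod ?l), es ! j) \<in> ?C" if "j < ?l" for j
    using that by (auto simp: cycle_incidences_def)
  have lt: "Suc i mod ?l < ?l" using i(1) by (intro mod_less_divisor) linarith
  have ne: "Suc i mod ?l \<noteq> i" by (rule Suc_mod_neq[OF i(1) l(1)])
  have vs_ne: "vs ! (Suc i mod ?l) \<noteq> vs ! i" using ne lt i(1) l(3) by (simp add: nth_eq_iff_index_eq)
  show "\<exists>w. w \<noteq> v \<and> (w, e) \<in> ?C" using C[OF i(1)] vs_ne i by metis
  show "\<exists>f. f \<noteq> e \<and> (v, f) \<in> ?C"
    using i(3)
  proof
    assume v: "v = vs ! i"
    obtain j where j: "j < ?l" "Suc j mod ?l = i" using Suc_mod_surj[OF i(1)] by blast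
    then have "j \<noteq> i" using Suc_mod_neq[OF j(1) l(1)] by auto
    then have "es ! j \<noteq> e" using i j l by (simp add: nth_eq_iff_index_eq)
    then show ?thesis using C(2)[OF j(1)] j(2) v by metis
  next
    assume v: "v = vs ! (Suc i mod ?l)"
    have "es ! (Suc i mod ?l) \<noteq> e" using i lt ne l by (simp add: nth_eq_iff_index_eq)
    then show ?thesis using C(1)[OF lt] v by metis
  qed
  show "e \<in> edges H" "v \<in> e" using assms(1) i l by (auto simp: cycle_seq_def)
qed

context
  fixes k m :: nat
  assumes k: "k \<ge> 3" and m: "m \<ge> 3"
begin

lemma mem_cycle_edge_core: "j < m \<Longrightarrow> v < m \<Longrightarrow> v \<in> cycle_edge k m j \<longleftrightarrow> v = j \<or> v = Suc j mod m"
  by (auto simp: cycle_edge_def)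

text \<open>The new vertices form consecutive blocks of length \<open>k - 2\<close>, so division
  recovers the hyperedge.\<close>

lemma mem_cycle_edge_private:
  assumes "j < m" "v \<ge> m"
  shows "v \<in> cycle_edge k m j \<longleftrightarrow> (v - m) div (k - 2) = j"
proof -
  have "Suc j mod m < m" using m by (intro mod_less_divisor) simp
  then have "v \<noteq> j" "v \<noteq> Suc j mod m" using assms by linarith+
  then have "v \<in> cycle_edge k m j \<longleftrightarrow> j * (k - 2) \<le> v - m \<and> v - m < Suc j * (k - 2)"
    using assms by (auto simp: cycle_edge_def)
  also have "\<dots> \<longleftrightarrow> (v - m) div (k - 2) = j"
  proof -
    have "k - 2 > 0" using k by simp
    then show ?thesis using div_nat_eqI[of "k - 2" j "v - m"] dividend_less_times_div[of "k - 2" "v - m"]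
        div_times_less_eq_dividend[of "v - m" "k - 2"] by (auto simp: mult.commute)
  qed
  finally show ?thesis .
qed

lemma cycle_edge_inj: "inj_on (cycle_edge k m) {0..<m}"
proof (rule inj_onI)
  fix i j assume ij: "i \<in> {0..<m}" "j \<in> {0..<m}" "cycle_edge k m i = cycle_edge k m j"
  have "m + i * (k - 2) < m + Suc i * (k - 2)" using k by simp
  then have "m + i * (k - 2) \<in> cycle_edge k m i" by (auto simp: cycle_edge_def simp del: mult_Suc)
  then have "m + i * (k - 2) \<in> cycle_edge k m j" using ij by simp
  then show "i = j" using mem_cycle_edge_private[of j "m + i * (k - 2)"] ij k by simp
qed

lemma card_cycle_edge: "j < m \<Longrightarrow> card (cycle_edge k m j) = k"
proof -
  assume j: "j < m"
  have "\<forall>v\<in>{j, Suc j mod m}. v < m" using j m by simp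
  then have "{j, Suc j mod m} \<inter> {m + j * (k - 2)..<m + Suc j * (k - 2)} = {}" by fastforce
  then have "card (cycle_edge k m j) = card {j, Suc j mod m} + card {m + j * (k - 2)..<m + Suc j * (k - 2)}"
    unfolding cycle_edge_def by (intro card_Un_disjoint) auto
  then show ?thesis using Suc_mod_neq[OF j] m k by simp
qed

lemma cycle_edge_subset: "j < m \<Longrightarrow> cycle_edge k m j \<subseteq> {0..<m + m * (k - 2)}"
proof
  fix v assume j: "j < m" and v: "v \<in> cycle_edge k m j"
  have "\<forall>v\<in>{j, Suc j mod m}. v < m" using j m by simp
  moreover have "Suc j * (k - 2) \<le> m * (k - 2)" using j by (intro mult_le_mono1) simp
  moreover have "v \<in> {j, Suc j mod m} \<or> v < m + Suc j * (k - 2)" using v by (auto simp: cycle_edge_def)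
  ultimately have "v < m + m * (k - 2)" by fastforce
  then show "v \<in> {0..<m + m * (k - 2)}" by simp
qed

lemma private_index: "m \<le> v \<Longrightarrow> v < m + m * (k - 2) \<Longrightarrow> (v - m) div (k - 2) < m"
  using k by (intro less_mult_imp_div_less) (simp add: less_diff_conv2 add.commute)

lemma Union_cycle_edge: "(\<Union>j<m. cycle_edge k m j) = {0..<m + m * (k - 2)}"
proof (intro equalityI subsetI)
  fix v assume v: "v \<in> {0..<m + m * (k - 2)}"
  show "v \<in> (\<Union>j<m. cycle_edge k m j)"
  proof (cases "v < m")
    case True
    then show ?thesis using mem_cycle_edge_core[of v v] by blast
  next
    case False
    then show ?thesis
      using v private_index[of v] mem_cycle_edge_private[of "(v - m) div (k - 2)" v] by auto
  qed
next
  fix v assume "v \<in> (\<Union>j<m. cycle_edge k m j)"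
  then show "v \<in> {0..<m + m * (k - 2)}" using cycle_edge_subset by blast
qed

lemma hypercycle_wf:
  "is_hypergraph (hypercycle k m)" "uniform k (hypercycle k m)"
  "linear_hypergraph (hypercycle k m)" "card (edges (hypercycle k m)) = m"
proof -
  show "is_hypergraph (hypercycle k m)"
    unfolding is_hypergraph_def edges_hypercycle verts_def nverts_hypercycle
    using cycle_edge_subset by (auto simp: cycle_edge_def)
  show "uniform k (hypercycle k m)"
    unfolding uniform_def edges_hypercycle using card_cycle_edge by auto
  show "card (edges (hypercycle k m)) = m"
    unfolding edges_hypercycle by (simp add: card_image cycle_edge_inj)
  show "linear_hypergraph (hypercycle k m)"
    unfolding linear_hypergraph_def edges_hypercycle
  proof (intro ballI impI, elim imageE, hypsubst)
    fix i j assume ij: "i \<in> {0..<m}" "j \<in> {0..<m}" "cycle_edge k m i \<noteq> cycle_edge k m j"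
    then have ne: "i \<noteq> j" by auto
    \<comment> \<open>Two common vertices would make \<open>i\<close> and \<open>j\<close> cyclic
      successors of each other, which is impossible for \<open>m\<close> at least
      \<open>3\<close>.\<close>
    have core: "v = w" if v: "v \<in> cycle_edge k m i \<inter> cycle_edge k m j" and w: "w \<in> cycle_edge k m i \<inter> cycle_edge k m j" for v w
    proof (rule ccontr)
      assume "v \<noteq> w"
      have "v < m" "w < m" using v w ij ne mem_cycle_edge_private by (metis IntE atLeastLessThan_iff not_less)+
      then have "v \<in> {i, Suc i mod m} \<inter> {j, Suc j mod m}" "w \<in> {i, Suc i mod m} \<inter> {j, Suc j mod m}"
        using v w ij mem_cycle_edge_core by auto
      then have "i = Suc j mod m \<and> j = Suc i mod m"
        using \<open>v \<noteq> w\<close> ne Suc_mod_inj[of i m j] ij by auto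
      moreover have "Suc j mod m = (if Suc j = m then 0 else Suc j)" "Suc i mod m = (if Suc i = m then 0 else Suc i)"
        using ij by (simp_all add: mod_Suc)
      ultimately have "i = (if Suc j = m then 0 else Suc j)" "j = (if Suc i = m then 0 else Suc i)"
        by metis+
      then have "Suc j = m \<and> i = 0 \<or> i = Suc j" "Suc i = m \<and> j = 0 \<or> j = Suc i" by metis+
      then show False using m by (elim disjE conjE) linarith+
    qed
    show "card (cycle_edge k m i \<inter> cycle_edge k m j) \<le> 1"
    proof (cases "cycle_edge k m i \<inter> cycle_edge k m j = {}")
      case False
      then obtain v where "v \<in> cycle_edge k m i \<inter> cycle_edge k m j" by blast
      then have "cycle_edge k m i \<inter> cycle_edge k m j = {v}" using core by blast
      then show ?thesis by simp
    qed simp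
  qed
qed

lemma degree_hypercycle:
  assumes "v < m + m * (k - 2)"
  shows "vertex_degree (hypercycle k m) v = (if v < m then 2 else 1)"
proof -
  have "vertex_degree (hypercycle k m) v = card {j \<in> {0..<m}. v \<in> cycle_edge k m j}"
  proof -
    have "{e \<in> edges (hypercycle k m). v \<in> e} = cycle_edge k m ` {j \<in> {0..<m}. v \<in> cycle_edge k m j}"
      unfolding edges_hypercycle by auto
    moreover have "inj_on (cycle_edge k m) {j \<in> {0..<m}. v \<in> cycle_edge k m j}"
      by (rule inj_on_subset[OF cycle_edge_inj]) auto
    ultimately show ?thesis unfolding vertex_degree_def by (simp only: card_image)
  qed
  also have "\<dots> = (if v < m then 2 else 1)"
  proof (cases "v < m")
    case True
    obtain j where j: "j < m" "Suc j mod m = v" using Suc_mod_surj[OF True] by blast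
    have "{j \<in> {0..<m}. v \<in> cycle_edge k m j} = {v, j}"
    proof (intro equalityI subsetI)
      fix i assume "i \<in> {j \<in> {0..<m}. v \<in> cycle_edge k m j}"
      then have i: "i < m" "v = i \<or> v = Suc i mod m" using mem_cycle_edge_core[OF _ True] by auto
      then show "i \<in> {v, j}" using j Suc_mod_inj[OF i(1) j(1)] by auto
    qed (use True j mem_cycle_edge_core[OF _ True] in auto)
    moreover have "v \<noteq> j" using Suc_mod_neq[OF j(1)] j(2) m by auto
    ultimately show ?thesis using True by simp
  next
    case False
    then have "{j \<in> {0..<m}. v \<in> cycle_edge k m j} = {(v - m) div (k - 2)}"
      using mem_cycle_edge_private[of _ v] private_index[of v] assms by auto
    then show ?thesis using False by simp
  qed
  finally show ?thesis .
qed

lemma degree_sum_cycle_edge: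
  assumes "j < m"
  shows "(\<Sum>v\<in>cycle_edge k m j. real (vertex_degree (hypercycle k m) v)) = real (k + 2)"
proof -
  have "(\<Sum>v\<in>cycle_edge k m j. vertex_degree (hypercycle k m) v) =
      (\<Sum>v\<in>cycle_edge k m j. if v < m then 2 else 1)"
    using cycle_edge_subset[OF assms] by (intro sum.cong refl degree_hypercycle) auto
  also have "\<dots> = (\<Sum>v\<in>cycle_edge k m j. 1 + (if v < m then 1 else 0))"
    by (intro sum.cong) auto
  also have "\<dots> = k + card {v \<in> cycle_edge k m j. v < m}"
  proof -
    have "finite (cycle_edge k m j)" by (simp add: cycle_edge_def)
    then show ?thesis unfolding sum.distrib using card_cycle_edge[OF assms] by (simp add: sum.If_cases Int_def)
  qed
  also have "{v \<in> cycle_edge k m j. v < m} = {j, Suc j mod m}"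
    using mem_cycle_edge_core[OF assms] assms m by auto
  also have "card {j, Suc j mod m} = 2" using Suc_mod_neq[OF assms] m by auto
  finally show ?thesis by (metis of_nat_sum)
qed

lemma hypercycle_connected: "connected_hypergraph (hypercycle k m)"
proof -
  let ?A = "adjacent (hypercycle k m)"
  have adj: "(u, v) \<in> ?A" if "j < m" "u \<in> cycle_edge k m j" "v \<in> cycle_edge k m j" for u v j
    using that by (auto simp: adjacent_def edges_hypercycle)
  have core: "j < m \<Longrightarrow> (0, j) \<in> ?A\<^sup>*" for j
  proof (induction j)
    case (Suc j)
    have "(j, Suc j) \<in> ?A"
      by (rule adj[of j]) (use Suc.prems in \<open>auto simp: cycle_edge_def\<close>)
    with Suc show ?case by (meson Suc_lessD rtrancl.rtrancl_into_rtrancl)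
  qed simp
  have from0: "(0, v) \<in> ?A\<^sup>*" if v: "v \<in> verts (hypercycle k m)" for v
  proof -
    have "v \<in> (\<Union>j<m. cycle_edge k m j)"
      using v unfolding Union_cycle_edge verts_def nverts_hypercycle .
    then obtain j where j: "j < m" "v \<in> cycle_edge k m j" by blast
    then have "(j, v) \<in> ?A" by (intro adj[of j]) (auto simp: cycle_edge_def)
    with core[OF j(1)] show ?thesis by (rule rtrancl_into_rtrancl)
  qed
  have "sym ?A" by (auto simp: sym_def adjacent_def)
  then have "sym (?A\<^sup>*)" by (rule sym_rtrancl)
  then have "(u, v) \<in> ?A\<^sup>*" if "u \<in> verts (hypercycle k m)" "v \<in> verts (hypercycle k m)" for u v
    using from0[OF that(1)] from0[OF that(2)] by (meson rtrancl_trans symD)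
  moreover have "verts (hypercycle k m) \<noteq> {}" using m by (simp add: verts_def nverts_hypercycle)
  ultimately show ?thesis by (simp add: connected_hypergraph_def)
qed

text \<open>Vertices of a cycle lie in two hyperedges, so they are below \<open>m\<close>. A
  hyperedge of the cycle uses both of its vertices of this kind, and the second one leads to the
  next hyperedge; hence the cycle goes all the way round.\<close>

lemma hypercycle_cycle_incidences:
  assumes cyc: "cycle_seq (hypercycle k m) vs es"
  shows "cycle_incidences vs es = (\<Union>j<m. {(j, cycle_edge k m j), (Suc j mod m, cycle_edge k m j)})"
proof -
  let ?C = "cycle_incidences vs es" and ?E = "cycle_edge k m"
  note nb = cycle_seq_neighbours[OF cyc]
  have mem: "\<exists>j<m. e = ?E j \<and> (v = j \<or> v = Suc j mod m)" if ve: "(v, e) \<in> ?C" for v e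
  proof -
    obtain f where f: "f \<noteq> e" "(v, f) \<in> ?C" using nb(2)[OF ve] by blast
    obtain i j where ij: "i < m" "j < m" "e = ?E i" "f = ?E j"
      using nb(3)[OF ve] nb(3)[OF f(2)] by (auto simp: edges_hypercycle)
    then have "i \<noteq> j" "v \<in> ?E i" "v \<in> ?E j" using nb(4)[OF ve] nb(4)[OF f(2)] f(1) by auto
    then have "v < m" using mem_cycle_edge_private ij by (metis not_less)
    then show ?thesis using ij \<open>v \<in> ?E i\<close> mem_cycle_edge_core by auto
  qed
  have E_eq: "i = j" if "?E i = ?E j" "i < m" "j < m" for i j
    by (rule inj_onD[OF cycle_edge_inj that(1)]) (use that in auto)
  have both: "(j, ?E j) \<in> ?C \<and> (Suc j mod m, ?E j) \<in> ?C" if j: "j < m" "(v, ?E j) \<in> ?C" for v j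
  proof -
    obtain w where w: "w \<noteq> v" "(w, ?E j) \<in> ?C" using nb(1)[OF j(2)] by blast
    have "v = j \<or> v = Suc j mod m" using mem[OF j(2)] E_eq j(1) by blast
    moreover have "w = j \<or> w = Suc j mod m" using mem[OF w(2)] E_eq j(1) by blast
    ultimately show ?thesis using w j by auto
  qed
  have succ: "(Suc j mod m, ?E (Suc j mod m)) \<in> ?C" if j: "j < m" "(j, ?E j) \<in> ?C" for j
  proof -
    have "(Suc j mod m, ?E j) \<in> ?C" using both j by blast
    from nb(2)[OF this] obtain f where f: "f \<noteq> ?E j" "(Suc j mod m, f) \<in> ?C" by blast
    obtain i where i: "i < m" "f = ?E i" "Suc j mod m = i \<or> Suc j mod m = Suc i mod m"
      using mem[OF f(2)] by blast
    have "i \<noteq> j" using i f(1) by auto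
    then have "Suc j mod m = i" using i Suc_mod_inj[OF j(1) i(1)] by auto
    then show ?thesis using f(2) i(2) by simp
  qed
  have "length vs \<ge> 2" using cyc by (simp add: cycle_seq_def)
  then have "(vs ! 0, es ! 0) \<in> ?C" by (force simp: cycle_incidences_def)
  then obtain j0 where j0: "j0 < m" "(j0, ?E j0) \<in> ?C" using mem both by metis
  have all: "((j0 + t) mod m, ?E ((j0 + t) mod m)) \<in> ?C" for t
  proof (induction t)
    case (Suc t)
    have "(j0 + t) mod m < m" using m by simp
    from succ[OF this Suc] show ?case by (simp add: mod_Suc_eq)
  qed (use j0 in simp)
  have all': "(j, ?E j) \<in> ?C" if "j < m" for j
  proof -
    have "(j0 + (m + j - j0)) mod m = j" using that j0 by simp
    with all[of "m + j - j0"] show ?thesis by simp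
  qed
  show ?thesis
  proof (intro equalityI subsetI)
    fix p assume "p \<in> ?C"
    moreover obtain v e where p: "p = (v, e)" by (cases p)
    ultimately obtain j where "j < m" "e = ?E j" "v = j \<or> v = Suc j mod m" using mem by blast
    then show "p \<in> (\<Union>j<m. {(j, ?E j), (Suc j mod m, ?E j)})" using p by blast
  next
    fix p assume "p \<in> (\<Union>j<m. {(j, ?E j), (Suc j mod m, ?E j)})"
    then obtain j where "j < m" "p = (j, ?E j) \<or> p = (Suc j mod m, ?E j)" by blast
    then show "p \<in> ?C" using both all' by blast
  qed
qed

lemma hypercycle_unicyclic: "unicyclic (hypercycle k m)"
proof -
  have "cycle_seq (hypercycle k m) [0..<m] (map (cycle_edge k m) [0..<m])"
    unfolding cycle_seq_def using m cycle_edge_inj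
    by (auto simp: distinct_map edges_hypercycle cycle_edge_def atLeast0LessThan)
  then have "\<exists>C. C \<in> cycles (hypercycle k m)" unfolding cycles_def by blast
  moreover have "C = D" if CD: "C \<in> cycles (hypercycle k m)" "D \<in> cycles (hypercycle k m)" for C D
  proof -
    obtain vs es where C: "C = cycle_incidences vs es" "cycle_seq (hypercycle k m) vs es"
      using CD(1) unfolding cycles_def by blast
    obtain vs' es' where D: "D = cycle_incidences vs' es'" "cycle_seq (hypercycle k m) vs' es'"
      using CD(2) unfolding cycles_def by blast
    show ?thesis unfolding C(1) D(1) hypercycle_cycle_incidences[OF C(2)] hypercycle_cycle_incidences[OF D(2)] ..
  qed
  ultimately show ?thesis using hypercycle_connected unfolding unicyclic_def by blast
qed

lemma hypercycle_in_class: "hypercycle k m \<in> linear_unicyclic_hypergraphs k m"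
  using hypercycle_wf hypercycle_unicyclic by (simp add: linear_unicyclic_hypergraphs_def)

end

text \<open>A hyperedge of the cycle has its two vertices of degree \<open>2\<close> on the cycle,
  so no other hyperedge can be attached to it. By connectedness the cycle contains all hyperedges,
  and only a relabelling remains.\<close>

lemma isomorphic_hypercycle:
  assumes hyp: "is_hypergraph H" and unif: "uniform k H" and conn: "connected_hypergraph H"
    and cyc: "cycle_seq H vs es" and nv: "nverts H = m + m * (k - 2)" and cardE: "card (edges H) = m"
    and k: "k \<ge> 3" and m: "m \<ge> 3"
    and two: "\<And>v. v \<in> verts H \<Longrightarrow> vertex_degree H v \<le> 2"
    and pair: "\<And>e. e \<in> edges H \<Longrightarrow> card {v \<in> e. vertex_degree H v = 2} = 2"
  shows "isomorphic H (hypercycle k m)"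
proof -
  let ?l = "length vs" and ?d = "vertex_degree H"
  have l: "?l \<ge> 2" "length es = ?l" "distinct vs" "distinct es" and es_sub: "set es \<subseteq> edges H"
    using cyc by (auto simp: cycle_seq_def)
  have inc: "vs ! i \<in> es ! i" "vs ! (Suc i mod ?l) \<in> es ! i" if "i < ?l" for i
    using cyc that by (auto simp: cycle_seq_def)
  have sub_verts: "e \<subseteq> verts H" if "e \<in> edges H" for e using hyp that by (auto simp: is_hypergraph_def)
  have fin_verts: "finite (verts H)" by (simp add: verts_def)
  have finE: "finite (edges H)" using cardE m by (metis card.infinite not_numeral_le_zero)
  have es_edge: "es ! i \<in> edges H" if "i < ?l" for i using es_sub l that by auto
  have lt: "Suc i mod ?l < ?l" for i using l(1) by (intro mod_less_divisor) linarith
  have star: "{e \<in> edges H. v \<in> e} = {e, f} \<and> ?d v = 2"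
    if "e \<in> edges H" "f \<in> edges H" "e \<noteq> f" "v \<in> e" "v \<in> f" for e f v
  proof -
    have sub: "{e, f} \<subseteq> {e \<in> edges H. v \<in> e}" using that by auto
    have "?d v \<le> 2" using two sub_verts that by blast
    then have "card {e \<in> edges H. v \<in> e} \<le> card {e, f}" using that(3) by (simp add: vertex_degree_def)
    then have "{e, f} = {e \<in> edges H. v \<in> e}" using sub finE by (intro card_seteq) auto
    then show ?thesis using that(3) by (simp add: vertex_degree_def flip: \<open>{e, f} = _\<close>)
  qed
  have star_vs: "{e \<in> edges H. vs ! (Suc i mod ?l) \<in> e} = {es ! i, es ! (Suc i mod ?l)} \<and> ?d (vs ! (Suc i mod ?l)) = 2"
    if i: "i < ?l" for i
  proof (rule star)
    show "es ! i \<noteq> es ! (Suc i mod ?l)"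
      using lt[of i] i l Suc_mod_neq[OF i l(1)] by (simp add: nth_eq_iff_index_eq)
  qed (use inc es_edge i lt in auto)
  have vs_two: "?d (vs ! i) = 2" "{e \<in> edges H. vs ! i \<in> e} \<subseteq> set es" if "i < ?l" for i
  proof -
    obtain j where j: "j < ?l" "Suc j mod ?l = i" using Suc_mod_surj[OF \<open>i < ?l\<close>] by blast
    from star_vs[OF j(1)] show "?d (vs ! i) = 2" "{e \<in> edges H. vs ! i \<in> e} \<subseteq> set es"
      using j that l by auto
  qed
  have two_es: "{v \<in> es ! i. ?d v = 2} = {vs ! i, vs ! (Suc i mod ?l)}" if i: "i < ?l" for i
  proof (rule card_seteq[symmetric])
    have "finite (es ! i)" using sub_verts[OF es_edge[OF i]] fin_verts by (rule finite_subset)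
    then show "finite {v \<in> es ! i. ?d v = 2}" by simp
    show "{vs ! i, vs ! (Suc i mod ?l)} \<subseteq> {v \<in> es ! i. ?d v = 2}"
      using inc[OF i] vs_two i lt by auto
    have "vs ! i \<noteq> vs ! (Suc i mod ?l)"
      using lt[of i] i l Suc_mod_neq[OF i l(1)] by (simp add: nth_eq_iff_index_eq)
    then show "card {v \<in> es ! i. ?d v = 2} \<le> card {vs ! i, vs ! (Suc i mod ?l)}"
      using pair[OF es_edge[OF i]] by simp
  qed
  \<comment> \<open>A vertex shared with another hyperedge has degree \<open>2\<close>, hence lies
    on the cycle, where both of its hyperedges belong to \<open>es\<close>.\<close>
  have closed: "e \<in> set es" if e: "e \<in> edges H" and u: "u \<in> e" "u \<in> es ! i" "i < ?l" for e u i
  proof (cases "e = es ! i")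
    case False
    then have "?d u = 2" using star[OF e es_edge[OF u(3)] False u(1,2)] by simp
    then have "u \<in> {vs ! i, vs ! (Suc i mod ?l)}" using two_es[OF u(3)] u(2) by blast
    then show ?thesis using vs_two(2)[OF u(3)] vs_two(2)[OF lt] e u(1) by blast
  qed (use u l in auto)
  let ?U = "\<Union>(set es)"
  have step: "w \<in> ?U" if "u \<in> ?U" "(u, w) \<in> adjacent H" for u w
  proof -
    obtain e where e: "e \<in> edges H" "u \<in> e" "w \<in> e" using \<open>(u, w) \<in> adjacent H\<close> by (auto simp: adjacent_def)
    obtain i where "i < ?l" "u \<in> es ! i" using \<open>u \<in> ?U\<close> l(2) by (auto simp: in_set_conv_nth)
    then show ?thesis using closed[OF e(1,2)] e(3) by blast
  qed
  have reach: "w \<in> ?U" if "(u, w) \<in> (adjacent H)\<^sup>*" "u \<in> ?U" for u w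
    using that by (induction rule: rtrancl_induct) (use step in blast)+
  have "0 < ?l" using l(1) by linarith
  then have "vs ! 0 \<in> es ! 0" "es ! 0 \<in> set es" using inc(1) l(2) by auto
  then have v0: "vs ! 0 \<in> ?U" "vs ! 0 \<in> verts H" using sub_verts es_sub by blast+
  have verts_U: "verts H = ?U"
  proof
    show "verts H \<subseteq> ?U" using reach[OF _ v0(1)] conn v0(2) by (auto simp only: connected_hypergraph_def)
    show "?U \<subseteq> verts H" using sub_verts es_sub by blast
  qed
  have "edges H \<subseteq> set es"
  proof
    fix e assume e: "e \<in> edges H"
    then obtain u where u: "u \<in> e" using hyp by (auto simp: is_hypergraph_def)
    then have "u \<in> ?U" using sub_verts[OF e] verts_U by blast
    then obtain i where "i < ?l" "u \<in> es ! i" using l(2) by (auto simp: in_set_conv_nth)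
    then show "e \<in> set es" using closed[OF e u] by blast
  qed
  then have E: "edges H = set es" using es_sub by blast
  then have lm: "?l = m" using cardE l by (simp add: distinct_card)
  \<comment> \<open>\<open>Q j\<close> lists the vertices of \<open>es ! j\<close> off the cycle.
    They become the images of the \<open>j\<close>-th block of new vertices, with the remainder
    modulo \<open>k - 2\<close> as position.\<close>
  define Q where "Q j = sorted_list_of_set (es ! j - {vs ! j, vs ! (Suc j mod m)})" for j
  define f where "f v = (if v < m then vs ! v else Q ((v - m) div (k - 2)) ! ((v - m) mod (k - 2)))" for v
  have Q: "set (Q j) = es ! j - {vs ! j, vs ! (Suc j mod m)}" "length (Q j) = k - 2" if j: "j < m" for j
  proof -
    have j': "j < ?l" using j lm by simp
    have fin: "finite (es ! j)" using sub_verts[OF es_edge[OF j']] fin_verts by (rule finite_subset)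
    then show "set (Q j) = es ! j - {vs ! j, vs ! (Suc j mod m)}" by (simp add: Q_def)
    have "vs ! j \<noteq> vs ! (Suc j mod m)"
      using lt[of j] j' l Suc_mod_neq[OF j' l(1)] lm by (simp add: nth_eq_iff_index_eq)
    then have "card {vs ! j, vs ! (Suc j mod m)} = 2" by simp
    moreover have "{vs ! j, vs ! (Suc j mod m)} \<subseteq> es ! j" using inc[OF j'] lm by simp
    moreover have "card (es ! j) = k" using unif es_edge[OF j'] by (simp add: uniform_def)
    ultimately show "length (Q j) = k - 2" unfolding Q_def
      using fin by (simp add: card_Diff_subset)
  qed
  have f_edge: "f ` cycle_edge k m j = es ! j" if j: "j < m" for j
  proof -
    have "Suc j mod m < m" using m by (intro mod_less_divisor) simp
    then have core: "f ` {j, Suc j mod m} = {vs ! j, vs ! (Suc j mod m)}" using j by (simp add: f_def)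
    have f_private: "f (m + j * (k - 2) + t) = Q j ! t" if "t < k - 2" for t
    proof -
      have "(j * (k - 2) + t) div (k - 2) = j" "(j * (k - 2) + t) mod (k - 2) = t" using that by auto
      then show ?thesis unfolding f_def by (simp add: add.assoc)
    qed
    have "{m + j * (k - 2)..<m + Suc j * (k - 2)} = (\<lambda>t. m + j * (k - 2) + t) ` {0..<k - 2}"
      by (simp add: add.commute add.left_commute)
    then have "f ` {m + j * (k - 2)..<m + Suc j * (k - 2)} = (\<lambda>t. Q j ! t) ` {0..<k - 2}"
      using f_private by (simp only: image_image) (auto intro!: image_cong)
    also have "\<dots> = set (Q j)" using Q(2)[OF j] by (metis list.set_map map_nth set_upt)
    finally have "f ` cycle_edge k m j = {vs ! j, vs ! (Suc j mod m)} \<union> set (Q j)"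
      unfolding cycle_edge_def image_Un core by simp
    then show ?thesis using Q(1)[OF j] inc[of j] j lm by auto
  qed
  let ?X = "hypercycle k m"
  have vX: "verts ?X = (\<Union>j<m. cycle_edge k m j)"
    unfolding verts_def nverts_hypercycle Union_cycle_edge[OF k m] ..
  have "f ` verts ?X = (\<Union>j<m. es ! j)" unfolding vX image_UN using f_edge by simp
  also have "\<dots> = ?U"
  proof -
    have "set es = (\<lambda>j. es ! j) ` {..<m}" using l(2) lm by (auto simp: set_conv_nth)
    then show ?thesis by simp
  qed
  finally have img: "f ` verts ?X = verts H" using verts_U by simp
  \<comment> \<open>Injectivity is not checked by cases: a map onto a finite set of the same size is
    injective.\<close>
  moreover have "card (verts ?X) = card (verts H)" by (simp add: verts_def nverts_hypercycle nv)
  ultimately have inj: "inj_on f (verts ?X)" by (intro eq_card_imp_inj_on) (auto simp: verts_def)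
  let ?g = "inv_into (verts ?X) f"
  have "bij_betw ?g (verts H) (verts ?X)"
    using inj img by (intro bij_betw_inv_into) (simp add: bij_betw_def)
  moreover have "(\<lambda>e. ?g ` e) ` edges H = edges ?X"
  proof -
    have "edges H = (\<lambda>j. f ` cycle_edge k m j) ` {0..<m}"
      unfolding E using f_edge l(2) lm by (auto simp: set_conv_nth)
    moreover have "?g ` f ` cycle_edge k m j = cycle_edge k m j" if "j < m" for j
      using inv_into_image_cancel[OF inj, of "cycle_edge k m j"] vX that by blast
    ultimately show ?thesis unfolding edges_hypercycle by (simp add: image_image)
  qed
  ultimately show ?thesis unfolding isomorphic_def by blast
qed

section \<open>The comparison\<close>

text \<open>On \<open>{1, 2}\<close> every function agrees with an affine one, so its sum is
  determined by the number of terms and the degree sum.\<close>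

lemma sum_over_degrees:
  fixes D :: "nat \<Rightarrow> nat" and g :: "nat \<Rightarrow> real"
  assumes D: "\<And>i. i < n \<Longrightarrow> D i = 1 \<or> D i = 2" and sum_D: "(\<Sum>i<n. D i) = n + m"
  shows "(\<Sum>i<n. g (D i)) = real n * g 1 + real m * (g 2 - g 1)"
proof -
  have "(\<Sum>i<n. g (D i)) = (\<Sum>i<n. g 1 + (real (D i) - 1) * (g 2 - g 1))"
    using D by (intro sum.cong) fastforce+
  also have "\<dots> = real n * g 1 + (real (\<Sum>i<n. D i) - real n) * (g 2 - g 1)"
    by (simp add: sum.distrib sum_subtractf flip: sum_distrib_right)
  finally show ?thesis unfolding sum_D by simp
qed

text \<open>\<open>d^2 = 3 d - 2 + (d - 1) (d - 2)\<close>, and for natural \<open>d\<close> the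
  last product is nonnegative, with value \<open>0\<close> only at \<open>1\<close> and
  \<open>2\<close>.\<close>

lemma sum_power2_degrees_gt:
  fixes D :: "nat \<Rightarrow> nat"
  assumes sum_D: "(\<Sum>i<n. D i) = n + m"
    and i: "i < n" "D i \<noteq> 1" "D i \<noteq> 2"
  shows "real n + 3 * real m < (\<Sum>i<n. real (D i) ^ 2)"
proof -
  have nonneg: "(real d - 1) * (real d - 2) \<ge> 0" for d
  proof (cases "d = 0 \<or> d = 1")
    case False
    then show ?thesis by (intro mult_nonneg_nonneg) auto
  qed auto
  have "(\<Sum>i<n. (real (D i) - 1) * (real (D i) - 2)) = (\<Sum>i<n. real (D i) ^ 2 + 2 - 3 * real (D i))"
    by (simp add: power2_eq_square algebra_simps)
  also have "\<dots> = (\<Sum>i<n. real (D i) ^ 2) + 2 * real n - 3 * real (\<Sum>i<n. D i)"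
    by (simp add: sum.distrib sum_subtractf sum_distrib_left)
  finally have eq: "(\<Sum>i<n. real (D i) ^ 2) = real n + 3 * real m + (\<Sum>i<n. (real (D i) - 1) * (real (D i) - 2))"
    unfolding sum_D by simp
  have "(real (D i) - 1) * (real (D i) - 2) > 0"
  proof (cases "D i = 0")
    case False
    then have "D i \<ge> 3" using i by linarith
    then show ?thesis by (intro mult_pos_pos) auto
  qed simp
  then have "(\<Sum>i<n. (real (D i) - 1) * (real (D i) - 2)) > 0"
    using i(1) nonneg by (intro sum_pos2[of _ i]) auto
  then show "real n + 3 * real m < (\<Sum>i<n. real (D i) ^ 2)" unfolding eq by simp
qed

text \<open>The variance identity; the second sum is positive as soon as one value differs from the
  mean.\<close>

lemma sum_power2_around_mean:
  fixes z :: "'a \<Rightarrow> real"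
  assumes "finite E" "(\<Sum>e\<in>E. z e) = real (card E) * c"
  shows "(\<Sum>e\<in>E. (z e)\<^sup>2) = real (card E) * c\<^sup>2 + (\<Sum>e\<in>E. (z e - c)\<^sup>2)"
proof -
  have "(\<Sum>e\<in>E. (z e - c)\<^sup>2) = (\<Sum>e\<in>E. (z e)\<^sup>2 + c\<^sup>2 - 2 * c * z e)"
    by (simp add: power2_diff algebra_simps)
  also have "\<dots> = (\<Sum>e\<in>E. (z e)\<^sup>2) + real (card E) * c\<^sup>2 - 2 * c * (\<Sum>e\<in>E. z e)"
    by (simp add: sum.distrib sum_subtractf sum_distrib_left)
  finally show ?thesis unfolding assms(2) by (simp add: power2_eq_square)
qed

text \<open>The order compares traces only at indices below the number of eigenvalues. That number
  is at least \<open>6 (k - 1)\<close>, which leaves room for \<open>k + 2\<close>.\<close>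

lemma trace_index_in_range:
  assumes "k \<ge> (3::nat)" "m \<ge> 3" "n = m * (k - 1)"
  shows "k + 2 \<le> n * (k - 1) ^ (n - 1) - 1"
proof -
  have "3 * (k - 1) \<le> n" using assms by simp
  moreover have "2 \<le> (k - 1) ^ (n - 1)"
  proof -
    have "n - 1 \<noteq> 0" using \<open>3 * (k - 1) \<le> n\<close> assms(1) by linarith
    then have "(k - 1) ^ 1 \<le> (k - 1) ^ (n - 1)" using assms(1) by (intro power_increasing) auto
    then show ?thesis using assms(1) by simp
  qed
  ultimately have "3 * (k - 1) * 2 \<le> n * (k - 1) ^ (n - 1)" by (rule mult_le_mono)
  then show ?thesis using assms(1) by linarith
qed

lemma hypercycle_less:
  assumes k: "k \<ge> 3" and m: "m \<ge> 3" and \<alpha>: "0 < \<alpha>" "\<alpha> < 1"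
    and H: "H \<in> linear_unicyclic_hypergraphs k m" and not_iso: "\<not> isomorphic H (hypercycle k m)"
  shows "S_alpha_less k \<alpha> (hypercycle k m) H"
proof -
  let ?X = "hypercycle k m"
  define n where "n = m * (k - 1)"
  have H': "is_hypergraph H" "uniform k H" "linear_hypergraph H" "unicyclic H" "card (edges H) = m"
    using H by (auto simp: linear_unicyclic_hypergraphs_def)
  interpret H: linear_uniform H k by unfold_locales (use H' k in auto)
  interpret X: linear_uniform ?X k by unfold_locales (use hypercycle_wf[OF k m] k in auto)
  have cardX: "card (edges ?X) = m" using hypercycle_wf[OF k m] by simp
  \<comment> \<open>Removes the truncated subtractions, so that \<open>m + m * (k - 2)\<close> and
    \<open>m * (k - 1)\<close> can be identified.\<close>
  obtain k' where k': "k = Suc (Suc k')" using k by (metis Suc_le_D numeral_3_eq_3 Suc_le_mono)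
  have nX: "nverts ?X = n" unfolding nverts_hypercycle n_def k' by simp
  have nH: "nverts H = n" using unicyclic_nverts[OF H'(1,2,4)] H'(5) unfolding n_def k' by simp
  have km: "k * m = n + m" unfolding n_def k' by simp
  have sumH: "(\<Sum>i<n. vertex_degree H i) = n + m" using H.sum_degrees nH H'(5) km by simp
  have degX: "vertex_degree ?X i = 1 \<or> vertex_degree ?X i = 2" if "i < n" for i
    using degree_hypercycle[OF k m, of i] that nX unfolding nverts_hypercycle by auto
  have sumX: "(\<Sum>i<n. vertex_degree ?X i) = n + m" using X.sum_degrees nX cardX km by simp
  have n_pos: "0 < n" using k m by (simp add: n_def)
  define K where "K = real ((k - 1) ^ (n - 1))"
  have K: "K > 0" using k by (simp add: K_def)
  have S2X: "(\<Sum>i<n. real (vertex_degree ?X i) ^ 2) = real n + 3 * real m"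
    using sum_over_degrees[OF degX sumX, of "\<lambda>d. real d ^ 2"] by simp
  have Tr0: "Tr k n 0 (A_alpha k \<alpha> ?X) = Tr k n 0 (A_alpha k \<alpha> H)" by (simp add: Tr_def)
  have range: "k + 2 \<le> n * (k - 1) ^ (n - 1) - 1" by (rule trace_index_in_range[OF k m n_def])
  show ?thesis
  proof (cases "\<forall>i<n. vertex_degree H i = 1 \<or> vertex_degree H i = 2")
    case False
    then obtain i where "i < n" "vertex_degree H i \<noteq> 1" "vertex_degree H i \<noteq> 2" by blast
    from sum_power2_degrees_gt[OF sumH this]
    have S2: "(\<Sum>i<n. real (vertex_degree ?X i) ^ 2) < (\<Sum>i<n. real (vertex_degree H i) ^ 2)"
      unfolding S2X .
    \<comment> \<open>Since \<open>2 < k\<close>, only the vertex part is present at this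
      order.\<close>
    have d: "1 \<le> (2::nat)" "2 < k" using k by simp_all
    have "weight n k (replicate 2 (replicate k 0)) * \<alpha>\<^sup>2 > 0"
      using weight_replicate_pos[OF n_pos] \<alpha> by simp
    then have "Tr k n 2 (A_alpha k \<alpha> ?X) < Tr k n 2 (A_alpha k \<alpha> H)"
      unfolding X.Tr_below_k[OF d, of \<alpha>, unfolded nX, folded K_def] H.Tr_below_k[OF d, of \<alpha>, unfolded nH, folded K_def]
      by (intro mult_strict_left_mono S2 K)
    moreover have "Tr k n 1 (A_alpha k \<alpha> ?X) = Tr k n 1 (A_alpha k \<alpha> H)"
    proof -
      have "(\<Sum>i<n. real (vertex_degree ?X i) ^ 1) = (\<Sum>i<n. real (vertex_degree H i) ^ 1)"
        using sumX sumH by (simp flip: of_nat_sum)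
      then show ?thesis
        using X.Tr_below_k[of 1 \<alpha>] H.Tr_below_k[of 1 \<alpha>] k unfolding nX nH by simp
    qed
    then have "\<forall>t<2. Tr k n t (A_alpha k \<alpha> ?X) = Tr k n t (A_alpha k \<alpha> H)"
      using Tr0 by (auto simp: less_2_cases_iff)
    moreover have "2 \<in> {1..n * (k - 1) ^ (n - 1) - 1}" using range by simp
    ultimately show ?thesis unfolding S_alpha_less_def using nX nH by blast
  next
    case True
    then have degH: "vertex_degree H i = 1 \<or> vertex_degree H i = 2" if "i < n" for i using that by blast
    have S: "(\<Sum>i<n. real (vertex_degree ?X i) ^ p) = (\<Sum>i<n. real (vertex_degree H i) ^ p)" for p
      using sum_over_degrees[OF degX sumX, of "\<lambda>d. real d ^ p"] sum_over_degrees[OF degH sumH, of "\<lambda>d. real d ^ p"]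
      by simp
    define zX where "zX e = (\<Sum>i\<in>e. real (vertex_degree ?X i))" for e
    define zH where "zH e = (\<Sum>i\<in>e. real (vertex_degree H i))" for e
    have zX: "zX e = real (k + 2)" if "e \<in> edges ?X" for e
      using that degree_sum_cycle_edge[OF k m] unfolding edges_hypercycle zX_def by auto
    \<comment> \<open>Double counting turns the total into the sum of squared degrees, which is
      \<open>n + 3 m = m (k + 2)\<close>.\<close>
    have "(\<Sum>e\<in>edges H. zH e) = (\<Sum>i<n. real (vertex_degree H i) ^ 2)"
      unfolding zH_def H.sum_over_edges nH by (simp add: power2_eq_square)
    also have "\<dots> = real (card (edges H)) * real (k + 2)"
    proof -
      have "real (k * m) = real n + real m" using km by simp
      then show ?thesis using S[of 2] S2X H'(5) by (simp add: algebra_simps)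
    qed
    finally have sum_zH: "(\<Sum>e\<in>edges H. zH e) = real (card (edges H)) * real (k + 2)" .
    have zH2: "(\<Sum>e\<in>edges H. (zH e)\<^sup>2) = (\<Sum>e\<in>edges ?X. (zX e)\<^sup>2) + (\<Sum>e\<in>edges H. (zH e - real (k + 2))\<^sup>2)"
      unfolding sum_power2_around_mean[OF H.finite_edges sum_zH] using zX H'(5) cardX by simp
    have "\<exists>e\<in>edges H. zH e \<noteq> real (k + 2)"
    proof (rule ccontr)
      assume "\<not> ?thesis"
      then have zH: "zH e = real (k + 2)" if "e \<in> edges H" for e using that by blast
      have pair: "card {v \<in> e. vertex_degree H v = 2} = 2" if e: "e \<in> edges H" for e
      proof -
        \<comment> \<open>A degree is \<open>1\<close> plus the indicator of degree
          \<open>2\<close>, so \<open>zH e = k + 2\<close> says that \<open>e\<close> has exactly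
          two vertices of degree \<open>2\<close>.\<close>
        have "zH e = (\<Sum>v\<in>e. 1 + (if vertex_degree H v = 2 then 1 else 0))"
          unfolding zH_def using degH H.edge_subset[OF e] nH by (intro sum.cong) fastforce+
        also have "\<dots> = real (card e) + real (card {v \<in> e. vertex_degree H v = 2})"
          unfolding sum.distrib using H.finite_edge[OF e] by (simp add: sum.If_cases Int_def)
        finally show ?thesis using zH[OF e] H.card_edge[OF e] by simp
      qed
      obtain vs es where cyc: "cycle_seq H vs es"
        using H'(4) unfolding unicyclic_def cycles_def by blast
      have "nverts H = m + m * (k - 2)" using nH nX unfolding nverts_hypercycle by simp
      moreover have "vertex_degree H v \<le> 2" if "v \<in> verts H" for v
        using degH[of v] that nH by (auto simp: verts_def)
      ultimately have "isomorphic H ?X"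
        using isomorphic_hypercycle[OF H'(1,2) _ cyc _ H'(5) k m _ pair] H'(4) by (auto simp: unicyclic_def)
      with not_iso show False ..
    qed
    then obtain e0 where e0: "e0 \<in> edges H" "zH e0 \<noteq> real (k + 2)" by blast
    have "(\<Sum>e\<in>edges H. (zH e - real (k + 2))\<^sup>2) > 0"
      using e0 H.finite_edges by (intro sum_pos2[of _ e0]) auto
    then have less: "(\<Sum>e\<in>edges ?X. (zX e)\<^sup>2) < (\<Sum>e\<in>edges H. (zH e)\<^sup>2)" unfolding zH2 by simp
    have "k \<le> n"
      using H.card_edge[OF e0(1)] card_mono[OF _ H.edge_subset[OF e0(1)]] nH by simp
    then have coeff: "edge_coeff n k (k + 2) {0..<k} [0, 1] > 0"
      using k by (intro edge_coeff_pair_pos) auto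
    have "((1 - \<alpha>) / fact (k - 1)) ^ k * \<alpha>\<^sup>2 > 0" using \<alpha> by simp
    then have "Tr k n (k + 2) (A_alpha k \<alpha> ?X) < Tr k n (k + 2) (A_alpha k \<alpha> H)"
      \<comment> \<open>Rewriting with \<open>S\<close> equates all power sums, the cubes included,
        so the two sides differ only in the squared degree sums of the hyperedges.\<close>
      unfolding X.Tr_Suc_Suc_k[of \<alpha>, unfolded nX, folded K_def zX_def]
        H.Tr_Suc_Suc_k[of \<alpha>, unfolded nH, folded K_def zH_def] S
      by (intro mult_strict_left_mono add_strict_left_mono less coeff K)
    moreover have "Tr k n t (A_alpha k \<alpha> ?X) = Tr k n t (A_alpha k \<alpha> H)" if t: "t < k + 2" for t
    proof -
      consider "t = 0" | "1 \<le> t" "t < k" | "t = k" | "t = k + 1" using t by linarith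
      then show ?thesis
      proof cases
        case 1
        then show ?thesis using Tr0 by simp
      next
        case 2
        then show ?thesis using X.Tr_below_k[OF 2, of \<alpha>] H.Tr_below_k[OF 2, of \<alpha>] unfolding nX nH S by simp
      next
        case 3
        then show ?thesis using X.Tr_k[of \<alpha>] H.Tr_k[of \<alpha>] H'(5) cardX unfolding nX nH S by simp
      next
        case 4
        then show ?thesis using X.Tr_Suc_k[of \<alpha>] H.Tr_Suc_k[of \<alpha>] unfolding nX nH S by simp
      qed
    qed
    moreover have "k + 2 \<in> {1..n * (k - 1) ^ (n - 1) - 1}" using range by simp
    ultimately show ?thesis unfolding S_alpha_less_def using nX nH by blast
  qed
qed

theorem theorem5p6:
  fixes k m :: nat and \<alpha> :: real
  assumes "k \<ge> 3" and "m \<ge> 3" and "0 < \<alpha>" and "\<alpha> < 1"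
  shows "first_in_S_alpha_order k \<alpha> (linear_unicyclic_hypergraphs k m) (hypercycle k m)"
  unfolding first_in_S_alpha_order_def
  using hypercycle_in_class hypercycle_less assms by blast

end
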